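(* Let $n\ge 2$, $0<\alpha\le 1$, let $\Omega\subset\mathbb{R}^n$ be a H\"older-$\alpha$ domain, and let $s\in(0,1)$, $1<p\le q<\infty$ and $b\in\mathbb{R}$ satisfy $$b\le p(s-n)+p(n-1+\alpha)\left(1+\frac1q-\frac1p\right)$$ and, additionally, $q\le\frac{np}{n-sp}$ when $p<\frac{n}{s}$. Then there exists a constant $C>0$, independent of $f$, such that for every $f\in C^\infty(\Omega)$ $$ \inf_{c\in\mathbb{R}}\|f-c\|_{L^q(\Omega)}\le C\left\{\int_\Omega\int_{|x-z|\le d(x)/2}\frac{|f(z)-f(x)|^p}{|z-x|^{n+sp}}\,\delta(x,z)^b\,dz\,dx\right\}^{1/p}. $$
   Context: $d(x)=\mathrm{dist}(x,\partial\Omega)$ for $x\in\Omega$; $\delta(x,z)=\min\{d(x),d(z)\}$. Both sides of the inequality are allowed to take the value $+\infty$. H\"older-$\alpha$ domain: a bounded domain $\Omega\subset\mathbb{R}^n$ which is locally the hypograph, in an appropriate orthogonal coordinate system, of a H\"older-$\alpha$ function; that is, there are finitely many open sets $O_0,O_1,\dots,O_N$ covering $\overline\Omega$ with $\overline{O_0}\subset\Omega$ and such that, for each $1\le j\le N$, there are an orthogonal coordinate system $x=(x',x_n)$, $x'\in\mathbb{R}^{n-1}$, $x_n\in\mathbb{R}$, and a H\"older continuous function $\phi_j:\mathbb{R}^{n-1}\to\mathbb{R}$ of exponent $\alpha$ for which $\Omega\cap O_j=\{x\in O_j: x_n<\phi_j(x')\}$ in these coordinates. *)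

theory Defs
  imports "HOL-Analysis.Analysis"
begin

definition holder_on :: "real \<Rightarrow> 'a::metric_space set \<Rightarrow> ('a \<Rightarrow> 'b::metric_space) \<Rightarrow> bool" where
  "holder_on \<alpha> S f \<longleftrightarrow>
     (\<exists>L. \<forall>x\<in>S. \<forall>y\<in>S. dist (f x) (f y) \<le> L * dist x y powr \<alpha>)"

text \<open>An orthogonal coordinate system enters the definition of a Hoelder domain only through
  the unit vector \<open>e\<close> of its last axis: the last coordinate of \<open>x\<close> is \<open>x \<bullet> e\<close>, and the space of the
  remaining coordinates is the hyperplane orthogonal to \<open>e\<close> (an isometric copy of Euclidean
  space of one dimension less), onto which \<open>x\<close> projects as \<open>x - (x \<bullet> e) *\<^sub>R e\<close>.  A shift of the
  origin is absorbed by \<open>\<phi>\<close>, whose values off the hyperplane are irrelevant.\<close>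

definition holder_hypograph_in ::
  "real \<Rightarrow> 'a::euclidean_space set \<Rightarrow> 'a set \<Rightarrow> bool" where
  "holder_hypograph_in \<alpha> U \<Omega> \<longleftrightarrow>
     (\<exists>e \<phi>. norm e = 1 \<and> holder_on \<alpha> {y. y \<bullet> e = 0} \<phi> \<and>
        \<Omega> \<inter> U = {x \<in> U. x \<bullet> e < \<phi> (x - (x \<bullet> e) *\<^sub>R e)})"

definition holder_domain :: "real \<Rightarrow> 'a::euclidean_space set \<Rightarrow> bool" where
  "holder_domain \<alpha> \<Omega> \<longleftrightarrow>
     open \<Omega> \<and> connected \<Omega> \<and> \<Omega> \<noteq> {} \<and> bounded \<Omega> \<and>
     (\<exists>(N::nat) U. (\<forall>j\<le>N. open (U j)) \<and> closure \<Omega> \<subseteq> (\<Union>j\<le>N. U j) \<and>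
        closure (U 0) \<subseteq> \<Omega> \<and> (\<forall>j\<in>{1..N}. holder_hypograph_in \<alpha> (U j) \<Omega>))"

text \<open>For open \<open>S\<close>: all directional derivatives up to order \<open>k\<close> exist as Frechet derivatives
  and are continuous on \<open>S\<close>.\<close>

primrec Ck_on ::
  "nat \<Rightarrow> ('a::euclidean_space \<Rightarrow> 'b::real_normed_vector) \<Rightarrow> 'a set \<Rightarrow> bool" where
  "Ck_on 0 f S \<longleftrightarrow> continuous_on S f"
| "Ck_on (Suc k) f S \<longleftrightarrow>
     (\<forall>x\<in>S. f differentiable (at x)) \<and>
     (\<forall>v. Ck_on k (\<lambda>x. frechet_derivative f (at x) v) S)"

definition smooth_on ::
  "('a::euclidean_space \<Rightarrow> 'b::real_normed_vector) \<Rightarrow> 'a set \<Rightarrow> bool" where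
  "smooth_on f S \<longleftrightarrow> (\<forall>k. Ck_on k f S)"

text \<open>Real powers on the extended half-line, for exponents \<open>r > 0\<close>.\<close>

definition ennpowr :: "ennreal \<Rightarrow> real \<Rightarrow> ennreal" where
  "ennpowr t r = (if t = \<infinity> then \<infinity> else ennreal (enn2real t powr r))"

definition Lq_norm :: "real \<Rightarrow> 'a::euclidean_space set \<Rightarrow> ('a \<Rightarrow> real) \<Rightarrow> ennreal" where
  "Lq_norm q \<Omega> f = ennpowr (\<integral>\<^sup>+x\<in>\<Omega>. ennreal (\<bar>f x\<bar> powr q) \<partial>lborel) (1 / q)"

definition bdist :: "'a::euclidean_space set \<Rightarrow> 'a \<Rightarrow> real" where
  "bdist \<Omega> x = infdist x (frontier \<Omega>)"

text \<open>Since \<open>bdist \<Omega> x\<close> is the distance to the boundary, the inner domain of integration lies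
  in \<open>\<Omega>\<close> for every \<open>x\<close> in an open set \<open>\<Omega>\<close> with nonempty boundary.\<close>

definition weighted_frac_seminorm ::
  "real \<Rightarrow> real \<Rightarrow> real \<Rightarrow> 'a::euclidean_space set \<Rightarrow> ('a \<Rightarrow> real) \<Rightarrow> ennreal" where
  "weighted_frac_seminorm s p b \<Omega> f =
     ennpowr
       (\<integral>\<^sup>+x\<in>\<Omega>. (\<integral>\<^sup>+z\<in>{z. norm (x - z) \<le> bdist \<Omega> x / 2}.
            ennreal (\<bar>f z - f x\<bar> powr p / norm (z - x) powr (real DIM('a) + s * p)
                       * min (bdist \<Omega> x) (bdist \<Omega> z) powr b) \<partial>lborel) \<partial>lborel)
       (1 / p)"

end

theory Submission
  imports Defs
begin

text \<open>
  The inequality is reduced to one about sets, in the spirit of Maz'ya's truncation method.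
  Split \<open>f - m\<close>, where \<open>m\<close> is a median of \<open>f\<close> over a fixed ball around a point \<open>x0\<close>, into
  its positive and negative parts, and each part \<open>u\<close> into dyadic layers \<open>v\<close> with values
  between 0 and 1. For each layer a capacity-type inequality is proved (\<open>capacity_bound\<close>):
  if \<open>v = 1\<close> on \<open>E\<close>, \<open>v = 0\<close> off \<open>A\<close>, and the average of \<open>v\<close> around \<open>x0\<close> is at most one
  half, then \<open>vol E \<le> C * vol A powr (1 - p / q) * energy v\<close>. The energies of the layers,
  suitably scaled, add up to at most that of \<open>u\<close> (\<open>energy_layers\<close>), and applying the
  inequality to consecutive superlevel sets gives a recursion whose sum bounds the norm of
  \<open>u\<close> (\<open>superlevel_bound\<close>).

  In the capacity-type inequality the value 1 at a point of \<open>E\<close> is compared with the average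
  at \<open>x0\<close> in three stages, and a fixed part of the drop must occur in one of them. If the
  drop is between the value at \<open>y\<close> and the average over a ball of radius comparable to the
  distance \<open>d y\<close> to the boundary, the singular kernel gives the local Sobolev inequality
  (\<open>local_bound\<close>); this is where the upper bound on \<open>q\<close> is used. If the drop is between
  averages at points far from the boundary, connectedness and compactness bound the energy
  from below (\<open>avg_close_interior\<close>).

  The remaining stage is a descent from a point \<open>y\<close> near the boundary along the axis of a
  chart. The change of the averages along the descent is bounded by an integral of
  oscillations over balls of radius comparable to \<open>d\<close> (\<open>segment_bound\<close>), and a weighted
  Young inequality brings in \<open>p\<close>-th powers (\<open>chain_point\<close>). Integration over \<open>y\<close> in \<open>E\<close> and
  exchange of the integrals leave the shadow of a point \<open>z\<close>: the part of \<open>E\<close> whose descents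
  pass near \<open>z\<close>. The shadow lies in a cylinder of radius comparable to \<open>d z\<close> and, because
  the graph is Hoelder continuous with exponent \<open>\<alpha>\<close>, of height of order \<open>d z powr \<alpha>\<close>, so its
  measure is of order \<open>d z powr (n - 1 + \<alpha>)\<close> at most; this is the origin of the number
  \<open>n - 1 + \<alpha>\<close> in the condition on \<open>b\<close>. Interpolating between this bound and the measure of
  \<open>E\<close> produces the power \<open>1 - p / q\<close> (\<open>shadow_bound\<close>). A weight that is a small negative
  power of the depth below the graph is carried along in order to include the case \<open>p = q\<close>,
  where the unweighted sums over scales diverge as in Hardy's inequality.
\<close>

section \<open>Elementary inequalities\<close>

abbreviation vol :: "'a::euclidean_space set \<Rightarrow> real" where "vol \<equiv> measure lborel"

text \<open>A weighted Young inequality with constants one: when \<open>X > W\<close>, the factor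
  \<open>X powr (1 - p) \<le> W powr (1 - p)\<close> makes the second summand alone at least \<open>X\<close>. It takes
  the place of Hoelder's inequality throughout: \<open>W\<close> is chosen at every point so that its own
  integral is small or explicitly computable.\<close>

lemma le_add_powr_mult:
  fixes X W p :: real
  assumes "0 \<le> X" "0 < W" "1 \<le> p"
  shows "X \<le> W + X powr p * W powr (1 - p)"
proof (cases "X \<le> W")
  case True
  then show ?thesis by (simp add: add_increasing2)
next
  case False
  with assms have "X powr (1 - p) \<le> W powr (1 - p)"
    by (intro powr_mono2') auto
  then have "X powr p * X powr (1 - p) \<le> X powr p * W powr (1 - p)"
    by (intro mult_left_mono) auto
  moreover have "X powr p * X powr (1 - p) = X"
    using False assms by (simp add: powr_add[symmetric])
  ultimately show ?thesis using assms by linarith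
qed

lemma powr_le_of_comparable:
  fixes x y c :: real
  assumes "0 < x" "x / 2 \<le> y" "y \<le> 2 * x"
  shows "y powr c \<le> 2 powr \<bar>c\<bar> * x powr c"
proof (cases "0 \<le> c")
  case True
  then have "y powr c \<le> (2 * x) powr c" using assms by (intro powr_mono2) auto
  then show ?thesis using assms True by (simp add: powr_mult)
next
  case False
  then have "y powr c \<le> (x / 2) powr c" using assms by (intro powr_mono2') auto
  also have "\<dots> = 2 powr \<bar>c\<bar> * x powr c"
    using assms False by (simp add: powr_divide powr_minus_divide)
  finally show ?thesis .
qed

lemma powr_antimono_bounded:
  fixes x R a c :: real
  assumes "0 < x" "x \<le> R" "a \<le> c"
  shows "x powr c \<le> R powr (c - a) * x powr a"
proof -
  have "x powr c = x powr (c - a) * x powr a"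
    using assms by (simp add: powr_add[symmetric])
  also have "\<dots> \<le> R powr (c - a) * x powr a"
    using assms by (intro mult_right_mono powr_mono2) auto
  finally show ?thesis .
qed

section \<open>The distance to the boundary\<close>

text \<open>The \<open>p\<close>-th power of the weighted seminorm. Working with it rather than with its root
  lets the contributions of the dyadic layers of a function be added.\<close>

definition frac_energy ::
  "real \<Rightarrow> real \<Rightarrow> real \<Rightarrow> 'a::euclidean_space set \<Rightarrow> ('a \<Rightarrow> real) \<Rightarrow> ennreal" where
  "frac_energy s p b \<Omega> f =
     (\<integral>\<^sup>+x\<in>\<Omega>. (\<integral>\<^sup>+z\<in>{z. norm (x - z) \<le> bdist \<Omega> x / 2}.
          ennreal (\<bar>f z - f x\<bar> powr p / norm (z - x) powr (real DIM('a) + s * p)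
                     * min (bdist \<Omega> x) (bdist \<Omega> z) powr b) \<partial>lborel) \<partial>lborel)"

locale bounded_region =
  fixes \<Omega> :: "'a::euclidean_space set"
  assumes open_region: "open \<Omega>" and connected_region: "connected \<Omega>"
    and region_ne: "\<Omega> \<noteq> {}" and bounded_region: "bounded \<Omega>"
begin

abbreviation d :: "'a \<Rightarrow> real" where "d \<equiv> bdist \<Omega>"

lemma frontier_ne: "frontier \<Omega> \<noteq> {}"
  using region_ne bounded_region not_bounded_UNIV frontier_eq_empty by metis

lemma dist_nonneg: "0 \<le> d x"
  by (simp add: bdist_def infdist_nonneg)

lemma d_pos: "x \<in> \<Omega> \<Longrightarrow> 0 < d x"
  unfolding bdist_def
  by (rule infdist_pos_not_in_closed)
     (use open_region frontier_ne in \<open>auto simp: frontier_def interior_open\<close>)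

lemma d_lipschitz: "\<bar>d x - d y\<bar> \<le> dist x y"
  unfolding bdist_def by (rule infdist_triangle_abs)

lemma continuous_d: "continuous_on UNIV d"
  unfolding bdist_def by (intro continuous_intros)

lemma measurable_d [measurable]: "d \<in> borel_measurable borel"
  using continuous_d by (rule borel_measurable_continuous_onI)

lemma measurable_region [measurable]: "\<Omega> \<in> sets borel"
  using open_region by simp

text \<open>A ball that leaves \<open>\<Omega>\<close> is connected, so it meets the frontier, which lies at distance
  at least \<open>d x\<close> from \<open>x\<close>.\<close>

lemma ball_subset_region: assumes "x \<in> \<Omega>" shows "ball x (d x) \<subseteq> \<Omega>"
proof (rule ccontr)
  assume "\<not> ?thesis"
  then have "ball x (d x) - \<Omega> \<noteq> {}" by auto
  moreover have "ball x (d x) \<inter> \<Omega> \<noteq> {}" using assms d_pos[OF assms] by force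
  ultimately have "ball x (d x) \<inter> frontier \<Omega> \<noteq> {}"
    by (intro connected_Int_frontier) auto
  then obtain a where "a \<in> frontier \<Omega>" "dist x a < d x" by auto
  then show False using infdist_le[of a "frontier \<Omega>" x] by (simp add: bdist_def)
qed

lemma mem_region: "x \<in> \<Omega> \<Longrightarrow> dist x y < d x \<Longrightarrow> y \<in> \<Omega>"
  using ball_subset_region by force

lemma d_ge: assumes "ball x r \<subseteq> \<Omega>" shows "r \<le> d x"
proof -
  have "r \<le> dist x a" if "a \<in> frontier \<Omega>" for a
    using that assms open_region by (force simp: frontier_def interior_open)
  then show ?thesis
    unfolding bdist_def infdist_def using frontier_ne by (auto intro!: cINF_greatest)
qed

lemma d_bounded: "\<exists>R\<ge>1. \<forall>x\<in>\<Omega>. d x \<le> R"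
proof -
  obtain a where a: "a \<in> frontier \<Omega>" using frontier_ne by auto
  obtain B where B: "\<And>x. x \<in> \<Omega> \<Longrightarrow> dist a x \<le> B"
    using bounded_region unfolding bounded_any_center[of _ a] by auto
  have "d x \<le> max 1 B" if "x \<in> \<Omega>" for x
    using infdist_le[OF a, of x] B[OF that] by (simp add: bdist_def dist_commute)
  then show ?thesis by (intro exI[of _ "max 1 B"]) auto
qed

lemma emeasure_region_finite: "emeasure lborel \<Omega> < \<infinity>"
  using bounded_region by (rule emeasure_bounded_finite)

lemma emeasure_subset_eq:
  assumes "E \<subseteq> \<Omega>"
  shows "emeasure lborel E = ennreal (vol E)"
  using assms bounded_region
  by (metis bounded_subset emeasure_bounded_finite emeasure_eq_ennreal_measure infinity_ennreal_def less_irrefl)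

end

section \<open>Averages over Whitney balls\<close>

text \<open>The energy depends only on the values in \<open>\<Omega>\<close>, so any measurable extension to the whole
  space will do; a total function keeps the integrals over varying balls easy to write.\<close>

definition unit_valued :: "('a::euclidean_space \<Rightarrow> real) \<Rightarrow> bool" where
  "unit_valued v \<longleftrightarrow> v \<in> borel_measurable borel \<and> (\<forall>x. 0 \<le> v x \<and> v x \<le> 1)"

lemma unit_valued_measurable: "unit_valued v \<Longrightarrow> v \<in> borel_measurable borel"
  by (simp add: unit_valued_def)

lemma integrable_unit_valued:
  assumes "unit_valued v" "B \<in> sets borel" "bounded B"
  shows "integrable lborel (\<lambda>z. indicator B z * v z :: real)"
proof (rule Bochner_Integration.integrable_bound)
  show "integrable lborel (indicator B :: 'a \<Rightarrow> real)"
    using assms emeasure_bounded_finite[of B] by (simp add: integrable_indicator_iff)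
  show "(\<lambda>z. indicator B z * v z :: real) \<in> borel_measurable lborel"
    using assms unit_valued_measurable[OF assms(1)] by measurable
qed (use assms in \<open>auto simp: unit_valued_def split: split_indicator\<close>)

text \<open>Used twice in a row, with the second mean as the constant of the first, this compares
  the means over two different sets.\<close>

lemma mean_diff_le:
  assumes v: "unit_valued v" and B: "B \<in> sets borel" "bounded B" and m: "0 < vol B"
  shows "ennreal (vol B) *
           ennreal \<bar>(\<integral>z. indicator B z * v z \<partial>lborel) / vol B - c\<bar>
         \<le> (\<integral>\<^sup>+z. indicator B z * ennreal \<bar>v z - c\<bar> \<partial>lborel)"
proof -
  let ?m = "vol B"
  have i1: "integrable lborel (\<lambda>z. indicator B z * v z :: real)"
    by (rule integrable_unit_valued[OF v B])
  have i2: "integrable lborel (\<lambda>z. c * indicator B z :: real)"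
    using B emeasure_bounded_finite[of B] by (auto simp: integrable_indicator_iff)
  have i: "integrable lborel (\<lambda>z. indicator B z * (v z - c) :: real)"
    using Bochner_Integration.integrable_diff[OF i1 i2] by (simp add: algebra_simps)
  have "(\<integral>z. indicator B z * (v z - c) \<partial>lborel)
      = (\<integral>z. indicator B z * v z \<partial>lborel) - (\<integral>z. c * indicator B z \<partial>lborel)"
    using Bochner_Integration.integral_diff[OF i1 i2] by (simp add: algebra_simps)
  also have "(\<integral>z. c * indicator B z \<partial>lborel) = c * ?m"
    using B by simp
  finally have eq: "(\<integral>z. indicator B z * (v z - c) \<partial>lborel)
      = (\<integral>z. indicator B z * v z \<partial>lborel) - c * ?m" .
  have "?m * \<bar>I / ?m - c\<bar> = \<bar>I - c * ?m\<bar>" for I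
  proof -
    have "?m * \<bar>I / ?m - c\<bar> = \<bar>?m * (I / ?m - c)\<bar>" using m by (subst abs_mult) simp
    also have "?m * (I / ?m - c) = I - c * ?m" using m by (simp add: field_simps)
    finally show ?thesis .
  qed
  then have "?m * \<bar>(\<integral>z. indicator B z * v z \<partial>lborel) / ?m - c\<bar>
      = \<bar>\<integral>z. indicator B z * (v z - c) \<partial>lborel\<bar>" unfolding eq .
  then have "ennreal ?m * ennreal \<bar>(\<integral>z. indicator B z * v z \<partial>lborel) / ?m - c\<bar>
      = ennreal (norm (\<integral>z. indicator B z * (v z - c) \<partial>lborel))"
    using m by (subst ennreal_mult[symmetric]) (auto simp: mult.commute)
  also have "\<dots> \<le> (\<integral>\<^sup>+z. ennreal (norm (indicator B z * (v z - c))) \<partial>lborel)"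
    by (rule integral_norm_bound_ennreal[OF i])
  also have "\<dots> = (\<integral>\<^sup>+z. indicator B z * ennreal \<bar>v z - c\<bar> \<partial>lborel)"
    by (intro nn_integral_cong) (auto split: split_indicator)
  finally show ?thesis .
qed

lemma unit_ball_vol_neq_0 [simp]: "unit_ball_vol (real k) \<noteq> 0"
  by (rule less_imp_neq[symmetric]) simp

lemma measure_ball:
  fixes c :: "'a::euclidean_space"
  assumes "0 \<le> r"
  shows "vol (ball c r) = unit_ball_vol DIM('a) * r ^ DIM('a)"
  using assms content_ball[of r c] by simp

text \<open>The factor \<open>1 / 32\<close> leaves room: even in a ball of radius \<open>5 * bdist \<Omega> \<xi> / 32\<close> around
  \<open>\<xi>\<close>, any two points \<open>z\<close>, \<open>w\<close> satisfy \<open>dist z w \<le> bdist \<Omega> z / 2\<close>, so that they are seen by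
  the energy.\<close>

definition wball :: "'a::euclidean_space set \<Rightarrow> 'a \<Rightarrow> 'a set" where
  "wball \<Omega> x = ball x (bdist \<Omega> x / 32)"

definition avg :: "'a::euclidean_space set \<Rightarrow> ('a \<Rightarrow> real) \<Rightarrow> 'a \<Rightarrow> real" where
  "avg \<Omega> v x = (\<integral>z. indicator (wball \<Omega> x) z * v z \<partial>lborel) / vol (wball \<Omega> x)"

context bounded_region
begin

abbreviation B :: "'a \<Rightarrow> 'a set" where "B \<equiv> wball \<Omega>"
abbreviation F :: "('a \<Rightarrow> real) \<Rightarrow> 'a \<Rightarrow> real" where "F \<equiv> avg \<Omega>"

lemma wball_sets [measurable]: "B x \<in> sets borel" and wball_bounded: "bounded (B x)"
  by (auto simp: wball_def)

lemma measure_wball: "vol (B x) = unit_ball_vol DIM('a) * (d x / 32) ^ DIM('a)"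
  unfolding wball_def by (rule measure_ball) (simp add: dist_nonneg)

lemma measure_wball_pos: "x \<in> \<Omega> \<Longrightarrow> 0 < vol (B x)"
  using d_pos[of x] by (simp add: measure_wball)

lemma avg_measurable:
  assumes "unit_valued v"
  shows "F v \<in> borel_measurable borel"
proof -
  have [measurable]: "v \<in> borel_measurable borel" by (rule unit_valued_measurable[OF assms])
  have eq: "indicator (B x) z * v z = (if dist x z < d x / 32 then v z else 0)" for x z
    by (auto simp: wball_def split: split_indicator)
  show ?thesis
    unfolding avg_def eq measure_wball by measurable
qed

lemma avg_diff_le:
  assumes v: "unit_valued v" and x: "x \<in> \<Omega>" and x': "x' \<in> \<Omega>"
  shows "ennreal (vol (B x) * vol (B x')) * ennreal \<bar>F v x - F v x'\<bar>
     \<le> (\<integral>\<^sup>+z. (\<integral>\<^sup>+w. indicator (B x) z * indicator (B x') w * ennreal \<bar>v z - v w\<bar> \<partial>lborel) \<partial>lborel)"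
proof -
  have [measurable]: "v \<in> borel_measurable borel" by (rule unit_valued_measurable[OF v])
  have "ennreal (vol (B x) * vol (B x')) * ennreal \<bar>F v x - F v x'\<bar>
     = ennreal (vol (B x')) * (ennreal (vol (B x)) * ennreal \<bar>F v x - F v x'\<bar>)"
    by (simp add: ennreal_mult mult_ac)
  also have "\<dots> \<le> ennreal (vol (B x')) * (\<integral>\<^sup>+z. indicator (B x) z * ennreal \<bar>v z - F v x'\<bar> \<partial>lborel)"
    unfolding avg_def[of _ _ x]
    by (intro mult_left_mono mean_diff_le[OF v wball_sets wball_bounded measure_wball_pos[OF x]]) auto
  also have "\<dots> = (\<integral>\<^sup>+z. indicator (B x) z * (ennreal (vol (B x')) * ennreal \<bar>F v x' - v z\<bar>) \<partial>lborel)"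
    by (subst nn_integral_cmult[symmetric]) (auto simp: mult_ac abs_minus_commute)
  also have "\<dots> \<le> (\<integral>\<^sup>+z. indicator (B x) z * (\<integral>\<^sup>+w. indicator (B x') w * ennreal \<bar>v w - v z\<bar> \<partial>lborel) \<partial>lborel)"
    unfolding avg_def[of _ _ x']
    by (intro nn_integral_mono mult_left_mono mean_diff_le[OF v wball_sets wball_bounded measure_wball_pos[OF x']]) auto
  also have "\<dots> = (\<integral>\<^sup>+z. (\<integral>\<^sup>+w. indicator (B x) z * indicator (B x') w * ennreal \<bar>v z - v w\<bar> \<partial>lborel) \<partial>lborel)"
    by (intro nn_integral_cong, subst nn_integral_cmult[symmetric])
       (auto simp: mult_ac abs_minus_commute)
  finally show ?thesis .
qed

text \<open>With exponent one this controls the difference of neighbouring averages; with exponent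
  \<open>p\<close> it is controlled by the energy.\<close>

definition osc :: "real \<Rightarrow> ('a \<Rightarrow> real) \<Rightarrow> 'a \<Rightarrow> ennreal" where
  "osc r v \<xi> = (\<integral>\<^sup>+z. (\<integral>\<^sup>+w. indicator (ball \<xi> (5 * d \<xi> / 32)) z * indicator (ball \<xi> (5 * d \<xi> / 32)) w
                   * ennreal (\<bar>v z - v w\<bar> powr r) \<partial>lborel) \<partial>lborel)"

definition step_const :: real where
  "step_const = (40 ^ DIM('a) / unit_ball_vol DIM('a)) ^ 2"

lemma step_const_pos: "0 < step_const"
  unfolding step_const_def by (rule zero_less_power, rule divide_pos_pos) auto

text \<open>Both averaging balls lie in the larger ball around any \<open>\<xi>\<close> close to \<open>x\<close>, and their
  radii are at least \<open>d \<xi> / 40\<close>. The freedom in \<open>\<xi>\<close> makes it possible to average the bound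
  over a whole segment later on.\<close>

lemma avg_step:
  assumes v: "unit_valued v" and x: "x \<in> \<Omega>" and x': "dist x x' \<le> d x / 32" and xi: "dist x \<xi> \<le> d x / 32"
  shows "ennreal \<bar>F v x - F v x'\<bar> \<le> ennreal (step_const * d \<xi> powr (- 2 * real DIM('a))) * osc 1 v \<xi>"
proof -
  let ?n = "DIM('a)" let ?V = "unit_ball_vol DIM('a)"
  have dx: "0 < d x" by (rule d_pos[OF x])
  have x'O: "x' \<in> \<Omega>" and xiO: "\<xi> \<in> \<Omega>" using mem_region[OF x] x' xi dx by auto
  have dxi: "0 < d \<xi>" by (rule d_pos[OF xiO])
  have a1: "d \<xi> \<le> 33 / 32 * d x" using d_lipschitz[of x \<xi>] xi by linarith
  have a2: "31 / 32 * d x \<le> d x'" using d_lipschitz[of x x'] x' by linarith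
  have a3: "d x' \<le> 33 / 32 * d x" using d_lipschitz[of x x'] x' by linarith
  have a4: "31 / 32 * d x \<le> d \<xi>" using d_lipschitz[of x \<xi>] xi by linarith
  have b1: "d \<xi> / 40 \<le> d x / 32" and b2: "d \<xi> / 40 \<le> d x' / 32" using a1 a2 dx by linarith+
  have "(?V * (d \<xi> / 40) ^ ?n) * (?V * (d \<xi> / 40) ^ ?n) \<le> vol (B x) * vol (B x')"
    unfolding measure_wball using b1 b2 dxi dx
    by (intro mult_mono mult_left_mono power_mono) auto
  moreover have "(?V * (d \<xi> / 40) ^ ?n) * (?V * (d \<xi> / 40) ^ ?n) = 1 / (step_const * d \<xi> powr (- 2 * real ?n))"
  proof -
    have "d \<xi> powr (- 2 * real ?n) = 1 / (d \<xi> ^ ?n * d \<xi> ^ ?n)"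
      using dxi by (simp add: powr_minus_divide powr_realpow[symmetric] powr_add[symmetric])
    then show ?thesis using dxi
      by (simp add: step_const_def power_divide power2_eq_square field_simps)
  qed
  ultimately have le: "1 \<le> (step_const * d \<xi> powr (- 2 * real ?n)) * (vol (B x) * vol (B x'))"
    using step_const_pos dxi by (simp add: field_simps)
  let ?c = "step_const * d \<xi> powr (- 2 * real ?n)" let ?M = "vol (B x) * vol (B x')"
  have c0: "0 \<le> ?c" using step_const_pos by simp
  have "ennreal \<bar>F v x - F v x'\<bar> \<le> ennreal (?c * ?M) * ennreal \<bar>F v x - F v x'\<bar>"
    using le by (subst ennreal_mult[symmetric]) (auto intro!: ennreal_leI simp: mult_le_cancel_right1)
  also have "\<dots> = ennreal ?c * (ennreal ?M * ennreal \<bar>F v x - F v x'\<bar>)"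
    by (subst ennreal_mult[OF c0]) (auto simp: mult_ac)
  also have "\<dots> \<le> ennreal ?c * (\<integral>\<^sup>+z. (\<integral>\<^sup>+w. indicator (B x) z * indicator (B x') w * ennreal \<bar>v z - v w\<bar> \<partial>lborel) \<partial>lborel)"
    by (intro mult_left_mono avg_diff_le v x x'O) auto
  also have "\<dots> \<le> ennreal ?c * osc 1 v \<xi>"
  proof -
    have "B x \<subseteq> ball \<xi> (5 * d \<xi> / 32)"
    proof
      fix z assume "z \<in> B x"
      then have "dist x z < d x / 32" by (simp add: wball_def)
      then have "dist \<xi> z < 2 * d x / 32" using dist_triangle[of \<xi> z x] xi by (simp add: dist_commute)
      then show "z \<in> ball \<xi> (5 * d \<xi> / 32)" using a4 dx by simp
    qed
    moreover have "B x' \<subseteq> ball \<xi> (5 * d \<xi> / 32)"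
    proof
      fix z assume "z \<in> B x'"
      then have "dist x' z < d x' / 32" by (simp add: wball_def)
      then have "dist \<xi> z < 2 * d x / 32 + d x' / 32"
        using dist_triangle[of \<xi> z x] dist_triangle[of x z x'] xi x' by (simp add: dist_commute)
      then show "z \<in> ball \<xi> (5 * d \<xi> / 32)" using a3 a4 dx by simp
    qed
    ultimately show ?thesis
      unfolding osc_def by (intro mult_left_mono nn_integral_mono mult_mono) (auto split: split_indicator)
  qed
  finally show ?thesis .
qed

end

section \<open>The energy controls oscillations\<close>

text \<open>Here \<open>bc\<close> is the largest admissible \<open>b\<close>, and \<open>\<gamma>\<close> is the power of the distance to the
  boundary that the kernel with \<open>b = bc\<close> amounts to when \<open>dist x z\<close> is comparable to \<open>d x\<close>.
  In terms of \<open>\<theta>\<close> the restriction on \<open>q\<close> is \<open>\<theta> * n \<le> s * p\<close>, both for \<open>p < n / s\<close> and for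
  \<open>p \<ge> n / s\<close>, where it is automatic.\<close>

locale sobolev_exponents = bounded_region \<Omega> for \<Omega> :: "'a::euclidean_space set" +
  fixes \<alpha> s p q b n bc \<gamma> \<theta> :: real
  assumes n_def: "n = real DIM('a)"
  defines "bc \<equiv> p * (s - n) + p * (n - 1 + \<alpha>) * (1 + 1 / q - 1 / p)"
    and "\<gamma> \<equiv> bc - n - s * p"
    and "\<theta> \<equiv> 1 - p / q"
  assumes alpha: "0 < \<alpha>" "\<alpha> \<le> 1" and s_pos: "0 < s" and p_gt: "1 < p" and p_le_q: "p \<le> q"
    and b_le: "b \<le> bc" and theta_le: "\<theta> * n \<le> s * p"
begin

abbreviation energy :: "('a \<Rightarrow> real) \<Rightarrow> ennreal" where "energy \<equiv> frac_energy s p b \<Omega>"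

text \<open>The energy with its kernel replaced by a multiple of a lower bound that does not see
  the singularity on the diagonal. It suffices for everything except \<open>local_bound\<close>.\<close>

definition crit_energy :: "('a \<Rightarrow> real) \<Rightarrow> ennreal" where
  "crit_energy v = (\<integral>\<^sup>+z. (\<integral>\<^sup>+w. indicator \<Omega> z * indicator {w. dist z w \<le> d z / 2} w
             * ennreal (d z powr \<gamma> * \<bar>v z - v w\<bar> powr p) \<partial>lborel) \<partial>lborel)"

definition descent_bound :: "'a set \<Rightarrow> real \<Rightarrow> 'a \<Rightarrow> real \<Rightarrow> bool" where
  "descent_bound Y T e C \<longleftrightarrow> (\<forall>v E. unit_valued v \<longrightarrow> E \<in> sets borel \<longrightarrow> E \<subseteq> Y \<longrightarrow> E \<subseteq> \<Omega> \<longrightarrow>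
     (\<forall>y\<in>E. 1 / 8 \<le> \<bar>F v y - F v (y - T *\<^sub>R e)\<bar>) \<longrightarrow>
     emeasure lborel E \<le> ennreal (C * vol E powr \<theta>) * crit_energy v)"

lemma n_ge_1: "1 \<le> n"
  using DIM_positive[where 'a='a] by (simp add: n_def Suc_le_eq[symmetric] del: DIM_positive)

lemma q_gt: "1 < q" using p_gt p_le_q by simp

lemma theta_bounds: "0 \<le> \<theta>" "\<theta> < 1" "1 - \<theta> = p / q"
  using p_gt p_le_q by (auto simp: \<theta>_def)

text \<open>The exponent is \<open>- (1 - \<alpha>) * (p - 1 + p / q)\<close>. That it is not positive means that the
  weight imposes no more on a single Whitney ball than scaling of the local Sobolev
  inequality allows.\<close>

lemma exponent_nonpos: "bc - s * p + \<theta> * n \<le> 0"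
proof -
  have "0 \<le> 1 - p / q" using theta_bounds by (simp add: \<theta>_def)
  have e: "p * (1 + 1 / q - 1 / p) = p - 1 + p / q" using p_gt by (simp add: field_simps)
  have e': "bc = p * (s - n) + (n - 1 + \<alpha>) * (p * (1 + 1 / q - 1 / p))"
    unfolding bc_def by (simp add: mult_ac)
  have "bc - s * p + \<theta> * n = - (1 - \<alpha>) * (p - 1 + p / q)"
    unfolding e' e \<theta>_def by (simp add: algebra_simps add_divide_distrib diff_divide_distrib)
  also have "\<dots> \<le> 0" using alpha p_gt q_gt by (intro mult_nonpos_nonneg) auto
  finally show ?thesis .
qed

text \<open>For \<open>dist x z \<le> d x / 2\<close> the two distances to the boundary are comparable, and since
  they are bounded, decreasing the exponent from \<open>bc\<close> to \<open>b\<close> only costs a constant.\<close>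

lemma kernel_bound:
  "\<exists>K>0. \<forall>x\<in>\<Omega>. \<forall>z. dist x z \<le> d x / 2 \<longrightarrow> d x powr bc \<le> K * min (d x) (d z) powr b"
proof -
  obtain R where R: "1 \<le> R" "\<And>x. x \<in> \<Omega> \<Longrightarrow> d x \<le> R" using d_bounded by blast
  have "d x powr bc \<le> (R powr (bc - b) * 2 powr \<bar>b\<bar>) * min (d x) (d z) powr b"
    if x: "x \<in> \<Omega>" and z: "dist x z \<le> d x / 2" for x z
  proof -
    have dx: "0 < d x" by (rule d_pos[OF x])
    have dz: "d x / 2 \<le> d z" using d_lipschitz[of x z] z by linarith
    have "d x powr bc \<le> R powr (bc - b) * d x powr b"
      using dx R(2)[OF x] b_le by (rule powr_antimono_bounded)
    also have "d x powr b \<le> 2 powr \<bar>b\<bar> * min (d x) (d z) powr b"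
      using dx dz by (intro powr_le_of_comparable) auto
    finally show ?thesis by (simp add: mult_left_mono mult.assoc)
  qed
  moreover have "0 < R powr (bc - b) * 2 powr \<bar>b\<bar>" using R(1) by simp
  ultimately show ?thesis by blast
qed

lemma crit_energy_le_energy:
  "\<exists>K>0. \<forall>v. unit_valued v \<longrightarrow> crit_energy v \<le> ennreal K * energy v"
proof -
  obtain K where K: "0 < K"
    "\<And>x z. x \<in> \<Omega> \<Longrightarrow> dist x z \<le> d x / 2 \<Longrightarrow> d x powr bc \<le> K * min (d x) (d z) powr b"
    using kernel_bound by blast
  have "crit_energy v \<le> ennreal K * energy v" if v: "unit_valued v" for v
  proof -
    have [measurable]: "v \<in> borel_measurable borel" by (rule unit_valued_measurable[OF v])
    let ?k = "\<lambda>z w. \<bar>v w - v z\<bar> powr p / norm (w - z) powr (n + s * p) * min (d z) (d w) powr b"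
    have le: "d z powr \<gamma> * \<bar>v z - v w\<bar> powr p \<le> K * ?k z w"
      if z: "z \<in> \<Omega>" and zw: "dist z w \<le> d z / 2" for z w
    proof (cases "w = z")
      case True
      then show ?thesis by simp
    next
      case False
      have dz: "0 < d z" by (rule d_pos[OF z])
      have sp: "0 < s * p" using s_pos p_gt by simp
      have nw: "0 < norm (w - z)" "norm (w - z) \<le> d z"
        using False zw dz by (auto simp: dist_norm norm_minus_commute)
      have "d z powr \<gamma> = d z powr bc * d z powr (- (n + s * p))"
        unfolding \<gamma>_def by (simp add: powr_add[symmetric] algebra_simps)
      also have "\<dots> \<le> (K * min (d z) (d w) powr b) * norm (w - z) powr (- (n + s * p))"
        using nw n_ge_1 sp K(1) by (intro mult_mono K(2)[OF z zw] powr_mono2') auto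
      finally have "d z powr \<gamma> * \<bar>v z - v w\<bar> powr p
          \<le> ((K * min (d z) (d w) powr b) * norm (w - z) powr (- (n + s * p))) * \<bar>v z - v w\<bar> powr p"
        by (rule mult_right_mono) simp
      then show ?thesis
        unfolding powr_minus_divide[of "norm (w - z)"] by (simp add: abs_minus_commute mult_ac)
    qed
    have "crit_energy v \<le> (\<integral>\<^sup>+z. (\<integral>\<^sup>+w. ennreal K * (indicator \<Omega> z * (ennreal (?k z w) * indicator {w. norm (z - w) \<le> d z / 2} w)) \<partial>lborel) \<partial>lborel)"
      unfolding crit_energy_def
    proof (intro nn_integral_mono)
      fix z w
      show "indicator \<Omega> z * indicator {w. dist z w \<le> d z / 2} w * ennreal (d z powr \<gamma> * \<bar>v z - v w\<bar> powr p)
         \<le> ennreal K * (indicator \<Omega> z * (ennreal (?k z w) * indicator {w. norm (z - w) \<le> d z / 2} w))"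
      proof (cases "z \<in> \<Omega> \<and> dist z w \<le> d z / 2")
        case True
        have "ennreal (d z powr \<gamma> * \<bar>v z - v w\<bar> powr p) \<le> ennreal (K * ?k z w)"
          using True by (intro ennreal_leI le) auto
        also have "\<dots> = ennreal K * ennreal (?k z w)" using K(1) by (intro ennreal_mult) auto
        finally show ?thesis using True by (simp add: dist_norm)
      qed (auto split: split_indicator)
    qed
    also have "\<dots> = ennreal K * energy v"
    proof -
      define g where "g z w = ennreal (?k z w) * indicator {w. norm (z - w) \<le> d z / 2} w" for z w
      have [measurable]: "case_prod g \<in> borel_measurable (borel \<Otimes>\<^sub>M borel)"
        unfolding g_def indicator_def mem_Collect_eq by measurable
      have "(\<integral>\<^sup>+w. ennreal K * (indicator \<Omega> z * g z w) \<partial>lborel)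
          = ennreal K * ((\<integral>\<^sup>+w. g z w \<partial>lborel) * indicator \<Omega> z)" for z
        by (cases "z \<in> \<Omega>") (auto simp: nn_integral_cmult)
      then show ?thesis
        unfolding frac_energy_def n_def[symmetric] g_def[symmetric]
        by (simp add: nn_integral_cmult)
    qed
    finally show ?thesis .
  qed
  then show ?thesis using K(1) by blast
qed

end

context bounded_region
begin

lemma five_ball:
  assumes xi: "\<xi> \<in> \<Omega>" and z: "z \<in> ball \<xi> (5 * d \<xi> / 32)"
  shows "z \<in> \<Omega>" "27 / 32 * d \<xi> \<le> d z" "d z \<le> 37 / 32 * d \<xi>"
proof -
  have dist: "dist \<xi> z < 5 * d \<xi> / 32" using z by simp
  show "z \<in> \<Omega>" using mem_region[OF xi, of z] dist d_pos[OF xi] by linarith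
  show "27 / 32 * d \<xi> \<le> d z" "d z \<le> 37 / 32 * d \<xi>"
    using d_lipschitz[of \<xi> z] dist by linarith+
qed

text \<open>The weighted Young inequality under the double integral; \<open>W\<close> stays free.\<close>

lemma osc_powr_interpolation:
  assumes v: "unit_valued v" and xi: "\<xi> \<in> \<Omega>" and W: "0 < W" and p: "1 \<le> p"
  shows "osc 1 v \<xi> \<le> ennreal (unit_ball_vol DIM('a) ^ 2 * d \<xi> powr (2 * real DIM('a)) * W)
             + ennreal (W powr (1 - p)) * osc p v \<xi>"
proof -
  have [measurable]: "v \<in> borel_measurable borel" by (rule unit_valued_measurable[OF v])
  let ?B = "ball \<xi> (5 * d \<xi> / 32)"
  have [measurable]: "?B \<in> sets borel" by simp
  let ?V = "unit_ball_vol DIM('a)" let ?n = "DIM('a)"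
  have dxi: "0 < d \<xi>" by (rule d_pos[OF xi])
  have "osc 1 v \<xi> \<le> (\<integral>\<^sup>+z. (\<integral>\<^sup>+w. (ennreal W * indicator ?B z) * indicator ?B w
            + ennreal (W powr (1 - p)) * (indicator ?B z * indicator ?B w * ennreal (\<bar>v z - v w\<bar> powr p)) \<partial>lborel) \<partial>lborel)"
    unfolding osc_def
  proof (intro nn_integral_mono)
    fix z w
    have "ennreal (\<bar>v z - v w\<bar> powr 1) \<le> ennreal (W + \<bar>v z - v w\<bar> powr p * W powr (1 - p))"
      using le_add_powr_mult[of "\<bar>v z - v w\<bar>" W p] W p by (intro ennreal_leI) simp
    also have "\<dots> = ennreal W + ennreal (W powr (1 - p)) * ennreal (\<bar>v z - v w\<bar> powr p)"
      using W by (simp add: ennreal_mult mult.commute)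
    finally have "ennreal (\<bar>v z - v w\<bar> powr 1)
        \<le> ennreal W + ennreal (W powr (1 - p)) * ennreal (\<bar>v z - v w\<bar> powr p)" .
    then show "indicator ?B z * indicator ?B w * ennreal (\<bar>v z - v w\<bar> powr 1)
        \<le> (ennreal W * indicator ?B z) * indicator ?B w
            + ennreal (W powr (1 - p)) * (indicator ?B z * indicator ?B w * ennreal (\<bar>v z - v w\<bar> powr p))"
      by (auto split: split_indicator)
  qed
  also have "\<dots> = (\<integral>\<^sup>+z. (\<integral>\<^sup>+w. (ennreal W * indicator ?B z) * indicator ?B w \<partial>lborel) \<partial>lborel)
        + ennreal (W powr (1 - p)) * osc p v \<xi>"
    unfolding osc_def by (simp add: nn_integral_add nn_integral_cmult)
  also have "(\<integral>\<^sup>+z. (\<integral>\<^sup>+w. (ennreal W * indicator ?B z) * indicator ?B w \<partial>lborel) \<partial>lborel)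
     = ennreal W * emeasure lborel ?B * emeasure lborel ?B"
    by (simp add: nn_integral_cmult nn_integral_multc)
  also have "\<dots> \<le> ennreal (?V ^ 2 * d \<xi> powr (2 * real ?n) * W)"
  proof -
    have "emeasure lborel ?B = ennreal (?V * (5 * d \<xi> / 32) ^ ?n)"
      using dxi by (intro emeasure_ball) auto
    also have "\<dots> \<le> ennreal (?V * d \<xi> ^ ?n)"
      using dxi by (intro ennreal_leI mult_left_mono power_mono) auto
    finally have "emeasure lborel ?B \<le> ennreal (?V * d \<xi> ^ ?n)" .
    then have "ennreal W * emeasure lborel ?B * emeasure lborel ?B
        \<le> ennreal W * ennreal (?V * d \<xi> ^ ?n) * ennreal (?V * d \<xi> ^ ?n)"
      by (intro mult_mono) auto
    also have "\<dots> = ennreal (W * (?V * d \<xi> ^ ?n) * (?V * d \<xi> ^ ?n))"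
      using W dxi by (simp add: ennreal_mult)
    also have "W * (?V * d \<xi> ^ ?n) * (?V * d \<xi> ^ ?n) = ?V ^ 2 * d \<xi> powr (2 * real ?n) * W"
      using dxi by (simp add: powr_realpow[symmetric] powr_add[symmetric] power2_eq_square)
    finally show ?thesis .
  qed
  finally show ?thesis by (simp add: add_right_mono)
qed

end

context sobolev_exponents
begin

lemma osc_le_crit_energy:
  assumes v: "unit_valued v" and xi: "\<xi> \<in> \<Omega>"
  shows "osc p v \<xi> \<le> ennreal (2 powr \<bar>\<gamma>\<bar> * d \<xi> powr (- \<gamma>)) * crit_energy v"
proof -
  have [measurable]: "v \<in> borel_measurable borel" by (rule unit_valued_measurable[OF v])
  let ?B = "ball \<xi> (5 * d \<xi> / 32)"
  let ?C = "2 powr \<bar>\<gamma>\<bar> * d \<xi> powr (- \<gamma>)"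
  have dxi: "0 < d \<xi>" by (rule d_pos[OF xi])
  have "osc p v \<xi> \<le> (\<integral>\<^sup>+z. (\<integral>\<^sup>+w. ennreal ?C * (indicator \<Omega> z * indicator {w. dist z w \<le> d z / 2} w
             * ennreal (d z powr \<gamma> * \<bar>v z - v w\<bar> powr p)) \<partial>lborel) \<partial>lborel)"
    unfolding osc_def
  proof (intro nn_integral_mono)
    fix z w
    show "indicator ?B z * indicator ?B w * ennreal (\<bar>v z - v w\<bar> powr p)
      \<le> ennreal ?C * (indicator \<Omega> z * indicator {w. dist z w \<le> d z / 2} w
             * ennreal (d z powr \<gamma> * \<bar>v z - v w\<bar> powr p))"
    proof (cases "z \<in> ?B \<and> w \<in> ?B")
      case True
      then have zw: "dist \<xi> z < 5 * d \<xi> / 32" "dist \<xi> w < 5 * d \<xi> / 32" by auto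
      have z: "z \<in> \<Omega>" "27 / 32 * d \<xi> \<le> d z" "d z \<le> 37 / 32 * d \<xi>"
        using five_ball[OF xi, of z] True by auto
      have dzw: "dist z w \<le> d z / 2"
        using zw z(2) dxi dist_triangle[of z w \<xi>] by (simp add: dist_commute)
      have dz: "0 < d z" by (rule d_pos[OF z(1)])
      have "d \<xi> powr \<gamma> \<le> 2 powr \<bar>\<gamma>\<bar> * d z powr \<gamma>"
        using z dz dxi by (intro powr_le_of_comparable) auto
      then have "d \<xi> powr (-\<gamma>) * d \<xi> powr \<gamma> \<le> d \<xi> powr (-\<gamma>) * (2 powr \<bar>\<gamma>\<bar> * d z powr \<gamma>)"
        by (intro mult_left_mono) auto
      then have 1: "1 \<le> ?C * d z powr \<gamma>"
        using dxi by (simp add: powr_add[symmetric] mult_ac)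
      have "1 * \<bar>v z - v w\<bar> powr p \<le> (?C * d z powr \<gamma>) * \<bar>v z - v w\<bar> powr p"
        by (intro mult_right_mono 1) simp
      then have "ennreal (\<bar>v z - v w\<bar> powr p) \<le> ennreal (?C * (d z powr \<gamma> * \<bar>v z - v w\<bar> powr p))"
        by (intro ennreal_leI) (simp add: mult_ac)
      also have "\<dots> = ennreal ?C * ennreal (d z powr \<gamma> * \<bar>v z - v w\<bar> powr p)"
        by (intro ennreal_mult) auto
      finally show ?thesis using True z dzw by simp
    qed (auto split: split_indicator)
  qed
  also have "\<dots> = ennreal ?C * crit_energy v"
    unfolding crit_energy_def indicator_def mem_Collect_eq by (simp add: nn_integral_cmult)
  finally show ?thesis .
qed

text \<open>The interpolation parameter is chosen so small that its own contribution is \<open>\<epsilon>\<close>.\<close>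

lemma avg_close:
  assumes x: "x \<in> \<Omega>" and eps: "0 < \<epsilon>"
  shows "\<exists>C>0. \<forall>x'. dist x x' \<le> d x / 32 \<longrightarrow> (\<forall>v. unit_valued v \<longrightarrow>
     ennreal \<bar>F v x - F v x'\<bar> \<le> ennreal \<epsilon> + ennreal C * crit_energy v)"
proof -
  have dx: "0 < d x" by (rule d_pos[OF x])
  define A where "A = step_const * d x powr (- 2 * real DIM('a))"
  define U where "U = unit_ball_vol DIM('a) ^ 2 * d x powr (2 * real DIM('a))"
  define W where "W = \<epsilon> / (A * U)"
  have A: "0 < A" using step_const_pos dx by (simp add: A_def)
  have U: "0 < U" using dx unit_ball_vol_pos[of "real DIM('a)"] by (simp add: U_def del: unit_ball_vol_pos)
  have W: "0 < W" using A U eps by (simp add: W_def)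
  define C where "C = A * (W powr (1 - p) * (2 powr \<bar>\<gamma>\<bar> * d x powr (- \<gamma>)))"
  have C: "0 < C" using A W dx by (simp add: C_def)
  have "ennreal \<bar>F v x - F v x'\<bar> \<le> ennreal \<epsilon> + ennreal C * crit_energy v"
    if x': "dist x x' \<le> d x / 32" and v: "unit_valued v" for x' v
  proof -
    have "ennreal \<bar>F v x - F v x'\<bar> \<le> ennreal A * osc 1 v x"
      unfolding A_def using dx by (intro avg_step[OF v x x']) auto
    also have "\<dots> \<le> ennreal A * (ennreal (U * W) + ennreal (W powr (1 - p)) * osc p v x)"
      unfolding U_def using p_gt by (intro mult_left_mono osc_powr_interpolation[OF v x W]) auto
    also have "\<dots> \<le> ennreal A * (ennreal (U * W) + ennreal (W powr (1 - p)) * (ennreal (2 powr \<bar>\<gamma>\<bar> * d x powr (- \<gamma>)) * crit_energy v))"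
      by (intro mult_left_mono add_left_mono osc_le_crit_energy[OF v x]) auto
    also have "\<dots> = ennreal (A * (U * W)) + ennreal C * crit_energy v"
    proof -
      have "ennreal C = ennreal A * (ennreal (W powr (1 - p)) * ennreal (2 powr \<bar>\<gamma>\<bar> * d x powr (- \<gamma>)))"
        unfolding C_def using A W by (simp add: ennreal_mult)
      moreover have "ennreal (A * (U * W)) = ennreal A * ennreal (U * W)"
        using A U W by (intro ennreal_mult) auto
      ultimately show ?thesis by (simp only: distrib_left mult.assoc)
    qed
    also have "A * (U * W) = \<epsilon>" using A U by (simp add: W_def)
    finally show ?thesis .
  qed
  then show ?thesis using C by blast
qed

lemma compact_interior: "compact {x \<in> \<Omega>. r \<le> d x}" if "0 < r"
proof -
  have "{x \<in> \<Omega>. r \<le> d x} = closure \<Omega> \<inter> {x. r \<le> d x}"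
  proof -
    have "x \<in> \<Omega>" if "x \<in> closure \<Omega>" "r \<le> d x" for x
    proof (rule ccontr)
      assume "x \<notin> \<Omega>"
      then have "x \<in> frontier \<Omega>" using that open_region by (simp add: frontier_def interior_open)
      then have "d x = 0" by (simp add: bdist_def)
      then show False using that \<open>0 < r\<close> by simp
    qed
    then show ?thesis using closure_subset by fastforce
  qed
  moreover have "closed {x. r \<le> d x}"
    by (intro closed_Collect_le continuous_intros continuous_d)
  ultimately show ?thesis
    using bounded_region by (simp add: compact_Int_closed)
qed

text \<open>Having averages that differ by at most \<open>\<epsilon>\<close> plus a multiple of the energy, for every
  \<open>\<epsilon>\<close>, is an equivalence relation on points with open classes, so by connectedness it holds
  between any two points; compactness of the set \<open>r \<le> d x\<close> makes the constant uniform. Its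
  use is that the energy is bounded below as soon as two such averages differ by a fixed
  amount.\<close>

lemma avg_close_interior:
  assumes x0: "x0 \<in> \<Omega>" and r: "0 < r" and eps: "0 < \<epsilon>"
  shows "\<exists>C>0. \<forall>x\<in>\<Omega>. r \<le> d x \<longrightarrow> (\<forall>v. unit_valued v \<longrightarrow>
     ennreal \<bar>F v x - F v x0\<bar> \<le> ennreal \<epsilon> + ennreal C * crit_energy v)"
proof -
  define R where "R x y \<longleftrightarrow> (\<forall>\<epsilon>>0. \<exists>C>0. \<forall>v. unit_valued v \<longrightarrow>
     ennreal \<bar>F v x - F v y\<bar> \<le> ennreal \<epsilon> + ennreal C * crit_energy v)" for x y
  have comb: "ennreal \<bar>a - c\<bar> \<le> ennreal \<epsilon> + ennreal (C1 + C2) * e"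
    if "ennreal \<bar>a - b\<bar> \<le> ennreal (\<epsilon> / 2) + ennreal C1 * e" "ennreal \<bar>b - c\<bar> \<le> ennreal (\<epsilon> / 2) + ennreal C2 * e"
      "0 < C1" "0 < C2" "0 < \<epsilon>" for a b c \<epsilon> C1 C2 e
  proof -
    have "ennreal \<bar>a - c\<bar> \<le> ennreal (\<bar>a - b\<bar> + \<bar>b - c\<bar>)" by (intro ennreal_leI) linarith
    also have "\<dots> = ennreal \<bar>a - b\<bar> + ennreal \<bar>b - c\<bar>" by simp
    also have "\<dots> \<le> (ennreal (\<epsilon> / 2) + ennreal C1 * e) + (ennreal (\<epsilon> / 2) + ennreal C2 * e)"
      by (intro add_mono that)
    also have "\<dots> = (ennreal (\<epsilon> / 2) + ennreal (\<epsilon> / 2)) + (ennreal C1 + ennreal C2) * e"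
      by (simp add: distrib_right add_ac)
    also have "ennreal (\<epsilon> / 2) + ennreal (\<epsilon> / 2) = ennreal \<epsilon>"
      using that by (subst ennreal_plus[symmetric]) auto
    also have "ennreal C1 + ennreal C2 = ennreal (C1 + C2)" using that by simp
    finally show ?thesis .
  qed
  have trans: "R x z" if "R x y" "R y z" for x y z
    unfolding R_def
  proof (intro allI impI)
    fix \<epsilon> :: real assume e: "0 < \<epsilon>"
    obtain C1 where C1: "0 < C1" "\<And>v. unit_valued v \<Longrightarrow> ennreal \<bar>F v x - F v y\<bar> \<le> ennreal (\<epsilon>/2) + ennreal C1 * crit_energy v"
      using \<open>R x y\<close> e unfolding R_def by (meson half_gt_zero)
    obtain C2 where C2: "0 < C2" "\<And>v. unit_valued v \<Longrightarrow> ennreal \<bar>F v y - F v z\<bar> \<le> ennreal (\<epsilon>/2) + ennreal C2 * crit_energy v"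
      using \<open>R y z\<close> e unfolding R_def by (meson half_gt_zero)
    show "\<exists>C>0. \<forall>v. unit_valued v \<longrightarrow> ennreal \<bar>F v x - F v z\<bar> \<le> ennreal \<epsilon> + ennreal C * crit_energy v"
      using comb[OF C1(2) C2(2) C1(1) C2(1) e] C1(1) C2(1) by (intro exI[of _ "C1 + C2"]) auto
  qed
  have sym: "R y x" if "R x y" for x y
    using that unfolding R_def by (simp add: abs_minus_commute)
  have all: "R x x0" if x: "x \<in> \<Omega>" for x
  proof (rule connected_equivalence_relation[OF connected_region x x0])
    fix a assume a: "a \<in> \<Omega>"
    show "\<exists>T. openin (top_of_set \<Omega>) T \<and> a \<in> T \<and> (\<forall>x\<in>T. R a x)"
    proof (intro exI conjI ballI)
      show "openin (top_of_set \<Omega>) (ball a (d a / 32) \<inter> \<Omega>)"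
        using open_region by (auto simp: openin_open_eq)
      show "a \<in> ball a (d a / 32) \<inter> \<Omega>" using a d_pos[OF a] by simp
      show "R a x" if "x \<in> ball a (d a / 32) \<inter> \<Omega>" for x
        unfolding R_def using avg_close[OF a] that by (metis IntD1 mem_ball less_imp_le)
    qed
  qed (use trans sym in blast)+
  define K where "K = {x \<in> \<Omega>. r \<le> d x}"
  have K: "compact K" unfolding K_def by (rule compact_interior[OF r])
  have "K \<subseteq> (\<Union>x\<in>K. ball x (d x / 32))" using d_pos by (force simp: K_def)
  then obtain T where T: "T \<subseteq> K" "finite T" "K \<subseteq> (\<Union>x\<in>T. ball x (d x / 32))"
    using compactE_image[OF K, of K "\<lambda>x. ball x (d x / 32)"] by auto
  have "\<exists>C>0. \<forall>x'. dist t x' \<le> d t / 32 \<longrightarrow> (\<forall>v. unit_valued v \<longrightarrow>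
     ennreal \<bar>F v x' - F v x0\<bar> \<le> ennreal \<epsilon> + ennreal C * crit_energy v)" if "t \<in> T" for t
  proof -
    have t: "t \<in> \<Omega>" using that T(1) by (auto simp: K_def)
    obtain C1 where C1: "0 < C1" "\<And>x' v. dist t x' \<le> d t / 32 \<Longrightarrow> unit_valued v \<Longrightarrow>
       ennreal \<bar>F v x' - F v t\<bar> \<le> ennreal (\<epsilon>/2) + ennreal C1 * crit_energy v"
      using avg_close[OF t, of "\<epsilon>/2"] eps by (auto simp: abs_minus_commute)
    obtain C2 where C2: "0 < C2" "\<And>v. unit_valued v \<Longrightarrow> ennreal \<bar>F v t - F v x0\<bar> \<le> ennreal (\<epsilon>/2) + ennreal C2 * crit_energy v"
      using all[OF t] eps unfolding R_def by (meson half_gt_zero)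
    show ?thesis
      using comb[OF C1(2) C2(2) C1(1) C2(1) eps] C1(1) C2(1) by (intro exI[of _ "C1 + C2"]) auto
  qed
  then obtain c where c: "\<And>t. t \<in> T \<Longrightarrow> 0 < c t" "\<And>t x' v. t \<in> T \<Longrightarrow> dist t x' \<le> d t / 32 \<Longrightarrow> unit_valued v \<Longrightarrow>
     ennreal \<bar>F v x' - F v x0\<bar> \<le> ennreal \<epsilon> + ennreal (c t) * crit_energy v" by metis
  define C where "C = 1 + sum c T"
  have "0 \<le> sum c T" using c(1) by (intro sum_nonneg) (auto intro: less_imp_le)
  then have C: "0 < C" by (simp add: C_def)
  have "ennreal \<bar>F v x - F v x0\<bar> \<le> ennreal \<epsilon> + ennreal C * crit_energy v"
    if "x \<in> \<Omega>" "r \<le> d x" and v: "unit_valued v" for x v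
  proof -
    have "x \<in> K" using that by (simp add: K_def)
    then obtain t where t: "t \<in> T" "dist t x < d t / 32" using T(3) by auto
    have "c t \<le> sum c T" using T(2) t(1) c(1) by (intro member_le_sum) (auto intro: less_imp_le)
    then have "ennreal (c t) * crit_energy v \<le> ennreal C * crit_energy v"
      by (intro mult_right_mono ennreal_leI) (auto simp: C_def)
    moreover have "ennreal \<bar>F v x - F v x0\<bar> \<le> ennreal \<epsilon> + ennreal (c t) * crit_energy v"
      using c(2)[OF t(1) _ v, of x] t(2) by simp
    ultimately show ?thesis by (meson add_left_mono order_trans)
  qed
  then show ?thesis using C by blast
qed

end

section \<open>Points where the function differs from its nearby average\<close>

context bounded_region
begin

text \<open>Markov's inequality for \<open>1 - v\<close>.\<close>

lemma measure_small_values: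
  assumes v: "unit_valued v" and y: "y \<in> \<Omega>" and avg: "F v y \<le> 3 / 4"
  shows "vol (B y) / 8 \<le> vol {z \<in> B y. v z \<le> 7 / 8}"
proof -
  have [measurable]: "v \<in> borel_measurable borel" by (rule unit_valued_measurable[OF v])
  let ?G = "{z \<in> B y. v z \<le> 7 / 8}"
  have m: "0 < vol (B y)" by (rule measure_wball_pos[OF y])
  have fin: "emeasure lborel (B y) < \<infinity>" using wball_bounded by (rule emeasure_bounded_finite)
  have G: "?G \<in> sets borel"
  proof -
    have "?G = B y \<inter> {z. v z \<le> 7 / 8}" by auto
    then show ?thesis by simp
  qed
  have GB: "bounded ?G" using wball_bounded[of y] by (rule bounded_subset) auto
  have finG: "emeasure lborel ?G < \<infinity>" using GB by (rule emeasure_bounded_finite)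
  have i1: "integrable lborel (indicator (B y) :: 'a \<Rightarrow> real)" using fin by (simp add: integrable_indicator_iff)
  have i2: "integrable lborel (indicator ?G :: 'a \<Rightarrow> real)" using finG G by (simp add: integrable_indicator_iff)
  have "7 / 8 * (vol (B y) - vol ?G)
      = (\<integral>z. 7 / 8 * (indicator (B y) z - indicator ?G z) \<partial>lborel)"
    using i1 i2 G by simp
  also have "\<dots> \<le> (\<integral>z. indicator (B y) z * v z \<partial>lborel)"
  proof (rule integral_mono)
    show "integrable lborel (\<lambda>z. 7 / 8 * (indicator (B y) z - indicator ?G z) :: real)"
      using i1 i2 by (intro integrable_mult_right Bochner_Integration.integrable_diff)
    show "integrable lborel (\<lambda>z. indicator (B y) z * v z)"
      by (rule integrable_unit_valued[OF v wball_sets wball_bounded])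
    show "7 / 8 * (indicator (B y) z - indicator ?G z) \<le> indicator (B y) z * v z" for z
      using v by (auto simp: unit_valued_def split: split_indicator)
  qed
  also have "\<dots> = F v y * vol (B y)" using m by (simp add: avg_def)
  also have "\<dots> \<le> 3 / 4 * vol (B y)" using avg m by (intro mult_right_mono) auto
  finally have "7 / 8 * (vol (B y) - vol ?G) \<le> 3 / 4 * vol (B y)" .
  moreover have "m / 8 \<le> g" if "7 / 8 * (m - g) \<le> 3 / 4 * m" "0 < m" for m g :: real
    using that by (simp add: field_simps)
  ultimately show ?thesis using m by blast
qed

end

context sobolev_exponents
begin

definition separates :: "('a \<Rightarrow> real) \<Rightarrow> 'a set \<Rightarrow> 'a set \<Rightarrow> bool" where
  "separates v E A \<longleftrightarrow> unit_valued v \<and> E \<in> sets borel \<and> A \<in> sets borel \<and> E \<subseteq> A \<and> A \<subseteq> \<Omega> \<and>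
     (\<forall>y\<in>E. v y = 1) \<and> (\<forall>z\<in>\<Omega> - A. v z = 0)"

text \<open>The local Sobolev inequality in weak form. If \<open>v y = 1\<close> while the average around \<open>y\<close>
  is at most \<open>3 / 4\<close>, then \<open>v \<le> 7 / 8\<close> on a fixed fraction of the averaging ball, and also
  everywhere in \<open>\<Omega>\<close> off \<open>A\<close>. Hence \<open>v \<le> 7 / 8\<close> on a fixed fraction of the ball around \<open>y\<close>
  whose radius \<open>\<rho>\<close> is the smaller of \<open>d y / 32\<close> and the radius \<open>t\<close> of a ball with twice the
  measure of \<open>A\<close>. Restricting the inner integral of the energy to these points gives at
  least \<open>d y powr bc * \<rho> powr (- (s * p))\<close> up to a constant; spending the part
  \<open>\<rho> powr (- (\<theta> * n))\<close> on the measure of \<open>A\<close> and the rest on \<open>d y\<close> leaves a factor that is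
  bounded below by \<open>exponent_nonpos\<close>.\<close>

lemma local_bound:
  "\<exists>C>0. \<forall>v E A. separates v E A \<longrightarrow> (\<forall>y\<in>E. F v y \<le> 3 / 4) \<longrightarrow>
     emeasure lborel E \<le> ennreal (C * vol A powr \<theta>) * energy v"
proof -
  obtain K where K: "0 < K"
    "\<And>x z. x \<in> \<Omega> \<Longrightarrow> dist x z \<le> d x / 2 \<Longrightarrow> d x powr bc \<le> K * min (d x) (d z) powr b"
    using kernel_bound by blast
  obtain R where R: "1 \<le> R" "\<And>x. x \<in> \<Omega> \<Longrightarrow> d x \<le> R" using d_bounded by blast
  let ?V = "unit_ball_vol (real DIM('a))"
  have V: "0 < ?V" by simp
  have sp: "0 < s * p" using s_pos p_gt by simp
  let ?k = "\<lambda>v x z. \<bar>v z - v x\<bar> powr p / norm (z - x) powr (n + s * p) * min (d x) (d z) powr b"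
  define c where "c = (1/8) powr p / K * (?V / 8) * (2 / ?V) powr (- \<theta>) * R powr (bc - s * p + \<theta> * n)"
  have "?V \<noteq> 0" using V by (rule less_imp_neq[symmetric])
  then have c: "0 < c" unfolding c_def using K(1) R(1) by (intro mult_pos_pos divide_pos_pos) auto
  have inner: "ennreal (c * a powr (- \<theta>)) \<le> (\<integral>\<^sup>+z. ennreal (?k v y z) * indicator {z. norm (y - z) \<le> d y / 2} z \<partial>lborel)"
    if v: "unit_valued v" and A: "A \<in> sets borel" "A \<subseteq> \<Omega>" and y: "y \<in> \<Omega>" and vy: "v y = 1"
      and vA: "\<And>z. z \<in> \<Omega> - A \<Longrightarrow> v z = 0" and avg: "F v y \<le> 3 / 4"
      and a: "a = vol A" "0 < a" for v A y a
  proof -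
    have [measurable]: "v \<in> borel_measurable borel" by (rule unit_valued_measurable[OF v])
    have dy: "0 < d y" by (rule d_pos[OF y])
    define t where "t = (2 * a / ?V) powr (1 / n)"
    have t: "0 < t" using a V by (simp add: t_def)
    have tn: "?V * t ^ DIM('a) = 2 * a"
    proof -
      have "t ^ DIM('a) = t powr n" using t by (simp add: n_def powr_realpow)
      also have "\<dots> = 2 * a / ?V" using n_ge_1 a V by (simp add: t_def powr_powr)
      finally show ?thesis using V by simp
    qed
    define \<rho> where "\<rho> = min (d y / 32) t"
    have rho: "0 < \<rho>" "\<rho> \<le> d y / 32" "\<rho> \<le> t" using dy t by (auto simp: \<rho>_def)
    define G where "G = {z \<in> ball y \<rho>. v z \<le> 7 / 8}"
    have G [measurable]: "G \<in> sets borel"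
    proof -
      have "G = ball y \<rho> \<inter> {z. v z \<le> 7 / 8}" by (auto simp: G_def)
      then show ?thesis by simp
    qed
    have "bounded G" unfolding G_def by (rule bounded_subset[OF bounded_ball]) auto
    then have Gfin: "emeasure lborel G < \<infinity>" by (rule emeasure_bounded_finite)
    have mball: "vol (ball y \<rho>) = ?V * \<rho> ^ DIM('a)" using rho by (intro measure_ball) auto
    have mG: "?V * \<rho> ^ DIM('a) / 8 \<le> vol G"
    proof (cases "d y / 32 \<le> t")
      case True
      then have "G = {z \<in> B y. v z \<le> 7 / 8}" by (auto simp: G_def \<rho>_def wball_def)
      moreover have "vol (B y) = ?V * \<rho> ^ DIM('a)"
        using True mball by (simp add: wball_def \<rho>_def)
      ultimately show ?thesis using measure_small_values[OF v y avg] by simp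
    next
      case False
      then have "\<rho> = t" by (simp add: \<rho>_def)
      then have "vol (ball y \<rho>) = 2 * a" using mball tn by simp
      moreover have "vol (ball y \<rho>) \<le> vol G + vol A"
      proof -
        have "ball y \<rho> \<subseteq> G \<union> A"
          using vA mem_region[OF y] rho dy by (fastforce simp: G_def)
        moreover have "emeasure lborel (G \<union> A) < \<infinity>"
          using A bounded_region \<open>bounded G\<close> by (intro emeasure_bounded_finite) (auto intro: bounded_subset)
        ultimately have "vol (ball y \<rho>) \<le> vol (G \<union> A)"
          using A G by (intro measure_mono_fmeasurable) (auto simp: fmeasurable_def)
        also have "\<dots> \<le> vol G + vol A"
          using A G by (intro measure_Un_le) auto
        finally show ?thesis .
      qed
      ultimately show ?thesis using a mball by simp
    qed
    \<comment> \<open>a lower bound for the integrand of the energy on \<open>G\<close>\<close>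
    define m where "m = (1/8) powr p * \<rho> powr (- (n + s * p)) * (d y powr bc / K)"
    have m: "0 < m" using rho dy K(1) by (simp add: m_def)
    have le: "ennreal m * indicator G z \<le> ennreal (?k v y z) * indicator {z. norm (y - z) \<le> d y / 2} z" for z
    proof (cases "z \<in> G")
      case True
      have yz: "dist y z < \<rho>" using True by (simp add: G_def)
      have "z \<noteq> y" using True vy by (auto simp: G_def)
      have dzy: "dist y z \<le> d y / 2" using yz rho dy by linarith
      have nz: "0 < norm (z - y)" "norm (z - y) \<le> \<rho>"
        using \<open>z \<noteq> y\<close> yz by (auto simp: dist_norm norm_minus_commute)
      have "(1/8) powr p \<le> \<bar>v z - v y\<bar> powr p"
        using True vy p_gt by (intro powr_mono2) (auto simp: G_def)
      moreover have "\<rho> powr (- (n + s * p)) \<le> norm (z - y) powr (- (n + s * p))"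
        using nz n_ge_1 sp by (intro powr_mono2') auto
      moreover have "d y powr bc / K \<le> min (d y) (d z) powr b"
        using K(2)[OF y dzy] K(1) by (simp add: field_simps)
      ultimately have "m \<le> \<bar>v z - v y\<bar> powr p * norm (z - y) powr (- (n + s * p)) * min (d y) (d z) powr b"
        unfolding m_def using K(1) by (intro mult_mono) auto
      also have "\<dots> = ?k v y z" unfolding powr_minus_divide[of "norm (z - y)"] by simp
      finally show ?thesis using True dzy by (simp add: dist_norm ennreal_leI)
    qed simp
    have "c * a powr (- \<theta>) \<le> m * vol G"
    proof -
      have e: "\<rho> powr (- (n + s * p)) * \<rho> ^ DIM('a) = \<rho> powr (- (s * p))"
        using rho by (simp add: powr_realpow[symmetric] n_def powr_add[symmetric])
      have "(2 * a / ?V) powr (- \<theta>) = t powr (- (n * \<theta>))"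
        using n_ge_1 by (simp add: t_def powr_powr)
      also have "\<dots> \<le> \<rho> powr (- (n * \<theta>))"
        using rho n_ge_1 theta_bounds by (intro powr_mono2') auto
      finally have 1: "(2 * a / ?V) powr (- \<theta>) \<le> \<rho> powr (- (n * \<theta>))" .
      have "R powr (bc - s * p + \<theta> * n) \<le> d y powr (bc - s * p + \<theta> * n)"
        using exponent_nonpos dy R(2)[OF y] by (intro powr_mono2') auto
      also have "\<dots> = d y powr bc * d y powr (- (s * p - \<theta> * n))"
        by (simp add: powr_add[symmetric] algebra_simps)
      also have "\<dots> \<le> d y powr bc * \<rho> powr (- (s * p - \<theta> * n))"
        using rho dy theta_le by (intro mult_left_mono powr_mono2') auto
      finally have 2: "R powr (bc - s * p + \<theta> * n) \<le> d y powr bc * \<rho> powr (- (s * p - \<theta> * n))" .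
      have "(2 * a / ?V) powr (- \<theta>) * R powr (bc - s * p + \<theta> * n)
          \<le> \<rho> powr (- (n * \<theta>)) * (d y powr bc * \<rho> powr (- (s * p - \<theta> * n)))"
        by (intro mult_mono 1 2) auto
      also have "\<dots> = d y powr bc * (\<rho> powr (- (n + s * p)) * \<rho> ^ DIM('a))"
        unfolding e by (simp add: powr_add[symmetric] mult_ac)
      finally have 3: "(2 * a / ?V) powr (- \<theta>) * R powr (bc - s * p + \<theta> * n)
          \<le> d y powr bc * (\<rho> powr (- (n + s * p)) * \<rho> ^ DIM('a))" .
      have 4: "(2 * a / ?V) powr (- \<theta>) = (2 / ?V) powr (- \<theta>) * a powr (- \<theta>)"
        using a V by (subst powr_mult[symmetric]) (auto simp: field_simps)
      have "c * a powr (- \<theta>) = ((1/8) powr p / K * (?V / 8)) * ((2 * a / ?V) powr (- \<theta>) * R powr (bc - s * p + \<theta> * n))"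
        unfolding c_def 4 by (simp add: mult_ac)
      also have "\<dots> \<le> ((1/8) powr p / K * (?V / 8)) * (d y powr bc * (\<rho> powr (- (n + s * p)) * \<rho> ^ DIM('a)))"
        using K(1) V by (intro mult_left_mono 3) auto
      also have "\<dots> = m * (?V * \<rho> ^ DIM('a) / 8)"
        unfolding m_def by (simp add: mult_ac)
      also have "\<dots> \<le> m * vol G"
        using m by (intro mult_left_mono mG) auto
      finally show ?thesis .
    qed
    then have "ennreal (c * a powr (- \<theta>)) \<le> ennreal (m * vol G)" by (rule ennreal_leI)
    also have "\<dots> = ennreal m * emeasure lborel G"
      using m Gfin by (simp add: ennreal_mult emeasure_eq_ennreal_measure)
    also have "\<dots> = (\<integral>\<^sup>+z. ennreal m * indicator G z \<partial>lborel)"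
      by (simp add: nn_integral_cmult)
    also have "\<dots> \<le> (\<integral>\<^sup>+z. ennreal (?k v y z) * indicator {z. norm (y - z) \<le> d y / 2} z \<partial>lborel)"
      by (intro nn_integral_mono le)
    finally show ?thesis .
  qed
  have "emeasure lborel E \<le> ennreal (1 / c * vol A powr \<theta>) * energy v"
    if sep: "separates v E A" and avg: "\<forall>y\<in>E. F v y \<le> 3 / 4" for v E A
  proof -
    have v: "unit_valued v" and E [measurable]: "E \<in> sets borel" and A: "A \<in> sets borel" "E \<subseteq> A" "A \<subseteq> \<Omega>"
      and vE: "\<forall>y\<in>E. v y = 1" and vA: "\<forall>z\<in>\<Omega> - A. v z = 0"
      using sep by (auto simp: separates_def)
    show ?thesis
    proof (cases "vol A = 0")
      case True
      then have "emeasure lborel A = 0" using emeasure_subset_eq[OF A(3)] by simp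
      then have "emeasure lborel E = 0" using A emeasure_mono[of E A lborel] by simp
      then show ?thesis by simp
    next
      case False
      define a where "a = vol A"
      have a: "0 < a" using False by (simp add: a_def zero_less_measure_iff)
      have ca: "0 < c * a powr (- \<theta>)" using c a by simp
      have "ennreal (c * a powr (- \<theta>)) * emeasure lborel E = (\<integral>\<^sup>+y. ennreal (c * a powr (- \<theta>)) * indicator E y \<partial>lborel)"
        using E by (simp add: nn_integral_cmult)
      also have "\<dots> \<le> energy v"
        unfolding frac_energy_def n_def[symmetric]
      proof (intro nn_integral_mono)
        fix y
        show "ennreal (c * a powr (- \<theta>)) * indicator E y \<le>
           (\<integral>\<^sup>+z. ennreal (?k v y z) * indicator {z. norm (y - z) \<le> d y / 2} z \<partial>lborel) * indicator \<Omega> y"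
          using inner[OF v A(1,3) _ _ _ _ a_def a, of y] vE vA avg A
          by (auto split: split_indicator)
      qed
      finally have "ennreal (1 / (c * a powr (- \<theta>))) * (ennreal (c * a powr (- \<theta>)) * emeasure lborel E)
          \<le> ennreal (1 / (c * a powr (- \<theta>))) * energy v" by (intro mult_left_mono) auto
      moreover have "ennreal (1 / (c * a powr (- \<theta>))) * (ennreal (c * a powr (- \<theta>)) * emeasure lborel E) = emeasure lborel E"
        using c a by (simp add: mult.assoc[symmetric] ennreal_mult[symmetric])
      moreover have "1 / (c * a powr (- \<theta>)) = 1 / c * a powr \<theta>" by (simp add: powr_minus_divide)
      ultimately show ?thesis by (simp add: a_def)
    qed
  qed
  then show ?thesis using c by (intro exI[of _ "1 / c"] conjI allI impI) auto
qed

end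

section \<open>Chains along segments\<close>

lemma nn_integral_indicator_split:
  fixes h :: "real \<Rightarrow> ennreal"
  assumes [measurable]: "h \<in> borel_measurable borel" and "a \<le> b" "b \<le> c"
  shows "(\<integral>\<^sup>+t. h t * indicator {a..<c} t \<partial>lborel)
       = (\<integral>\<^sup>+t. h t * indicator {a..<b} t \<partial>lborel) + (\<integral>\<^sup>+t. h t * indicator {b..<c} t \<partial>lborel)"
proof -
  have "(\<integral>\<^sup>+t. h t * indicator {a..<c} t \<partial>lborel)
     = (\<integral>\<^sup>+t. h t * indicator {a..<b} t + h t * indicator {b..<c} t \<partial>lborel)"
    using assms by (intro nn_integral_cong) (auto split: split_indicator)
  then show ?thesis by (simp add: nn_integral_add)
qed

text \<open>The steps have length at least \<open>r s / 128\<close>, so that a difference over a step can be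
  charged to an integral over that step. Stepping stops as soon as the remainder is at most
  \<open>r s / 32\<close>; this keeps the last step from being too short.\<close>

lemma chain_integral:
  fixes g r :: "real \<Rightarrow> real" and h :: "real \<Rightarrow> ennreal"
  assumes [measurable]: "h \<in> borel_measurable borel"
    and lip: "\<And>s t. \<bar>r s - r t\<bar> \<le> \<bar>s - t\<bar>"
    and pos: "0 < r0" "\<And>t. t \<in> {0..T} \<Longrightarrow> r0 \<le> r t"
    and step: "\<And>s t. 0 \<le> s \<Longrightarrow> t \<le> T \<Longrightarrow> r s / 128 \<le> t - s \<Longrightarrow> t - s \<le> r s / 32 \<Longrightarrow>
       ennreal \<bar>g s - g t\<bar> \<le> (\<integral>\<^sup>+\<tau>. h \<tau> * indicator {s..<t} \<tau> \<partial>lborel)"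
    and start: "r 0 / 128 \<le> T" and T: "0 \<le> T"
  shows "ennreal \<bar>g 0 - g T\<bar> \<le> (\<integral>\<^sup>+\<tau>. h \<tau> * indicator {0..<T} \<tau> \<partial>lborel)"
proof -
  let ?I = "\<lambda>a b. \<integral>\<^sup>+\<tau>. h \<tau> * indicator {a..<b} \<tau> \<partial>lborel"
  have claim: "ennreal \<bar>g a - g T\<bar> \<le> ?I a T"
    if "0 \<le> a" "r a / 128 \<le> T - a" "a \<le> T" "T - a \<le> real k * (r0 / 128)" for a k
    using that
  proof (induction k arbitrary: a)
    case 0
    then show ?case using pos(1) pos(2)[of a] by auto
  next
    case (Suc k)
    have ra: "r0 \<le> r a" using pos(2)[of a] Suc.prems by auto
    show ?case
    proof (cases "T - a \<le> r a / 32")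
      case True
      then show ?thesis using step[of a T] Suc.prems by auto
    next
      case False
      define a' where "a' = a + r a / 128"
      have a': "a \<le> a'" "a' \<le> T" using ra pos(1) False by (auto simp: a'_def)
      have "r a' \<le> r a + r a / 128" using lip[of a' a] a' unfolding a'_def by linarith
      then have 1: "r a' / 128 \<le> T - a'" using False ra pos(1) by (simp add: a'_def)
      have 2: "T - a' \<le> real k * (r0 / 128)" using Suc.prems(4) ra by (simp add: a'_def algebra_simps)
      have "ennreal \<bar>g a - g T\<bar> \<le> ennreal (\<bar>g a - g a'\<bar> + \<bar>g a' - g T\<bar>)"
        by (intro ennreal_leI) linarith
      also have "\<dots> = ennreal \<bar>g a - g a'\<bar> + ennreal \<bar>g a' - g T\<bar>" by simp
      also have "\<dots> \<le> ?I a a' + ?I a' T"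
      proof (intro add_mono)
        show "ennreal \<bar>g a - g a'\<bar> \<le> ?I a a'"
          using a' Suc.prems(1) ra pos(1) by (intro step) (auto simp: a'_def)
        show "ennreal \<bar>g a' - g T\<bar> \<le> ?I a' T"
          using Suc.IH[of a'] 1 2 a' Suc.prems(1) by auto
      qed
      also have "\<dots> = ?I a T"
        using a' by (intro nn_integral_indicator_split[symmetric]) auto
      finally show ?thesis .
    qed
  qed
  have "0 \<le> T" "T - 0 \<le> real (nat \<lceil>T / (r0 / 128)\<rceil>) * (r0 / 128)"
  proof -
    show "0 \<le> T" by (rule T)
    show "T - 0 \<le> real (nat \<lceil>T / (r0 / 128)\<rceil>) * (r0 / 128)"
    proof -
      have "T / (r0 / 128) \<le> real (nat \<lceil>T / (r0 / 128)\<rceil>)" by linarith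
      then have "T / (r0 / 128) * (r0 / 128) \<le> real (nat \<lceil>T / (r0 / 128)\<rceil>) * (r0 / 128)"
        using pos(1) by (intro mult_right_mono) auto
      then show ?thesis using pos(1) by simp
    qed
  qed
  then show ?thesis using claim[of 0] start by auto
qed

context bounded_region
begin

lemma osc_measurable:
  assumes "unit_valued v"
  shows "osc r v \<in> borel_measurable borel"
proof -
  have [measurable]: "v \<in> borel_measurable borel" by (rule unit_valued_measurable[OF assms])
  have eq: "indicator (ball \<xi> (5 * d \<xi> / 32)) z = (if dist \<xi> z < 5 * d \<xi> / 32 then 1 else 0 :: ennreal)" for \<xi> z
    by (auto split: split_indicator)
  show ?thesis unfolding osc_def eq by measurable
qed

text \<open>Over one step, \<open>avg_step\<close> is averaged over all intermediate points \<open>\<xi>\<close>; dividing by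
  the length of the step costs at most \<open>132 / d \<xi>\<close>, where \<open>132 = 128 * 33 / 32\<close>.\<close>

lemma segment_bound:
  assumes v: "unit_valued v" and e: "norm e = 1" and T: "0 < T"
    and seg: "\<And>t. t \<in> {0..T} \<Longrightarrow> y - t *\<^sub>R e \<in> \<Omega>" and start: "d y / 128 \<le> T"
  shows "ennreal \<bar>F v y - F v (y - T *\<^sub>R e)\<bar>
    \<le> (\<integral>\<^sup>+t. ennreal (132 * step_const * d (y - t *\<^sub>R e) powr (- 2 * real DIM('a) - 1))
           * osc 1 v (y - t *\<^sub>R e) * indicator {0..<T} t \<partial>lborel)"
proof -
  have [measurable]: "osc 1 v \<in> borel_measurable borel" by (rule osc_measurable[OF v])
  define \<xi> where "\<xi> t = y - t *\<^sub>R e" for t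
  have xi_dist: "dist (\<xi> s) (\<xi> t) = \<bar>s - t\<bar>" for s t
  proof -
    have "\<xi> s - \<xi> t = (t - s) *\<^sub>R e" by (simp add: \<xi>_def algebra_simps)
    then show ?thesis using e by (simp add: dist_norm abs_minus_commute)
  qed
  have [measurable]: "\<xi> \<in> borel_measurable borel" unfolding \<xi>_def by measurable
  have "continuous_on {0..T} (\<lambda>t. d (\<xi> t))"
    unfolding \<xi>_def by (intro continuous_on_compose2[OF continuous_d] continuous_intros) auto
  then obtain t0 where t0: "t0 \<in> {0..T}" "\<And>t. t \<in> {0..T} \<Longrightarrow> d (\<xi> t0) \<le> d (\<xi> t)"
    using continuous_attains_inf[of "{0..T}" "\<lambda>t. d (\<xi> t)"] T by auto
  have "ennreal \<bar>F v (\<xi> 0) - F v (\<xi> T)\<bar>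
    \<le> (\<integral>\<^sup>+t. (ennreal (132 * step_const * d (\<xi> t) powr (- 2 * real DIM('a) - 1)) * osc 1 v (\<xi> t))
          * indicator {0..<T} t \<partial>lborel)"
  proof (rule chain_integral[where r = "\<lambda>t. d (\<xi> t)" and ?r0.0 = "d (\<xi> t0)"])
    show "\<bar>d (\<xi> s) - d (\<xi> t)\<bar> \<le> \<bar>s - t\<bar>" for s t
      using d_lipschitz[of "\<xi> s" "\<xi> t"] xi_dist[of s t] by simp
    show "0 < d (\<xi> t0)" using seg[OF t0(1)] by (auto simp: \<xi>_def intro: d_pos)
    show "d (\<xi> 0) / 128 \<le> T" using start by (simp add: \<xi>_def)
  next
    fix s t assume st: "0 \<le> s" "t \<le> T" "d (\<xi> s) / 128 \<le> t - s" "t - s \<le> d (\<xi> s) / 32"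
    have st': "s \<le> t" using st(3) dist_nonneg[of "\<xi> s"] by linarith
    have xs: "\<xi> s \<in> \<Omega>" using seg[of s] st st' by (simp add: \<xi>_def)
    have ds: "0 < d (\<xi> s)" by (rule d_pos[OF xs])
    have lt: "0 < t - s" using ds st by linarith
    let ?D = "\<bar>F v (\<xi> s) - F v (\<xi> t)\<bar>"
    have "ennreal ?D = (\<integral>\<^sup>+\<tau>. ennreal (?D / (t - s)) * indicator {s..<t} \<tau> \<partial>lborel)"
      using lt by (simp add: nn_integral_cmult ennreal_mult[symmetric])
    also have "\<dots> \<le> (\<integral>\<^sup>+\<tau>. (ennreal (132 * step_const * d (\<xi> \<tau>) powr (- 2 * real DIM('a) - 1)) * osc 1 v (\<xi> \<tau>)) * indicator {s..<t} \<tau> \<partial>lborel)"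
    proof (intro nn_integral_mono)
      fix \<tau>
      show "ennreal (?D / (t - s)) * indicator {s..<t} \<tau>
        \<le> (ennreal (132 * step_const * d (\<xi> \<tau>) powr (- 2 * real DIM('a) - 1)) * osc 1 v (\<xi> \<tau>)) * indicator {s..<t} \<tau>"
      proof (cases "\<tau> \<in> {s..<t}")
        case True
        have d1: "dist (\<xi> s) (\<xi> t) \<le> d (\<xi> s) / 32" "dist (\<xi> s) (\<xi> \<tau>) \<le> d (\<xi> s) / 32"
          using True st by (auto simp: xi_dist)
        have dt: "d (\<xi> \<tau>) \<le> 33 / 32 * d (\<xi> s)" "31 / 32 * d (\<xi> s) \<le> d (\<xi> \<tau>)"
          using d_lipschitz[of "\<xi> s" "\<xi> \<tau>"] d1(2) by linarith+
        have dpos: "0 < d (\<xi> \<tau>)" using dt ds by linarith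
        have "1 / (t - s) \<le> 132 / d (\<xi> \<tau>)"
        proof -
          have "d (\<xi> \<tau>) / 132 \<le> t - s" using dt st ds by linarith
          then show ?thesis using lt dpos by (simp add: field_simps)
        qed
        then have "ennreal (?D / (t - s)) \<le> ennreal (132 / d (\<xi> \<tau>) * ?D)"
          by (intro ennreal_leI) (metis abs_ge_zero mult.commute mult_left_mono times_divide_eq_right mult.right_neutral)
        also have "\<dots> = ennreal (132 / d (\<xi> \<tau>)) * ennreal ?D"
          using dpos by (intro ennreal_mult) auto
        also have "\<dots> \<le> ennreal (132 / d (\<xi> \<tau>)) * (ennreal (step_const * d (\<xi> \<tau>) powr (- 2 * real DIM('a))) * osc 1 v (\<xi> \<tau>))"
          by (intro mult_left_mono avg_step[OF v xs d1]) auto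
        also have "\<dots> = ennreal (132 / d (\<xi> \<tau>) * (step_const * d (\<xi> \<tau>) powr (- 2 * real DIM('a)))) * osc 1 v (\<xi> \<tau>)"
          using dpos step_const_pos by (subst ennreal_mult) (auto simp: mult.assoc)
        also have "132 / d (\<xi> \<tau>) * (step_const * d (\<xi> \<tau>) powr (- 2 * real DIM('a)))
            = 132 * step_const * d (\<xi> \<tau>) powr (- 2 * real DIM('a) - 1)"
          using dpos by (simp add: powr_diff)
        finally show ?thesis using True by simp
      qed simp
    qed
    finally show "ennreal ?D \<le> (\<integral>\<^sup>+\<tau>. (ennreal (132 * step_const * d (\<xi> \<tau>) powr (- 2 * real DIM('a) - 1)) * osc 1 v (\<xi> \<tau>)) * indicator {s..<t} \<tau> \<partial>lborel)" .
  qed (use t0 T in auto)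
  then show ?thesis by (simp add: \<xi>_def)
qed

end

section \<open>Two integrals\<close>

lemma nn_integral_shifted_powr_le:
  fixes r k T :: real
  assumes "0 < r" "0 < k" "0 \<le> T"
  shows "(\<integral>\<^sup>+t. ennreal ((r + t) powr (- 1 - k)) * indicator {0..T} t \<partial>lborel) \<le> ennreal (r powr (- k) / k)"
proof -
  have "(\<integral>\<^sup>+t. ennreal ((r + t) powr (- 1 - k)) * indicator {0..T} t \<partial>lborel)
     = ennreal ((- ((r + T) powr (- k)) / k) - (- ((r + 0) powr (- k)) / k))"
  proof (rule nn_integral_FTC_Icc)
    fix t assume t: "t \<in> {0..T}"
    show "((\<lambda>t. - ((r + t) powr (- k)) / k) has_real_derivative (r + t) powr (- 1 - k)) (at t)"
    proof -
      have "((\<lambda>t. (r + t) powr (- k)) has_real_derivative (- k) * (r + t) powr (- k - real 1) * 1) (at t)"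
        using t assms by (intro DERIV_fun_powr) (auto intro!: derivative_eq_intros)
      from DERIV_cmult[OF this, of "- (1 / k)"]
      show ?thesis
        using assms by (simp add: minus_diff_commute)
    qed
  qed (use assms in auto)
  also have "\<dots> \<le> ennreal (r powr (- k) / k)"
    using assms by (intro ennreal_leI) (simp add: divide_nonneg_pos)
  finally show ?thesis .
qed

lemma nn_integral_inverse_sqrt:
  fixes r :: real
  assumes "0 < r"
  shows "(\<integral>\<^sup>+t. indicator {0..r} t * ennreal ((r - t) powr (- 1/2)) \<partial>lborel) = ennreal (2 * r powr (1/2))"
proof -
  have "((\<lambda>t. (r - t) powr (- 1/2)) has_integral ((- 2 * (r - r) powr (1/2)) - (- 2 * (r - 0) powr (1/2)))) {0..r}"
  proof (rule fundamental_theorem_of_calculus_interior)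
    show "continuous_on {0..r} (\<lambda>t. - 2 * (r - t) powr (1/2))"
      by (intro continuous_intros continuous_on_powr') auto
    show "((\<lambda>t. - 2 * (r - t) powr (1/2)) has_vector_derivative (r - t) powr (- 1/2)) (at t)"
      if "t \<in> {0<..<r}" for t
      unfolding has_real_derivative_iff_has_vector_derivative[symmetric]
      using that by (auto intro!: derivative_eq_intros simp: powr_diff powr_minus field_simps)
  qed (use assms in auto)
  from nn_integral_has_integral_lebesgue[OF _ this]
  have "(\<integral>\<^sup>+t. ennreal (indicator {0..r} t * (r - t) powr (- 1/2)) \<partial>lborel) = ennreal (2 * r powr (1/2))"
    by simp
  moreover have "(\<integral>\<^sup>+t. indicator {0..r} t * ennreal ((r - t) powr (- 1/2)) \<partial>lborel)
      = (\<integral>\<^sup>+t. ennreal (indicator {0..r} t * (r - t) powr (- 1/2)) \<partial>lborel)"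
    by (intro nn_integral_cong) (auto split: split_indicator)
  ultimately show ?thesis by simp
qed


section \<open>The chain estimate in a boundary chart\<close>

lemma nn_integral_translate:
  fixes f :: "'a::euclidean_space \<Rightarrow> ennreal"
  assumes [measurable]: "f \<in> borel_measurable borel"
  shows "(\<integral>\<^sup>+y. f y \<partial>lborel) = (\<integral>\<^sup>+x. f (c + x) \<partial>lborel)"
proof -
  have "(\<integral>\<^sup>+y. f y \<partial>lborel) = (\<integral>\<^sup>+y. f y \<partial>distr lborel borel ((+) c))"
    by (simp add: lborel_distr_plus)
  also have "\<dots> = (\<integral>\<^sup>+x. f (c + x) \<partial>lborel)"
    by (intro nn_integral_distr) auto
  finally show ?thesis .
qed

text \<open>The vector \<open>- e\<close> points into \<open>\<Omega>\<close>, and \<open>\<rho> y\<close> is the depth of \<open>y\<close> below the graph,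
  measured along \<open>e\<close>. That the graph is Hoelder continuous enters only through \<open>rho_le\<close>: a
  point at depth \<open>h\<close> has distance at least of order \<open>h powr (1 / \<alpha>)\<close> to the boundary.\<close>

locale boundary_chart = sobolev_exponents \<Omega> \<alpha> s p q b n bc \<gamma> \<theta>
  for \<Omega> :: "'a::euclidean_space set" and \<alpha> s p q b n bc \<gamma> \<theta> :: real +
  fixes e :: 'a and \<rho> :: "'a \<Rightarrow> real" and Y :: "'a set" and T c :: real
  assumes e: "norm e = 1" and T: "0 < T" and c: "0 < c"
    and rho_measurable [measurable]: "\<rho> \<in> borel_measurable borel"
    and rho_shift: "\<rho> (y - t *\<^sub>R e) = \<rho> y + t"
    and chart: "y \<in> Y \<Longrightarrow> t \<in> {0..T} \<Longrightarrow> y - t *\<^sub>R e \<in> \<Omega>"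
    and rho_pos: "y \<in> Y \<Longrightarrow> 0 < \<rho> y"
    and rho_le: "y \<in> Y \<Longrightarrow> t \<in> {0..T} \<Longrightarrow> c * (\<rho> y + t) \<le> d (y - t *\<^sub>R e) powr \<alpha>"
    and Y_small: "y \<in> Y \<Longrightarrow> d y / 128 \<le> T"
begin

text \<open>The chain estimate carries a weight \<open>\<rho> powr (- a)\<close>, without which an integral over the
  depth would be logarithmically large near the boundary. Any \<open>a\<close> between 0 and \<open>p / q\<close>
  serves; for this one the weight raised to the power \<open>q / p\<close> is \<open>\<rho> powr (- 1/2)\<close>.\<close>

definition a :: real where "a = p / (2 * q)"
definition \<kappa> :: real where "\<kappa> = - 2 * n - p + \<alpha> * (p - 1 + a)"

lemma a_pos: "0 < a" using p_gt q_gt by (simp add: a_def)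

text \<open>The Young parameter at \<open>\<xi> = y - t *\<^sub>R e\<close> is proportional to
  \<open>d \<xi> * (r + t) powr (- 1 - k) * r powr k\<close> with \<open>r = \<rho> y\<close>, so that its contribution has an
  integral over \<open>t\<close> that does not depend on \<open>r\<close> and can be absorbed into the left-hand side.
  In the other term \<open>c * (r + t) \<le> d \<xi> powr \<alpha>\<close> turns the powers of \<open>r + t\<close> into powers of
  \<open>d \<xi>\<close>, which leaves \<open>d \<xi> powr \<kappa>\<close> and the weight.\<close>

lemma chain_point:
  "\<exists>C>0. \<forall>v y. unit_valued v \<longrightarrow> y \<in> Y \<longrightarrow> 1 / 8 \<le> \<bar>F v y - F v (y - T *\<^sub>R e)\<bar> \<longrightarrow>
    1 \<le> ennreal (C * \<rho> y powr (- a)) *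
         (\<integral>\<^sup>+t. ennreal (d (y - t *\<^sub>R e) powr \<kappa>) * osc p v (y - t *\<^sub>R e) * indicator {0..<T} t \<partial>lborel)"
proof -
  let ?V = "unit_ball_vol (real DIM('a))"
  define k where "k = a / (p - 1)"
  have k: "0 < k" using a_pos p_gt by (simp add: k_def)
  have kp: "k * (p - 1) = a" using p_gt by (simp add: k_def)
  define C1 where "C1 = 132 * step_const"
  have C1: "0 < C1" using step_const_pos by (simp add: C1_def)
  \<comment> \<open>the integral of \<open>(r + t) powr (- 1 - k)\<close> is at most \<open>r powr (- k) / k\<close>; the target is \<open>1 / 16\<close>\<close>
  define \<mu> where "\<mu> = k / (16 * C1 * ?V ^ 2)"
  have V2: "0 < ?V ^ 2" by simp
  have mu: "0 < \<mu>" unfolding \<mu>_def using k C1 by (intro divide_pos_pos mult_pos_pos V2) auto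
  have mu_eq: "C1 * ?V ^ 2 * \<mu> = k / 16" using C1 by (simp add: \<mu>_def)
  define C where "C = 16 * (C1 * (\<mu> powr (1 - p) * c powr (- (p - 1 + a))))"
  have C: "0 < C" using C1 mu c by (simp add: C_def)
  have "1 \<le> ennreal (C * \<rho> y powr (- a)) *
         (\<integral>\<^sup>+t. ennreal (d (y - t *\<^sub>R e) powr \<kappa>) * osc p v (y - t *\<^sub>R e) * indicator {0..<T} t \<partial>lborel)"
    if v: "unit_valued v" and y: "y \<in> Y" and drop: "1 / 8 \<le> \<bar>F v y - F v (y - T *\<^sub>R e)\<bar>" for v y
  proof -
    have [measurable]: "osc p v \<in> borel_measurable borel" by (rule osc_measurable[OF v])
    define r where "r = \<rho> y"
    have r: "0 < r" using rho_pos[OF y] by (simp add: r_def)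
    define \<xi> where "\<xi> t = y - t *\<^sub>R e" for t
    have [measurable]: "\<xi> \<in> borel_measurable borel" unfolding \<xi>_def by measurable
    have xi: "\<xi> t \<in> \<Omega>" "c * (r + t) \<le> d (\<xi> t) powr \<alpha>" if "t \<in> {0..T}" for t
      using chart[OF y that] rho_le[OF y that] by (auto simp: \<xi>_def r_def)
    let ?g = "\<lambda>t. ennreal ((r + t) powr (- 1 - k))"
    let ?h = "\<lambda>t. ennreal (d (\<xi> t) powr \<kappa>) * osc p v (\<xi> t)"
    let ?H = "\<integral>\<^sup>+t. ?h t * indicator {0..<T} t \<partial>lborel"
    have key: "ennreal (C1 * d (\<xi> t) powr (- 2 * n - 1)) * osc 1 v (\<xi> t)
        \<le> ennreal (k / 16 * r powr k) * ?g t + ennreal (C / 16 * r powr (- a)) * ?h t"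
      if t: "t \<in> {0..<T}" for t
    proof -
      let ?d = "d (\<xi> t)"
      have xt: "\<xi> t \<in> \<Omega>" "c * (r + t) \<le> ?d powr \<alpha>" using xi[of t] t by auto
      have dpos: "0 < ?d" by (rule d_pos[OF xt(1)])
      have rt: "0 < r + t" using r t by simp
      define W where "W = \<mu> * ?d * (r + t) powr (- 1 - k) * r powr k"
      have W: "0 < W" using mu dpos rt r by (simp add: W_def)
      have "W powr (1 - p) = \<mu> powr (1 - p) * ?d powr (1 - p) * (r + t) powr (p - 1 + a) * r powr (- a)"
      proof -
        have e1: "(- 1 - k) * (1 - p) = p - 1 + a" "k * (1 - p) = - a"
          using kp by (simp_all add: algebra_simps)
        show ?thesis unfolding W_def using mu dpos rt r
          by (simp add: powr_mult powr_powr e1)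
      qed
      also have "\<dots> \<le> \<mu> powr (1 - p) * ?d powr (1 - p) * (c powr (- (p - 1 + a)) * ?d powr (\<alpha> * (p - 1 + a))) * r powr (- a)"
      proof -
        have pa: "0 \<le> p - 1 + a" using p_gt a_pos by simp
        have "(c * (r + t)) powr (p - 1 + a) \<le> (?d powr \<alpha>) powr (p - 1 + a)"
          using xt(2) c rt pa by (intro powr_mono2) auto
        then have "c powr (p - 1 + a) * (r + t) powr (p - 1 + a) \<le> ?d powr (\<alpha> * (p - 1 + a))"
          using c rt by (simp add: powr_mult powr_powr)
        then have "(r + t) powr (p - 1 + a) \<le> c powr (- (p - 1 + a)) * ?d powr (\<alpha> * (p - 1 + a))"
          unfolding powr_minus_divide[of c] using c by (simp add: field_simps)
        then show ?thesis by (intro mult_right_mono mult_left_mono) auto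
      qed
      finally have W1p: "W powr (1 - p) \<le> \<mu> powr (1 - p) * ?d powr (1 - p) * (c powr (- (p - 1 + a)) * ?d powr (\<alpha> * (p - 1 + a))) * r powr (- a)" .
      have "ennreal (C1 * ?d powr (- 2 * n - 1)) * osc 1 v (\<xi> t)
          \<le> ennreal (C1 * ?d powr (- 2 * n - 1)) * (ennreal (?V ^ 2 * ?d powr (2 * n) * W) + ennreal (W powr (1 - p)) * osc p v (\<xi> t))"
        unfolding n_def using p_gt by (intro mult_left_mono osc_powr_interpolation[OF v xt(1) W]) auto
      also have "\<dots> = ennreal ((C1 * ?d powr (- 2 * n - 1)) * (?V ^ 2 * ?d powr (2 * n) * W))
          + ennreal ((C1 * ?d powr (- 2 * n - 1)) * W powr (1 - p)) * osc p v (\<xi> t)"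
        using C1 W by (simp add: distrib_left ennreal_mult mult.assoc)
      also have "(C1 * ?d powr (- 2 * n - 1)) * (?V ^ 2 * ?d powr (2 * n) * W)
          = (C1 * ?V ^ 2 * \<mu>) * (?d powr (- 2 * n - 1) * ?d powr (2 * n) * ?d powr 1) * ((r + t) powr (- 1 - k) * r powr k)"
        unfolding W_def using dpos by simp
      also have "\<dots> = (k / 16 * r powr k) * (r + t) powr (- 1 - k)"
        unfolding mu_eq powr_add[symmetric] using dpos by simp
      also have "ennreal ((C1 * ?d powr (- 2 * n - 1)) * W powr (1 - p)) * osc p v (\<xi> t)
          \<le> ennreal ((C / 16 * r powr (- a)) * ?d powr \<kappa>) * osc p v (\<xi> t)"
      proof (intro mult_right_mono ennreal_leI)
        have "(C1 * ?d powr (- 2 * n - 1)) * W powr (1 - p)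
          \<le> (C1 * ?d powr (- 2 * n - 1)) * (\<mu> powr (1 - p) * ?d powr (1 - p) * (c powr (- (p - 1 + a)) * ?d powr (\<alpha> * (p - 1 + a))) * r powr (- a))"
          using C1 by (intro mult_left_mono W1p) auto
        also have "\<dots> = (C / 16 * r powr (- a)) * (?d powr (- 2 * n - 1) * ?d powr (1 - p) * ?d powr (\<alpha> * (p - 1 + a)))"
          by (simp add: C_def mult_ac)
        also have "?d powr (- 2 * n - 1) * ?d powr (1 - p) * ?d powr (\<alpha> * (p - 1 + a)) = ?d powr \<kappa>"
          unfolding powr_add[symmetric] \<kappa>_def by (simp add: algebra_simps)
        finally show "(C1 * ?d powr (- 2 * n - 1)) * W powr (1 - p) \<le> (C / 16 * r powr (- a)) * ?d powr \<kappa>" .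
      qed auto
      also have "ennreal ((k / 16 * r powr k) * (r + t) powr (- 1 - k)) = ennreal (k / 16 * r powr k) * ?g t"
        using k by (intro ennreal_mult) auto
      also have "ennreal ((C / 16 * r powr (- a)) * ?d powr \<kappa>) * osc p v (\<xi> t) = ennreal (C / 16 * r powr (- a)) * ?h t"
        using C by (subst ennreal_mult) (auto simp: mult.assoc)
      finally show ?thesis by (simp add: add_left_mono)
    qed
    have "ennreal (1 / 8) \<le> ennreal \<bar>F v y - F v (y - T *\<^sub>R e)\<bar>"
      using drop by (rule ennreal_leI)
    also have "\<dots> \<le> (\<integral>\<^sup>+t. ennreal (C1 * d (\<xi> t) powr (- 2 * n - 1)) * osc 1 v (\<xi> t) * indicator {0..<T} t \<partial>lborel)"
      unfolding C1_def \<xi>_def n_def using e T chart[OF y] Y_small[OF y] by (intro segment_bound[OF v]) auto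
    also have "\<dots> \<le> (\<integral>\<^sup>+t. ennreal (k / 16 * r powr k) * (?g t * indicator {0..T} t)
         + ennreal (C / 16 * r powr (- a)) * (?h t * indicator {0..<T} t) \<partial>lborel)"
      using key by (intro nn_integral_mono) (auto split: split_indicator)
    also have "\<dots> = ennreal (k / 16 * r powr k) * (\<integral>\<^sup>+t. ?g t * indicator {0..T} t \<partial>lborel)
         + ennreal (C / 16 * r powr (- a)) * ?H"
      by (simp add: nn_integral_add nn_integral_cmult)
    also have "\<dots> \<le> ennreal (1 / 16) + ennreal (C / 16 * r powr (- a)) * ?H"
    proof (intro add_right_mono)
      have "ennreal (k / 16 * r powr k) * (\<integral>\<^sup>+t. ?g t * indicator {0..T} t \<partial>lborel)
         \<le> ennreal (k / 16 * r powr k) * ennreal (r powr (- k) / k)"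
        using r k T by (intro mult_left_mono nn_integral_shifted_powr_le) auto
      also have "\<dots> = ennreal ((k / 16 * r powr k) * (r powr (- k) / k))"
        using k by (intro ennreal_mult[symmetric]) auto
      also have "(k / 16 * r powr k) * (r powr (- k) / k) = 1 / 16"
        using k r by (simp add: powr_minus_divide)
      finally show "ennreal (k / 16 * r powr k) * (\<integral>\<^sup>+t. ?g t * indicator {0..T} t \<partial>lborel) \<le> ennreal (1 / 16)" .
    qed
    finally have le: "ennreal (1 / 8) \<le> ennreal (1 / 16) + ennreal (C / 16 * r powr (- a)) * ?H" .
    \<comment> \<open>the first term on the right is absorbed; the integral is possibly infinite\<close>
    have sub: "1 \<le> ennreal 16 * X" if "ennreal (1 / 8) \<le> ennreal (1 / 16) + X" for X
    proof (cases X)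
      case (real x)
      then have "1 / 8 \<le> 1 / 16 + x" using that by (simp flip: ennreal_plus)
      then have "1 \<le> 16 * x" by simp
      then have "ennreal 1 \<le> ennreal (16 * x)" by (rule ennreal_leI)
      then show ?thesis using real by (simp add: ennreal_mult)
    qed (simp add: ennreal_mult_top)
    have "1 \<le> ennreal 16 * (ennreal (C / 16 * r powr (- a)) * ?H)"
      by (rule sub[OF le])
    also have "\<dots> = ennreal (16 * (C / 16 * r powr (- a))) * ?H"
      using C by (subst ennreal_mult) (auto simp: mult.assoc)
    finally show ?thesis by (simp add: \<xi>_def r_def)
  qed
  then show ?thesis using C by blast
qed

end

context boundary_chart
begin

text \<open>The weighted measure of all pairs \<open>(y, t)\<close> with \<open>y\<close> in \<open>E\<close> for which the path from \<open>y\<close>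
  into the interior is near \<open>z\<close> at time \<open>t\<close>.\<close>

definition shadow :: "'a set \<Rightarrow> real \<Rightarrow> 'a \<Rightarrow> ennreal" where
  "shadow E k z = (\<integral>\<^sup>+y. (\<integral>\<^sup>+t. indicator E y * indicator {0..<T} t
       * (if dist z (y - t *\<^sub>R e) \<le> d z / 4 then 1 else 0) * ennreal (\<rho> y powr k) \<partial>lborel) \<partial>lborel)"

lemma shadow_length:
  "(\<integral>\<^sup>+t. indicator {0..<T} t * (if dist z (y - t *\<^sub>R e) \<le> r then 1 else 0) \<partial>lborel) \<le> ennreal (2 * r)"
  if "0 \<le> r"
proof -
  let ?s = "(y - z) \<bullet> e"
  have ee: "e \<bullet> e = 1" using e by (simp add: norm_eq_1)
  have "(\<integral>\<^sup>+t. indicator {0..<T} t * (if dist z (y - t *\<^sub>R e) \<le> r then 1 else 0) \<partial>lborel)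
      \<le> (\<integral>\<^sup>+t. indicator {?s - r..?s + r} t \<partial>lborel)"
  proof (intro nn_integral_mono)
    fix t
    have "?s - r \<le> t \<and> t \<le> ?s + r" if t: "dist z (y - t *\<^sub>R e) \<le> r"
    proof -
      have "(y - t *\<^sub>R e - z) \<bullet> e = ?s - t" using ee by (simp add: inner_diff_left)
      moreover have "\<bar>(y - t *\<^sub>R e - z) \<bullet> e\<bar> \<le> norm (y - t *\<^sub>R e - z)"
        using Cauchy_Schwarz_ineq2[of "y - t *\<^sub>R e - z" e] e by simp
      ultimately show ?thesis using t by (simp add: dist_norm norm_minus_commute abs_le_iff)
    qed
    then show "indicator {0..<T} t * (if dist z (y - t *\<^sub>R e) \<le> r then 1 else 0) \<le> (indicator {?s - r..?s + r} t :: ennreal)"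
      by (auto split: split_indicator)
  qed
  also have "\<dots> = ennreal (2 * r)" using \<open>0 \<le> r\<close> by simp
  finally show ?thesis .
qed

text \<open>After the translation \<open>y = x + t *\<^sub>R e\<close> the point \<open>x\<close> ranges over a ball of radius
  \<open>d z / 4\<close>, and \<open>t\<close> over part of a segment of length \<open>\<rho> x\<close>, which is at most of order
  \<open>d z powr \<alpha>\<close>; the integral of \<open>(\<rho> x - t) powr (- 1/2)\<close> over it is of order
  \<open>d z powr (\<alpha> / 2)\<close>.\<close>

lemma shadow_half_le:
  "\<exists>C>0. \<forall>E z. E \<in> sets borel \<longrightarrow> E \<subseteq> Y \<longrightarrow> z \<in> \<Omega> \<longrightarrow>
     shadow E (- 1/2) z \<le> ennreal (C * d z powr (n + \<alpha> / 2))"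
proof -
  let ?V = "unit_ball_vol (real DIM('a))"
  define C where "C = ?V * (2 * (2 powr \<alpha> / c) powr (1/2))"
  have C: "0 < C" unfolding C_def using c by (intro mult_pos_pos) auto
  have "shadow E (- 1/2) z \<le> ennreal (C * d z powr (n + \<alpha> / 2))"
    if [measurable]: "E \<in> sets borel" and E: "E \<subseteq> Y" and z: "z \<in> \<Omega>" for E z
  proof -
    have dz: "0 < d z" by (rule d_pos[OF z])
    define M where "M = (2 * d z) powr \<alpha> / c"
    have M: "0 < M" using dz c by (simp add: M_def)
    let ?i = "\<lambda>x. if dist z x \<le> d z / 4 then 1 else 0 :: ennreal"
    let ?h = "\<lambda>x t. indicator E (t *\<^sub>R e + x) * indicator {0..<T} t * ?i x * ennreal (\<rho> (t *\<^sub>R e + x) powr (- 1/2))"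
    have "shadow E (- 1/2) z = (\<integral>\<^sup>+t. (\<integral>\<^sup>+y. indicator E y * indicator {0..<T} t * ?i (y - t *\<^sub>R e) * ennreal (\<rho> y powr (- 1/2)) \<partial>lborel) \<partial>lborel)"
      unfolding shadow_def by (rule lborel_pair.Fubini') measurable
    also have "\<dots> = (\<integral>\<^sup>+t. (\<integral>\<^sup>+x. ?h x t \<partial>lborel) \<partial>lborel)"
    proof (rule nn_integral_cong)
      fix t :: real
      show "(\<integral>\<^sup>+y. indicator E y * indicator {0..<T} t * ?i (y - t *\<^sub>R e) * ennreal (\<rho> y powr (- 1/2)) \<partial>lborel)
        = (\<integral>\<^sup>+x. ?h x t \<partial>lborel)"
        by (subst nn_integral_translate[where c = "t *\<^sub>R e"]) auto
    qed
    also have "\<dots> = (\<integral>\<^sup>+x. (\<integral>\<^sup>+t. ?h x t \<partial>lborel) \<partial>lborel)"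
      by (rule lborel_pair.Fubini') measurable
    also have "\<dots> \<le> (\<integral>\<^sup>+x. ennreal (2 * M powr (1/2)) * indicator (cball z (d z / 4)) x \<partial>lborel)"
    proof (intro nn_integral_mono)
      fix x
      show "(\<integral>\<^sup>+t. ?h x t \<partial>lborel)
         \<le> ennreal (2 * M powr (1/2)) * indicator (cball z (d z / 4)) x"
      proof (cases "dist z x \<le> d z / 4 \<and> (\<exists>t\<in>{0..<T}. t *\<^sub>R e + x \<in> E)")
        case False
        then have zero: "?h x t = 0" for t
          by (auto split: split_indicator)
        show ?thesis unfolding zero by simp
      next
        case True
        have sh: "\<rho> x = \<rho> (t *\<^sub>R e + x) + t" for t using rho_shift[of "t *\<^sub>R e + x" t] by simp
        obtain t0 where t0: "t0 \<in> {0..<T}" "t0 *\<^sub>R e + x \<in> E" using True by auto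
        have "c * \<rho> x \<le> d x powr \<alpha>"
          using rho_le[of "t0 *\<^sub>R e + x" t0] t0 E by (auto simp: sh[of t0, symmetric])
        also have "d x powr \<alpha> \<le> (2 * d z) powr \<alpha>"
          using d_lipschitz[of z x] True alpha dz by (intro powr_mono2) (auto simp: dist_nonneg)
        finally have rM: "\<rho> x \<le> M" using c by (simp add: M_def field_simps)
        have r0: "0 < \<rho> x" using rho_pos[of "t0 *\<^sub>R e + x"] t0 E sh[of t0] by auto
        have "(\<integral>\<^sup>+t. ?h x t \<partial>lborel)
           \<le> (\<integral>\<^sup>+t. indicator {0..\<rho> x} t * ennreal ((\<rho> x - t) powr (- 1/2)) \<partial>lborel)"
        proof (intro nn_integral_mono)
          fix t
          show "?h x t
             \<le> indicator {0..\<rho> x} t * ennreal ((\<rho> x - t) powr (- 1/2))"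
            using rho_pos[of "t *\<^sub>R e + x"] E sh[of t] by (auto split: split_indicator)
        qed
        also have "\<dots> = ennreal (2 * \<rho> x powr (1/2))" by (rule nn_integral_inverse_sqrt[OF r0])
        also have "\<dots> \<le> ennreal (2 * M powr (1/2))"
          using rM r0 by (intro ennreal_leI mult_left_mono powr_mono2) auto
        finally show ?thesis using True by simp
      qed
    qed
    also have "\<dots> = ennreal (2 * M powr (1/2)) * emeasure lborel (cball z (d z / 4))"
      by (rule nn_integral_cmult_indicator) simp
    also have "\<dots> = ennreal (2 * M powr (1/2)) * ennreal (?V * (d z / 4) ^ DIM('a))"
      using dz by (subst emeasure_cball) auto
    also have "\<dots> \<le> ennreal (2 * M powr (1/2)) * ennreal (?V * d z powr n)"
    proof (intro mult_left_mono ennreal_leI)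
      have "d z powr n = d z ^ DIM('a)" using dz by (simp add: n_def powr_realpow)
      moreover have "(d z / 4) ^ DIM('a) \<le> d z ^ DIM('a)" using dz by (intro power_mono) auto
      ultimately show "(d z / 4) ^ DIM('a) \<le> d z powr n" by simp
    qed auto
    also have "\<dots> = ennreal ((2 * M powr (1/2)) * (?V * d z powr n))"
      by (intro ennreal_mult[symmetric]) auto
    also have "(2 * M powr (1/2)) * (?V * d z powr n) = C * d z powr (n + \<alpha> / 2)"
    proof -
      have "M = (2 powr \<alpha> / c) * d z powr \<alpha>" using dz by (simp add: M_def powr_mult)
      then have "M powr (1/2) = (2 powr \<alpha> / c) powr (1/2) * d z powr (\<alpha> / 2)"
        using c dz powr_mult[of "2 powr \<alpha> / c" "d z powr \<alpha>" "1/2"] by (simp add: powr_powr)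
      then show ?thesis by (simp add: C_def powr_add)
    qed
    finally show ?thesis .
  qed
  then show ?thesis using C by blast
qed

text \<open>An interpolation between a bound for the unweighted shadow, which is proportional to
  the measure of \<open>E\<close>, and \<open>shadow_half_le\<close>, which does not depend on \<open>E\<close>. The parameter \<open>\<Lambda>\<close>
  makes both contributions equal up to a constant. The critical \<open>bc\<close> is the exponent for
  which the remaining power of \<open>d z\<close> is \<open>\<gamma> - \<kappa>\<close>.\<close>

lemma shadow_bound:
  "\<exists>C>0. \<forall>E z. E \<in> sets borel \<longrightarrow> E \<subseteq> Y \<longrightarrow> E \<subseteq> \<Omega> \<longrightarrow> 0 < vol E \<longrightarrow> z \<in> \<Omega> \<longrightarrow>
     shadow E (- a) z \<le> ennreal (C * vol E powr \<theta> * d z powr (\<gamma> - \<kappa>))"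
proof -
  obtain C where C: "0 < C" "\<And>E z. E \<in> sets borel \<Longrightarrow> E \<subseteq> Y \<Longrightarrow> z \<in> \<Omega> \<Longrightarrow>
     shadow E (- 1/2) z \<le> ennreal (C * d z powr (n + \<alpha> / 2))"
    using shadow_half_le by blast
  have "shadow E (- a) z \<le> ennreal ((1 + C) * vol E powr \<theta> * d z powr (\<gamma> - \<kappa>))"
    if [measurable]: "E \<in> sets borel" and E: "E \<subseteq> Y" "E \<subseteq> \<Omega>" and m: "0 < vol E" and z: "z \<in> \<Omega>" for E z
  proof -
    have dz: "0 < d z" by (rule d_pos[OF z])
    define m where "m = vol E"
    have m0: "0 < m" using m by (simp add: m_def)
    define \<beta> where "\<beta> = n - 1 + \<alpha> / 2"
    \<comment> \<open>chosen so that \<open>\<Lambda> powr (- (q / p)) = m / d z powr \<beta>\<close>, which balances the two terms\<close>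
    define \<Lambda> where "\<Lambda> = (d z powr \<beta> / m) powr (p / q)"
    have L: "0 < \<Lambda>" using dz m0 by (simp add: \<Lambda>_def)
    let ?i = "\<lambda>x. if dist z x \<le> d z / 4 then 1 else 0 :: ennreal"
    have "shadow E (- a) z \<le> (\<integral>\<^sup>+y. (\<integral>\<^sup>+t. (ennreal \<Lambda> * indicator E y) * (indicator {0..<T} t * ?i (y - t *\<^sub>R e))
        + ennreal (\<Lambda> powr (1 - q / p)) * (indicator E y * indicator {0..<T} t * ?i (y - t *\<^sub>R e) * ennreal (\<rho> y powr (- 1/2))) \<partial>lborel) \<partial>lborel)"
      unfolding shadow_def
    proof (intro nn_integral_mono)
      fix y t
      have "\<rho> y powr (- a) \<le> \<Lambda> + (\<rho> y powr (- a)) powr (q / p) * \<Lambda> powr (1 - q / p)"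
        using L p_gt p_le_q by (intro le_add_powr_mult) auto
      also have "(\<rho> y powr (- a)) powr (q / p) = \<rho> y powr (- 1/2)"
        using p_gt q_gt by (simp add: powr_powr a_def)
      finally have "ennreal (\<rho> y powr (- a)) \<le> ennreal (\<Lambda> + \<rho> y powr (- 1/2) * \<Lambda> powr (1 - q / p))"
        by (rule ennreal_leI)
      also have "\<dots> = ennreal \<Lambda> + ennreal (\<Lambda> powr (1 - q / p)) * ennreal (\<rho> y powr (- 1/2))"
        using L by (simp add: ennreal_mult mult.commute)
      finally show "indicator E y * indicator {0..<T} t * ?i (y - t *\<^sub>R e) * ennreal (\<rho> y powr (- a))
         \<le> (ennreal \<Lambda> * indicator E y) * (indicator {0..<T} t * ?i (y - t *\<^sub>R e))
        + ennreal (\<Lambda> powr (1 - q / p)) * (indicator E y * indicator {0..<T} t * ?i (y - t *\<^sub>R e) * ennreal (\<rho> y powr (- 1/2)))"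
        by (auto split: split_indicator)
    qed
    also have "\<dots> = (\<integral>\<^sup>+y. (ennreal \<Lambda> * indicator E y) * (\<integral>\<^sup>+t. indicator {0..<T} t * ?i (y - t *\<^sub>R e) \<partial>lborel) \<partial>lborel)
        + ennreal (\<Lambda> powr (1 - q / p)) * shadow E (- 1/2) z"
      unfolding shadow_def
      by (simp add: nn_integral_add nn_integral_cmult)
    also have "\<dots> \<le> (\<integral>\<^sup>+y. (ennreal \<Lambda> * indicator E y) * ennreal (2 * (d z / 4)) \<partial>lborel)
        + ennreal (\<Lambda> powr (1 - q / p)) * ennreal (C * d z powr (n + \<alpha> / 2))"
      using dz by (intro add_mono nn_integral_mono mult_left_mono shadow_length C(2) E z) auto
    also have "(\<integral>\<^sup>+y. (ennreal \<Lambda> * indicator E y) * ennreal (2 * (d z / 4)) \<partial>lborel) = ennreal (\<Lambda> * m * (d z / 2))"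
    proof -
      have "(\<integral>\<^sup>+y. (ennreal \<Lambda> * indicator E y) * ennreal (2 * (d z / 4)) \<partial>lborel)
         = ennreal \<Lambda> * emeasure lborel E * ennreal (d z / 2)"
        by (simp add: nn_integral_multc nn_integral_cmult)
      also have "\<dots> = ennreal (\<Lambda> * m * (d z / 2))"
        unfolding emeasure_subset_eq[OF E(2)] m_def[symmetric] using L m0 dz by (simp add: ennreal_mult[symmetric])
      finally show ?thesis .
    qed
    also have "ennreal (\<Lambda> powr (1 - q / p)) * ennreal (C * d z powr (n + \<alpha> / 2)) = ennreal (C * (\<Lambda> * m * d z))"
    proof -
      have "\<Lambda> powr (- (q / p)) = m / d z powr \<beta>"
      proof -
        have "\<Lambda> powr (- (q / p)) = (d z powr \<beta> / m) powr (- 1)"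
          using p_gt q_gt by (simp add: \<Lambda>_def powr_powr)
        also have "\<dots> = m / d z powr \<beta>" using dz m0 by (subst powr_minus_divide) simp
        finally show ?thesis .
      qed
      then have "\<Lambda> powr (1 - q / p) = \<Lambda> * (m / d z powr \<beta>)"
        using L powr_add[of \<Lambda> 1 "- (q / p)"] by simp
      moreover have "d z powr (n + \<alpha> / 2) = d z powr \<beta> * d z"
        using dz powr_add[of "d z" \<beta> 1] by (simp add: \<beta>_def algebra_simps)
      ultimately have eq: "\<Lambda> powr (1 - q / p) * (C * d z powr (n + \<alpha> / 2)) = C * (\<Lambda> * m * d z)"
        using dz by simp
      have "ennreal (\<Lambda> powr (1 - q / p)) * ennreal (C * d z powr (n + \<alpha> / 2))
          = ennreal (\<Lambda> powr (1 - q / p) * (C * d z powr (n + \<alpha> / 2)))"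
        using C(1) by (intro ennreal_mult[symmetric]) auto
      then show ?thesis unfolding eq .
    qed
    also have "ennreal (\<Lambda> * m * (d z / 2)) + ennreal (C * (\<Lambda> * m * d z)) = ennreal (\<Lambda> * m * (d z / 2) + C * (\<Lambda> * m * d z))"
      using L m0 dz C(1) by (intro ennreal_plus[symmetric]) auto
    also have "\<dots> \<le> ennreal ((1 + C) * (\<Lambda> * m * d z))"
    proof (rule ennreal_leI)
      have "0 < \<Lambda> * m * d z" using L m0 dz by simp
      then show "\<Lambda> * m * (d z / 2) + C * (\<Lambda> * m * d z) \<le> (1 + C) * (\<Lambda> * m * d z)"
        by (simp add: distrib_right)
    qed
    also have "\<Lambda> * m * d z = m powr \<theta> * d z powr (\<gamma> - \<kappa>)"
    proof -
      have "\<Lambda> = d z powr (\<beta> * (p / q)) / m powr (p / q)"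
        using dz m0 by (simp add: \<Lambda>_def powr_divide powr_powr)
      then have "\<Lambda> * m * d z = (m / m powr (p / q)) * (d z powr (\<beta> * (p / q)) * d z)" by simp
      also have "m / m powr (p / q) = m powr \<theta>" using m0 by (simp add: \<theta>_def powr_diff)
      also have "d z powr (\<beta> * (p / q)) * d z = d z powr (\<beta> * (p / q) + 1)" using dz by (simp add: powr_add)
      also have "\<beta> * (p / q) + 1 = \<gamma> - \<kappa>"
      proof -
        have e: "p * (1 + 1 / q - 1 / p) = p - 1 + p / q" using p_gt by (simp add: field_simps)
        have "bc = p * (s - n) + (n - 1 + \<alpha>) * (p * (1 + 1 / q - 1 / p))"
          unfolding bc_def by (simp add: mult_ac)
        then have bc: "bc = p * (s - n) + (n - 1 + \<alpha>) * (p - 1 + p / q)" unfolding e .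
        have "a = (p / q) / 2" by (simp add: a_def)
        then show ?thesis unfolding \<beta>_def \<gamma>_def \<kappa>_def bc by (simp add: algebra_simps add_divide_distrib)
      qed
      finally show ?thesis .
    qed
    finally show ?thesis by (simp add: m_def mult.assoc)
  qed
  then show ?thesis using C(1) by (intro exI[of _ "1 + C"]) auto
qed

text \<open>The weight is moved from \<open>\<xi>\<close> to the integration variable \<open>z\<close>, as a preparation for
  exchanging the order of integration.\<close>

lemma weighted_osc_le:
  assumes v: "unit_valued v" and xi: "\<xi> \<in> \<Omega>"
  shows "ennreal (d \<xi> powr k) * osc p v \<xi> \<le> (\<integral>\<^sup>+z. indicator \<Omega> z * (if dist z \<xi> \<le> d z / 4 then 1 else 0)
     * (ennreal (2 powr \<bar>k\<bar> * d z powr k) * (\<integral>\<^sup>+w. indicator {w. dist z w \<le> d z / 2} w * ennreal (\<bar>v z - v w\<bar> powr p) \<partial>lborel)) \<partial>lborel)"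
proof -
  let ?J = "\<lambda>z. \<integral>\<^sup>+w. indicator {w. dist z w \<le> d z / 2} w * ennreal (\<bar>v z - v w\<bar> powr p) \<partial>lborel"
  have [measurable]: "v \<in> borel_measurable borel" by (rule unit_valued_measurable[OF v])
  let ?B = "ball \<xi> (5 * d \<xi> / 32)"
  have [measurable]: "?B \<in> sets borel" by simp
  have dxi: "0 < d \<xi>" by (rule d_pos[OF xi])
  let ?g = "\<lambda>z w. indicator ?B z * indicator ?B w * ennreal (\<bar>v z - v w\<bar> powr p)"
  have "ennreal (d \<xi> powr k) * osc p v \<xi> = (\<integral>\<^sup>+z. ennreal (d \<xi> powr k) * (\<integral>\<^sup>+w. ?g z w \<partial>lborel) \<partial>lborel)"
    unfolding osc_def by (simp add: nn_integral_cmult)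
  also have "\<dots> \<le> (\<integral>\<^sup>+z. indicator \<Omega> z * (if dist z \<xi> \<le> d z / 4 then 1 else 0)
     * (ennreal (2 powr \<bar>k\<bar> * d z powr k) * ?J z) \<partial>lborel)"
  proof (intro nn_integral_mono)
    fix z
    show "ennreal (d \<xi> powr k) * (\<integral>\<^sup>+w. ?g z w \<partial>lborel) \<le> indicator \<Omega> z * (if dist z \<xi> \<le> d z / 4 then 1 else 0)
     * (ennreal (2 powr \<bar>k\<bar> * d z powr k) * ?J z)"
    proof (cases "z \<in> ?B")
      case False
      then show ?thesis by simp
    next
      case True
      note z = five_ball[OF xi True]
      have zxi: "dist \<xi> z < 5 * d \<xi> / 32" using True by simp
      have near: "dist z \<xi> \<le> d z / 4" using zxi z(2) dxi by (simp add: dist_commute)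
      have dz: "0 < d z" by (rule d_pos[OF z(1)])
      have "ennreal (d \<xi> powr k) * (\<integral>\<^sup>+w. ?g z w \<partial>lborel)
         \<le> ennreal (2 powr \<bar>k\<bar> * d z powr k) * ?J z"
      proof (rule mult_mono)
        show "ennreal (d \<xi> powr k) \<le> ennreal (2 powr \<bar>k\<bar> * d z powr k)"
          using z dz dxi by (intro ennreal_leI powr_le_of_comparable) auto
        show "(\<integral>\<^sup>+w. ?g z w \<partial>lborel) \<le> ?J z"
        proof (rule nn_integral_mono)
          fix w
          have "dist z w \<le> d z / 2" if "w \<in> ?B"
            using that zxi z(2) dxi dist_triangle[of z w \<xi>] by (simp add: dist_commute)
          then show "?g z w \<le> indicator {w. dist z w \<le> d z / 2} w * ennreal (\<bar>v z - v w\<bar> powr p)"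
            by (auto split: split_indicator)
        qed
      qed auto
      then show ?thesis using z(1) near by simp
    qed
  qed
  finally show ?thesis .
qed

text \<open>The estimate of \<open>chain_point\<close> is integrated over \<open>E\<close>; once the integral over \<open>z\<close> is
  made the outermost one, the inner integral is the shadow of \<open>z\<close>.\<close>

lemma chart_bound:
  "\<exists>C>0. descent_bound Y T e C"
proof -
  obtain C1 where C1: "0 < C1" "\<And>v y. unit_valued v \<Longrightarrow> y \<in> Y \<Longrightarrow> 1 / 8 \<le> \<bar>F v y - F v (y - T *\<^sub>R e)\<bar> \<Longrightarrow>
    1 \<le> ennreal (C1 * \<rho> y powr (- a)) *
         (\<integral>\<^sup>+t. ennreal (d (y - t *\<^sub>R e) powr \<kappa>) * osc p v (y - t *\<^sub>R e) * indicator {0..<T} t \<partial>lborel)"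
    using chain_point by blast
  obtain C2 where C2: "0 < C2" "\<And>E z. E \<in> sets borel \<Longrightarrow> E \<subseteq> Y \<Longrightarrow> E \<subseteq> \<Omega> \<Longrightarrow> 0 < vol E \<Longrightarrow> z \<in> \<Omega> \<Longrightarrow>
     shadow E (- a) z \<le> ennreal (C2 * vol E powr \<theta> * d z powr (\<gamma> - \<kappa>))"
    using shadow_bound by blast
  define C where "C = C1 * (2 powr \<bar>\<kappa>\<bar> * C2)"
  have C: "0 < C" using C1 C2 by (simp add: C_def)
  have "emeasure lborel E \<le> ennreal (C * vol E powr \<theta>) * crit_energy v"
    if v: "unit_valued v" and E [measurable]: "E \<in> sets borel" and EY: "E \<subseteq> Y" "E \<subseteq> \<Omega>"
      and drop: "\<forall>y\<in>E. 1 / 8 \<le> \<bar>F v y - F v (y - T *\<^sub>R e)\<bar>" for v E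
  proof (cases "vol E = 0")
    case True
    then show ?thesis using emeasure_subset_eq[OF EY(2)] by simp
  next
    case False
    then have m: "0 < vol E" by (simp add: zero_less_measure_iff)
    define m where "m = vol E"
    have [measurable]: "v \<in> borel_measurable borel" by (rule unit_valued_measurable[OF v])
    have [measurable]: "osc p v \<in> borel_measurable borel" by (rule osc_measurable[OF v])
    let ?i = "\<lambda>z x. if dist z x \<le> d z / 4 then 1 else 0 :: ennreal"
    let ?w = "\<lambda>z w. if dist z w \<le> d z / 2 then ennreal (\<bar>v z - v w\<bar> powr p) else 0"
    define G where "G z = indicator \<Omega> z * (ennreal (2 powr \<bar>\<kappa>\<bar> * d z powr \<kappa>) * (\<integral>\<^sup>+w. ?w z w \<partial>lborel))" for z
    have [measurable]: "G \<in> borel_measurable borel" unfolding G_def by measurable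
    have ind: "indicator {w. dist z w \<le> d z / 2} w * ennreal (\<bar>v z - v w\<bar> powr p) = ?w z w" for z w
      by simp
    let ?K = "\<lambda>y t z. indicator E y * indicator {0..<T} t * ?i z (y - t *\<^sub>R e) * ennreal (\<rho> y powr (- a))"
    have "emeasure lborel E = (\<integral>\<^sup>+y. indicator E y \<partial>lborel)" by simp
    also have "\<dots> \<le> (\<integral>\<^sup>+y. (\<integral>\<^sup>+t. (\<integral>\<^sup>+z. ennreal C1 * (?K y t z * G z) \<partial>lborel) \<partial>lborel) \<partial>lborel)"
    proof (rule nn_integral_mono)
      fix y
      show "indicator E y \<le> (\<integral>\<^sup>+t. (\<integral>\<^sup>+z. ennreal C1 * (?K y t z * G z) \<partial>lborel) \<partial>lborel)"
      proof (cases "y \<in> E")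
        case False
        then show ?thesis by simp
      next
        case True
        have yY: "y \<in> Y" using True EY by auto
        have "1 \<le> ennreal (C1 * \<rho> y powr (- a)) *
         (\<integral>\<^sup>+t. ennreal (d (y - t *\<^sub>R e) powr \<kappa>) * osc p v (y - t *\<^sub>R e) * indicator {0..<T} t \<partial>lborel)"
          by (rule C1(2)[OF v yY bspec[OF drop True]])
        also have "\<dots> = (\<integral>\<^sup>+t. ennreal (C1 * \<rho> y powr (- a)) *
           (ennreal (d (y - t *\<^sub>R e) powr \<kappa>) * osc p v (y - t *\<^sub>R e) * indicator {0..<T} t) \<partial>lborel)"
          by (rule nn_integral_cmult[symmetric]) measurable
        also have "\<dots> \<le> (\<integral>\<^sup>+t. (\<integral>\<^sup>+z. ennreal C1 * (?K y t z * G z) \<partial>lborel) \<partial>lborel)"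
        proof (rule nn_integral_mono)
          fix t
          show "ennreal (C1 * \<rho> y powr (- a)) *
             (ennreal (d (y - t *\<^sub>R e) powr \<kappa>) * osc p v (y - t *\<^sub>R e) * indicator {0..<T} t)
             \<le> (\<integral>\<^sup>+z. ennreal C1 * (?K y t z * G z) \<partial>lborel)"
          proof (cases "t \<in> {0..<T}")
            case False
            then show ?thesis by simp
          next
            case tT: True
            have xi: "y - t *\<^sub>R e \<in> \<Omega>" using chart[OF yY, of t] tT by auto
            have "ennreal (C1 * \<rho> y powr (- a)) * (ennreal (d (y - t *\<^sub>R e) powr \<kappa>) * osc p v (y - t *\<^sub>R e) * indicator {0..<T} t)
              \<le> ennreal (C1 * \<rho> y powr (- a)) * (\<integral>\<^sup>+z. ?i z (y - t *\<^sub>R e) * G z \<partial>lborel)"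
              using weighted_osc_le[OF v xi, of \<kappa>] tT unfolding ind
              by (intro mult_left_mono) (auto simp: G_def mult_ac)
            also have "\<dots> = (\<integral>\<^sup>+z. ennreal (C1 * \<rho> y powr (- a)) * (?i z (y - t *\<^sub>R e) * G z) \<partial>lborel)"
              by (rule nn_integral_cmult[symmetric]) measurable
            also have "\<dots> = (\<integral>\<^sup>+z. ennreal C1 * (?K y t z * G z) \<partial>lborel)"
              using True tT C1(1) by (intro nn_integral_cong) (auto simp: ennreal_mult mult_ac)
            finally show ?thesis .
          qed
        qed
        finally show ?thesis using True by simp
      qed
    qed
    also have "\<dots> = (\<integral>\<^sup>+y. (\<integral>\<^sup>+z. (\<integral>\<^sup>+t. ennreal C1 * (?K y t z * G z) \<partial>lborel) \<partial>lborel) \<partial>lborel)"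
      by (rule nn_integral_cong, rule lborel_pair.Fubini') measurable
    also have "\<dots> = (\<integral>\<^sup>+z. (\<integral>\<^sup>+y. (\<integral>\<^sup>+t. ennreal C1 * (?K y t z * G z) \<partial>lborel) \<partial>lborel) \<partial>lborel)"
      by (rule lborel_pair.Fubini') measurable
    also have "\<dots> = (\<integral>\<^sup>+z. ennreal C1 * G z * shadow E (- a) z \<partial>lborel)"
    proof (rule nn_integral_cong)
      fix z
      have "(\<integral>\<^sup>+y. (\<integral>\<^sup>+t. ennreal C1 * (?K y t z * G z) \<partial>lborel) \<partial>lborel)
         = (\<integral>\<^sup>+y. (\<integral>\<^sup>+t. (ennreal C1 * G z) * ?K y t z \<partial>lborel) \<partial>lborel)"
        by (simp only: mult_ac)
      also have "\<dots> = ennreal C1 * G z * shadow E (- a) z"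
        unfolding shadow_def by (simp add: nn_integral_cmult)
      finally show "(\<integral>\<^sup>+y. (\<integral>\<^sup>+t. ennreal C1 * (?K y t z * G z) \<partial>lborel) \<partial>lborel) = ennreal C1 * G z * shadow E (- a) z" .
    qed
    also have "\<dots> \<le> (\<integral>\<^sup>+z. ennreal (C * m powr \<theta>) * (\<integral>\<^sup>+w. indicator \<Omega> z * indicator {w. dist z w \<le> d z / 2} w
             * ennreal (d z powr \<gamma> * \<bar>v z - v w\<bar> powr p) \<partial>lborel) \<partial>lborel)"
    proof (rule nn_integral_mono)
      fix z
      show "ennreal C1 * G z * shadow E (- a) z \<le> ennreal (C * m powr \<theta>) * (\<integral>\<^sup>+w. indicator \<Omega> z * indicator {w. dist z w \<le> d z / 2} w
             * ennreal (d z powr \<gamma> * \<bar>v z - v w\<bar> powr p) \<partial>lborel)"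
      proof (cases "z \<in> \<Omega>")
        case False
        then show ?thesis by (simp add: G_def)
      next
        case True
        have dz: "0 < d z" by (rule d_pos[OF True])
        let ?Q = "\<integral>\<^sup>+w. ?w z w \<partial>lborel"
        have Gz: "G z = ennreal (2 powr \<bar>\<kappa>\<bar> * d z powr \<kappa>) * ?Q" using True by (simp add: G_def)
        have "ennreal C1 * G z * shadow E (- a) z
           \<le> ennreal C1 * (ennreal (2 powr \<bar>\<kappa>\<bar> * d z powr \<kappa>) * ?Q) * ennreal (C2 * m powr \<theta> * d z powr (\<gamma> - \<kappa>))"
          unfolding Gz m_def by (intro mult_left_mono C2(2) E EY m True) auto
        also have "\<dots> = ennreal (C1 * (2 powr \<bar>\<kappa>\<bar> * d z powr \<kappa>) * (C2 * m powr \<theta> * d z powr (\<gamma> - \<kappa>))) * ?Q"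
          using C1(1) C2(1) by (simp add: ennreal_mult mult_ac)
        also have "C1 * (2 powr \<bar>\<kappa>\<bar> * d z powr \<kappa>) * (C2 * m powr \<theta> * d z powr (\<gamma> - \<kappa>)) = C * m powr \<theta> * d z powr \<gamma>"
        proof -
          have "d z powr \<gamma> = d z powr \<kappa> * d z powr (\<gamma> - \<kappa>)" by (simp add: powr_add[symmetric])
          then show ?thesis by (simp add: C_def mult_ac)
        qed
        also have "ennreal (C * m powr \<theta> * d z powr \<gamma>) * ?Q
           = ennreal (C * m powr \<theta>) * (ennreal (d z powr \<gamma>) * ?Q)"
          using C by (simp add: ennreal_mult mult.assoc)
        also have "ennreal (d z powr \<gamma>) * ?Q = (\<integral>\<^sup>+w. ennreal (d z powr \<gamma>) * ?w z w \<partial>lborel)"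
          by (rule nn_integral_cmult[symmetric]) measurable
        also have "\<dots> = (\<integral>\<^sup>+w. indicator \<Omega> z * indicator {w. dist z w \<le> d z / 2} w
             * ennreal (d z powr \<gamma> * \<bar>v z - v w\<bar> powr p) \<partial>lborel)"
          using True by (intro nn_integral_cong) (auto simp: ennreal_mult)
        finally show ?thesis .
      qed
    qed
    also have "\<dots> = ennreal (C * m powr \<theta>) * crit_energy v"
      unfolding crit_energy_def indicator_def mem_Collect_eq by (rule nn_integral_cmult) measurable
    finally show ?thesis by (simp add: m_def)
  qed
  then show ?thesis unfolding descent_bound_def using C by (intro exI[of _ C] conjI allI impI)
qed

end

section \<open>Hoelder domains have boundary charts\<close>

lemma holder_on_continuous:
  assumes "holder_on \<alpha> S f" "0 < \<alpha>"
  shows "continuous_on S f"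
proof -
  obtain L where L: "\<And>x y. x \<in> S \<Longrightarrow> y \<in> S \<Longrightarrow> dist (f x) (f y) \<le> L * dist x y powr \<alpha>"
    using assms(1) unfolding holder_on_def by blast
  show ?thesis
    unfolding continuous_on_def
  proof
    fix x assume x: "x \<in> S"
    have lim: "((\<lambda>y. L * dist y x powr \<alpha>) \<longlongrightarrow> L * 0) (at x within S)"
    proof (intro tendsto_mult tendsto_const)
      have "((\<lambda>y. dist y x) \<longlongrightarrow> 0) (at x within S)"
      proof -
        have "((\<lambda>y. dist y x) \<longlongrightarrow> dist x x) (at x within S)" by (intro tendsto_intros)
        then show ?thesis by simp
      qed
      then show "((\<lambda>y. dist y x powr \<alpha>) \<longlongrightarrow> 0) (at x within S)"
        by (rule tendsto_zero_powrI[OF _ tendsto_const _ assms(2)]) simp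
    qed
    have "\<forall>\<^sub>F y in at x within S. norm (dist (f y) (f x)) \<le> L * dist y x powr \<alpha>"
      using L x by (auto simp: eventually_at_filter)
    then have "((\<lambda>y. dist (f y) (f x)) \<longlongrightarrow> 0) (at x within S)"
      by (rule Lim_null_comparison) (use lim in simp)
    then show "(f \<longlongrightarrow> f x) (at x within S)" by (rule tendsto_dist_iff[THEN iffD2])
  qed
qed

context bounded_region
begin

text \<open>The number \<open>\<rho> y\<close> is the depth of \<open>y\<close> below the graph, measured along \<open>e\<close>.\<close>

definition depth_chart ::
  "real \<Rightarrow> real \<Rightarrow> 'a set \<Rightarrow> 'a \<Rightarrow> ('a \<Rightarrow> real) \<Rightarrow> real \<Rightarrow> bool" where
  "depth_chart \<alpha> \<eta> U e \<rho> c \<longleftrightarrow> norm e = 1 \<and> 0 < c \<and> \<rho> \<in> borel_measurable borel \<and>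
     (\<forall>y t. \<rho> (y - t *\<^sub>R e) = \<rho> y + t) \<and>
     (\<forall>y\<in>\<Omega>. ball y \<eta> \<subseteq> U \<longrightarrow> 0 < \<rho> y \<and>
        (\<forall>t\<in>{0..\<eta> / 2}. y - t *\<^sub>R e \<in> \<Omega> \<and> c * (\<rho> y + t) \<le> d (y - t *\<^sub>R e) powr \<alpha>))"

text \<open>A ball of radius \<open>r\<close> around a point of depth \<open>h\<close> stays below the graph, as long as
  \<open>L * r powr \<alpha> + r < h\<close>; for \<open>r \<le> 1\<close> the first power dominates up to a constant, so
  \<open>r powr \<alpha>\<close> may be a small multiple of \<open>h\<close>.\<close>

lemma hypograph_chart:
  assumes hyp: "holder_hypograph_in \<alpha> U \<Omega>" and alpha: "0 < \<alpha>" "\<alpha> \<le> 1" and lam: "0 < \<eta>" "\<eta> \<le> 1"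
  shows "\<exists>e \<rho> c. depth_chart \<alpha> \<eta> U e \<rho> c"
proof -
  obtain e \<phi> where e: "norm e = 1" and hol: "holder_on \<alpha> {y. y \<bullet> e = 0} \<phi>"
    and eq: "\<Omega> \<inter> U = {x \<in> U. x \<bullet> e < \<phi> (x - (x \<bullet> e) *\<^sub>R e)}"
    using hyp unfolding holder_hypograph_in_def by blast
  have ee: "e \<bullet> e = 1" using e by (simp add: norm_eq_1)
  define P where "P x = x - (x \<bullet> e) *\<^sub>R e" for x
  have PH: "P x \<in> {y. y \<bullet> e = 0}" for x by (simp add: P_def inner_diff_left ee)
  have Pshift: "P (y - t *\<^sub>R e) = P y" for y t
    by (simp add: P_def inner_diff_left ee algebra_simps)
  have Pdist: "dist (P x) (P y) \<le> dist x y" for x y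
  proof -
    define w where "w = x - y"
    define k where "k = w \<bullet> e"
    have "P x - P y = w - k *\<^sub>R e" by (simp add: P_def w_def k_def inner_diff_left algebra_simps)
    moreover have "(w - k *\<^sub>R e) \<bullet> (w - k *\<^sub>R e) = w \<bullet> w - k * k"
      by (simp add: inner_diff_left inner_diff_right ee inner_commute[of e w] k_def[symmetric])
    then have "(norm (w - k *\<^sub>R e))\<^sup>2 \<le> (norm w)\<^sup>2"
      unfolding power2_norm_eq_inner by simp
    then have "norm (w - k *\<^sub>R e) \<le> norm w" by (rule power2_le_imp_le) simp
    ultimately show ?thesis by (simp add: dist_norm w_def)
  qed
  define \<rho> where "\<rho> y = \<phi> (P y) - y \<bullet> e" for y
  have contP: "continuous_on UNIV P" unfolding P_def by (intro continuous_intros)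
  have contr: "continuous_on UNIV \<rho>"
    unfolding \<rho>_def
    by (intro continuous_intros continuous_on_compose2[OF holder_on_continuous[OF hol alpha(1)] contP])
       (use PH in auto)
  have shift: "\<rho> (y - t *\<^sub>R e) = \<rho> y + t" for y t
    unfolding \<rho>_def Pshift by (simp add: inner_diff_left ee)
  obtain L0 where L0: "\<And>x y. x \<bullet> e = 0 \<Longrightarrow> y \<bullet> e = 0 \<Longrightarrow> dist (\<phi> x) (\<phi> y) \<le> L0 * dist x y powr \<alpha>"
    using hol unfolding holder_on_def by blast
  define L where "L = max L0 0"
  have L: "0 \<le> L" "dist (\<phi> (P x)) (\<phi> (P y)) \<le> L * dist x y powr \<alpha>" for x y
  proof -
    show "0 \<le> L" by (simp add: L_def)
    have "dist (\<phi> (P x)) (\<phi> (P y)) \<le> L0 * dist (P x) (P y) powr \<alpha>" using PH by (intro L0) auto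
    also have "\<dots> \<le> L * dist (P x) (P y) powr \<alpha>" by (intro mult_right_mono) (auto simp: L_def)
    also have "\<dots> \<le> L * dist x y powr \<alpha>"
      using Pdist alpha by (intro mult_left_mono powr_mono2) (auto simp: L_def)
    finally show "dist (\<phi> (P x)) (\<phi> (P y)) \<le> L * dist x y powr \<alpha>" .
  qed
  have "compact (closure \<Omega>)" using bounded_region by simp
  then have "compact (\<rho> ` closure \<Omega>)"
    by (intro compact_continuous_image continuous_on_subset[OF contr]) auto
  then obtain R0 where R0: "\<And>y. y \<in> closure \<Omega> \<Longrightarrow> \<bar>\<rho> y\<bar> \<le> R0"
    using compact_imp_bounded bounded_iff by (metis imageI real_norm_def)
  define R where "R = \<bar>R0\<bar> + 1"
  have R: "0 < R" "\<And>y t. y \<in> \<Omega> \<Longrightarrow> t \<le> \<eta> / 2 \<Longrightarrow> \<rho> y + t \<le> R"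
  proof -
    show "0 < R" by (simp add: R_def)
    show "\<rho> y + t \<le> R" if "y \<in> \<Omega>" "t \<le> \<eta> / 2" for y t
      using R0[of y] that lam closure_subset[of \<Omega>] by (fastforce simp: R_def)
  qed
  \<comment> \<open>the second bound keeps the radius below \<open>\<eta> / 2\<close>, so that the ball stays in \<open>U\<close>\<close>
  define c where "c = min (1 / (2 * (L + 1))) ((\<eta> / 2) powr \<alpha> / R)"
  have c: "0 < c" using L(1) R(1) lam by (simp add: c_def)
  have main: "0 < \<rho> y \<and> (\<forall>t\<in>{0..\<eta> / 2}. y - t *\<^sub>R e \<in> \<Omega> \<and> c * (\<rho> y + t) \<le> d (y - t *\<^sub>R e) powr \<alpha>)"
    if y: "y \<in> \<Omega>" and sub: "ball y \<eta> \<subseteq> U" for y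
  proof -
    have yU: "y \<in> U" using sub lam by auto
    then have "y \<in> {x \<in> U. x \<bullet> e < \<phi> (x - (x \<bullet> e) *\<^sub>R e)}" using y eq by blast
    then have rpos: "0 < \<rho> y" by (simp add: \<rho>_def P_def)
    have "y - t *\<^sub>R e \<in> \<Omega> \<and> c * (\<rho> y + t) \<le> d (y - t *\<^sub>R e) powr \<alpha>" if t: "t \<in> {0..\<eta> / 2}" for t
    proof -
      define x where "x = y - t *\<^sub>R e"
      define h where "h = \<rho> y + t"
      have h: "0 < h" "h \<le> R" "\<rho> x = h"
        using rpos t R(2)[OF y, of t] shift by (auto simp: h_def x_def)
      define r where "r = (c * h) powr (1 / \<alpha>)"
      have r: "0 < r" using c h by (simp add: r_def)
      have ra: "r powr \<alpha> = c * h" using c h alpha by (simp add: r_def powr_powr)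
      have "c * h \<le> ((\<eta> / 2) powr \<alpha> / R) * R" using h c by (intro mult_mono) (auto simp: c_def)
      then have "c * h \<le> (\<eta> / 2) powr \<alpha>" using R(1) by simp
      then have "r powr \<alpha> \<le> (\<eta> / 2) powr \<alpha>" using ra by simp
      then have rl: "r \<le> \<eta> / 2"
        using powr_less_mono2[of \<alpha> "\<eta> / 2" r] lam alpha by force
      have rr: "r \<le> r powr \<alpha>"
        using powr_mono'[of \<alpha> 1 r] r rl lam alpha by simp
      have "ball x r \<subseteq> \<Omega>"
      proof
        fix z assume z: "z \<in> ball x r"
        have "dist y x \<le> \<eta> / 2" using t e by (simp add: x_def dist_norm)
        then have "dist y z < \<eta>" using z rl dist_triangle[of y z x] by simp
        then have zU: "z \<in> U" using sub by auto
        have zx: "dist x z < r" using z by simp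
        have "L * dist x z powr \<alpha> \<le> L * r powr \<alpha>"
          using zx alpha L(1) by (intro mult_left_mono powr_mono2) auto
        then have "\<phi> (P x) - L * r powr \<alpha> \<le> \<phi> (P z)"
          using L(2)[of x z] by (simp add: dist_real_def)
        moreover have "z \<bullet> e < x \<bullet> e + r"
        proof -
          have "\<bar>(z - x) \<bullet> e\<bar> \<le> norm (z - x)" using Cauchy_Schwarz_ineq2[of "z - x" e] e by simp
          then show ?thesis using zx by (simp add: inner_diff_left dist_norm norm_minus_commute abs_le_iff)
        qed
        moreover have "L * r powr \<alpha> + r < \<phi> (P x) - x \<bullet> e"
        proof -
          have "L * r powr \<alpha> + r \<le> (L + 1) * (c * h)" using rr ra by (simp add: algebra_simps)
          also have "\<dots> \<le> (L + 1) * (1 / (2 * (L + 1)) * h)"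
            using L(1) h by (intro mult_left_mono mult_right_mono) (auto simp: c_def)
          also have "\<dots> = h / 2" using L(1) by (simp add: field_simps)
          also have "\<dots> < h" using h by simp
          finally show ?thesis using h(3) by (simp add: \<rho>_def)
        qed
        ultimately have "z \<bullet> e < \<phi> (P z)" by linarith
        then show "z \<in> \<Omega>" using zU eq by (auto simp: P_def)
      qed
      then have "x \<in> \<Omega>" "r \<le> d x" using r d_ge by auto
      then have "r powr \<alpha> \<le> d x powr \<alpha>" using r alpha by (intro powr_mono2) auto
      then show ?thesis using \<open>x \<in> \<Omega>\<close> ra by (simp add: x_def h_def)
    qed
    then show ?thesis using rpos by blast
  qed
  have meas: "\<rho> \<in> borel_measurable borel" using contr by (rule borel_measurable_continuous_onI)
  show ?thesis unfolding depth_chart_def using e c meas shift main by (intro exI[of _ e] exI[of _ \<rho>] exI[of _ c]) blast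
qed

end

section \<open>The capacity-type inequality\<close>

context sobolev_exponents
begin

text \<open>What the capacity-type inequality uses of a chart: the points of \<open>Y\<close> can be moved by
  \<open>T\<close> against \<open>e\<close> to distance \<open>r\<close> from the boundary, and the set where this changes the
  average substantially is small in terms of the energy.\<close>

definition descends :: "'a set \<Rightarrow> real \<Rightarrow> real \<Rightarrow> 'a \<Rightarrow> bool" where
  "descends Y T r e \<longleftrightarrow> Y \<in> sets borel \<and> Y \<subseteq> \<Omega> \<and>
     (\<forall>y\<in>Y. y - T *\<^sub>R e \<in> \<Omega> \<and> r \<le> d (y - T *\<^sub>R e)) \<and>
     (\<exists>C>0. descent_bound Y T e C)"

lemma closed_ball_subset: "closed {y. ball y \<eta> \<subseteq> U}" for U :: "'a set"
proof -
  have "- {y. ball y \<eta> \<subseteq> U} = (\<Union>w\<in>- U. ball w \<eta>)"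
    by (auto simp: dist_commute)
  then show ?thesis unfolding closed_def by (simp only:) (intro open_UN ballI open_ball)
qed

text \<open>With \<open>\<eta>\<close> a Lebesgue number of the given cover, a point close to the boundary has its
  \<open>\<eta>\<close>-ball inside some \<open>U j\<close> with \<open>j \<noteq> 0\<close>, so the segment of length \<open>\<eta> / 2\<close> stays in the
  chart.\<close>

lemma descending_cover:
  assumes hol: "holder_domain \<alpha> \<Omega>"
  shows "\<exists>N T r Y e. 0 < T \<and> 0 < r \<and> (\<forall>j\<in>{1..N::nat}. descends (Y j) T r (e j)) \<and>
    (\<forall>y\<in>\<Omega>. d y < r \<longrightarrow> (\<exists>j\<in>{1..N}. y \<in> Y j))"
proof -
  obtain N U where U: "\<And>j. j \<le> N \<Longrightarrow> open (U j)" "closure \<Omega> \<subseteq> (\<Union>j\<le>N. U j)"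
    "closure (U 0) \<subseteq> \<Omega>" "\<And>j. j \<in> {1..N::nat} \<Longrightarrow> holder_hypograph_in \<alpha> (U j) \<Omega>"
    using hol unfolding holder_domain_def by blast
  have "compact (closure \<Omega>)" using bounded_region by simp
  then obtain \<eta>0 where l0: "0 < \<eta>0" "\<And>x. x \<in> closure \<Omega> \<Longrightarrow> \<exists>G\<in>U ` {..N}. ball x \<eta>0 \<subseteq> G"
    using Heine_Borel_lemma[of "closure \<Omega>" "U ` {..N}"] U(1,2) by auto
  define \<eta> where "\<eta> = min \<eta>0 1"
  have lam: "0 < \<eta>" "\<eta> \<le> 1" using l0(1) by (auto simp: \<eta>_def)
  have cover: "\<exists>j\<le>N. ball x \<eta> \<subseteq> U j" if "x \<in> \<Omega>" for x
  proof -
    have "x \<in> closure \<Omega>" using that closure_subset by blast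
    then obtain j where "j \<le> N" "ball x \<eta>0 \<subseteq> U j" using l0(2) by blast
    moreover have "ball x \<eta> \<subseteq> ball x \<eta>0" by (simp add: \<eta>_def subset_ball)
    ultimately show ?thesis by blast
  qed
  define T where "T = \<eta> / 2"
  have T: "0 < T" using lam by (simp add: T_def)
  have "\<exists>e \<rho> c. depth_chart \<alpha> \<eta> (U j) e \<rho> c"
    if "j \<in> {1..N}" for j
    by (rule hypograph_chart[OF U(4)[OF that] alpha lam])
  then obtain e \<rho> c where ch: "\<And>j. j \<in> {1..N} \<Longrightarrow> depth_chart \<alpha> \<eta> (U j) (e j) (\<rho> j) (c j)"
    by metis
  define c0 where "c0 = Min (insert 1 (c ` {1..N}))"
  have c0: "0 < c0" "\<And>j. j \<in> {1..N} \<Longrightarrow> c0 \<le> c j"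
  proof -
    show "0 < c0" using ch by (auto simp: c0_def depth_chart_def)
    show "c0 \<le> c j" if "j \<in> {1..N}" for j unfolding c0_def using that by (intro Min_le) auto
  qed
  \<comment> \<open>the depth at the end of a segment is at least \<open>T\<close>\<close>
  define r where "r = min T ((c0 * T) powr (1 / \<alpha>))"
  have r: "0 < r" "r \<le> T" "r \<le> (c0 * T) powr (1 / \<alpha>)" using T c0 by (auto simp: r_def)
  define Y where "Y j = {y \<in> \<Omega>. d y < T} \<inter> {y. ball y \<eta> \<subseteq> U j}" for j
  have desc: "descends (Y j) T r (e j)" if j: "j \<in> {1..N}" for j
  proof -
    note chj = ch[OF j, unfolded depth_chart_def]
    interpret boundary_chart \<Omega> \<alpha> s p q b n bc \<gamma> \<theta> "e j" "\<rho> j" "Y j" T "c j"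
    proof unfold_locales
      show "norm (e j) = 1" "0 < T" "0 < c j" "\<rho> j \<in> borel_measurable borel"
        using chj T by blast+
      show "\<rho> j (y - t *\<^sub>R e j) = \<rho> j y + t" for y t using chj by blast
      show "y - t *\<^sub>R e j \<in> \<Omega>" if "y \<in> Y j" "t \<in> {0..T}" for y t
        using that chj unfolding Y_def T_def by blast
      show "0 < \<rho> j y" if "y \<in> Y j" for y using that chj unfolding Y_def by blast
      show "c j * (\<rho> j y + t) \<le> d (y - t *\<^sub>R e j) powr \<alpha>" if "y \<in> Y j" "t \<in> {0..T}" for y t
        using that chj unfolding Y_def T_def by blast
      show "d y / 128 \<le> T" if "y \<in> Y j" for y
        using that dist_nonneg[of y] by (auto simp: Y_def)
    qed
    have "Y j \<in> sets borel"
    proof -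
      have "{y \<in> \<Omega>. d y < T} \<in> sets borel"
      proof -
        have "{y \<in> \<Omega>. d y < T} = \<Omega> \<inter> {y. d y < T}" by auto
        then show ?thesis by simp
      qed
      moreover have "{y. ball y \<eta> \<subseteq> U j} \<in> sets borel" using closed_ball_subset by (rule borel_closed)
      ultimately show ?thesis unfolding Y_def by (rule sets.Int)
    qed
    moreover have "y - T *\<^sub>R e j \<in> \<Omega> \<and> r \<le> d (y - T *\<^sub>R e j)" if y: "y \<in> Y j" for y
    proof -
      have yO: "y - T *\<^sub>R e j \<in> \<Omega>" using chart[OF y, of T] T by simp
      have cj: "0 < c j" using chj by blast
      have "c0 * T \<le> c j * (\<rho> j y + T)"
        using c0 j cj rho_pos[OF y] T by (intro mult_mono) auto
      also have "\<dots> \<le> d (y - T *\<^sub>R e j) powr \<alpha>" using rho_le[OF y, of T] T by simp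
      finally have "(c0 * T) powr (1 / \<alpha>) \<le> (d (y - T *\<^sub>R e j) powr \<alpha>) powr (1 / \<alpha>)"
        using c0 T alpha by (intro powr_mono2) auto
      then show ?thesis using yO r alpha d_pos[OF yO] by (simp add: powr_powr)
    qed
    ultimately show ?thesis unfolding descends_def using chart_bound Y_def by auto
  qed
  have "\<exists>j\<in>{1..N}. y \<in> Y j" if y: "y \<in> \<Omega>" "d y < r" for y
  proof -
    obtain j where j: "j \<le> N" "ball y \<eta> \<subseteq> U j" using cover[OF y(1)] by blast
    have "j \<noteq> 0"
    proof
      assume "j = 0"
      then have "ball y \<eta> \<subseteq> \<Omega>" using j(2) U(3) closure_subset[of "U 0"] by blast
      then have "\<eta> \<le> d y" by (rule d_ge)
      then show False using y(2) r(2) lam by (simp add: T_def)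
    qed
    then show ?thesis using j y r by (intro bexI[of _ j]) (auto simp: Y_def)
  qed
  then show ?thesis using T r(1) desc by blast
qed

text \<open>The average at \<open>x0\<close> is at most \<open>1 / 2\<close> and \<open>v = 1\<close> on \<open>E\<close>, so at every point of \<open>E\<close>
  one of three differences is substantial: between \<open>v\<close> and its average (\<open>local_bound\<close>),
  between the averages at the two ends of a descending segment (\<open>descends\<close>), or between the
  averages at two points far from the boundary. In the third case the energy is bounded
  below by \<open>avg_close_interior\<close>, and the measure of \<open>\<Omega>\<close> being finite is enough.\<close>

lemma capacity_bound:
  assumes hol: "holder_domain \<alpha> \<Omega>" and x0: "x0 \<in> \<Omega>"
  shows "\<exists>C>0. \<forall>v E A. separates v E A \<longrightarrow> F v x0 \<le> 1 / 2 \<longrightarrow>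
     emeasure lborel E \<le> ennreal (C * vol A powr \<theta>) * energy v"
proof -
  obtain N T r Y e where T: "0 < T" "0 < r" and desc: "\<And>j. j \<in> {1..N::nat} \<Longrightarrow> descends (Y j) T r (e j)"
    and cover: "\<And>y. y \<in> \<Omega> \<Longrightarrow> d y < r \<Longrightarrow> \<exists>j\<in>{1..N}. y \<in> Y j"
    using descending_cover[OF hol] by blast
  obtain K where K: "0 < K" "\<And>v. unit_valued v \<Longrightarrow> crit_energy v \<le> ennreal K * energy v"
    using crit_energy_le_energy by blast
  obtain Cl where Cl: "0 < Cl" "\<And>v E A. separates v E A \<Longrightarrow> (\<forall>y\<in>E. F v y \<le> 3 / 4) \<Longrightarrow>
     emeasure lborel E \<le> ennreal (Cl * vol A powr \<theta>) * energy v"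
    using local_bound by blast
  obtain Ci where Ci: "0 < Ci" "\<And>x v. x \<in> \<Omega> \<Longrightarrow> r \<le> d x \<Longrightarrow> unit_valued v \<Longrightarrow>
     ennreal \<bar>F v x - F v x0\<bar> \<le> ennreal (1 / 16) + ennreal Ci * crit_energy v"
    using avg_close_interior[OF x0 T(2), of "1 / 16"] by auto
  have "\<exists>C>0. descent_bound (Y j) T (e j) C" if "j \<in> {1..N}" for j
    using desc[OF that] unfolding descends_def by blast
  then obtain Cj where Cj: "\<And>j. j \<in> {1..N} \<Longrightarrow> 0 < Cj j"
    "\<And>j. j \<in> {1..N} \<Longrightarrow> descent_bound (Y j) T (e j) (Cj j)"
    by metis
  define M where "M = vol \<Omega>"
  have measure_le: "vol A \<le> vol A'" if "A \<subseteq> A'" "A \<in> sets borel" "A' \<in> sets borel" "A' \<subseteq> \<Omega>" for A A'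
    using that emeasure_subset_eq[of A'] by (intro measure_mono_fmeasurable) (auto simp: fmeasurable_def)
  define C where "C = Cl + (\<Sum>j\<in>{1..N}. Cj j * K) + 16 * Ci * K * (M powr (1 - \<theta>) + 1)"
  have S0: "0 \<le> (\<Sum>j\<in>{1..N}. Cj j * K)" using Cj(1) K(1) by (intro sum_nonneg) (simp add: less_imp_le)
  have I0: "0 < 16 * Ci * K * (M powr (1 - \<theta>) + 1)"
    using Ci(1) K(1) by (intro mult_pos_pos) (auto simp: add_nonneg_pos)
  have C: "0 < C" using Cl(1) S0 I0 by (simp add: C_def)
  have "emeasure lborel E \<le> ennreal (C * vol A powr \<theta>) * energy v"
    if sep: "separates v E A" and avg0: "F v x0 \<le> 1 / 2" for v E A
  proof -
    have v: "unit_valued v" and E [measurable]: "E \<in> sets borel" and A: "A \<in> sets borel" "E \<subseteq> A" "A \<subseteq> \<Omega>"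
      and vE: "\<forall>y\<in>E. v y = 1" and vA: "\<forall>z\<in>\<Omega> - A. v z = 0"
      using sep by (auto simp: separates_def)
    have [measurable]: "F v \<in> borel_measurable borel" by (rule avg_measurable[OF v])
    define a where "a = vol A"
    have a0: "0 \<le> a" by (simp add: a_def)
    show ?thesis
    proof (cases "ennreal (1 / 16) \<le> ennreal Ci * crit_energy v")
      case True
      have "a = a powr \<theta> * a powr (1 - \<theta>)"
        using a0 by (cases "a = 0") (simp_all add: powr_add[symmetric])
      also have "\<dots> \<le> a powr \<theta> * M powr (1 - \<theta>)"
        using measure_le[OF A(3) A(1)] a0 theta_bounds(2) by (intro mult_left_mono powr_mono2) (auto simp: a_def M_def)
      finally have a_le: "a \<le> a powr \<theta> * M powr (1 - \<theta>)" .
      have "emeasure lborel E \<le> emeasure lborel A" using A by (intro emeasure_mono) auto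
      also have "\<dots> = ennreal a" using emeasure_subset_eq[OF A(3)] by (simp add: a_def)
      also have "\<dots> \<le> ennreal (a powr \<theta> * M powr (1 - \<theta>)) * (ennreal 16 * ennreal (1 / 16))"
      proof -
        have "ennreal 16 * ennreal (1 / 16) = 1" by (subst ennreal_mult[symmetric]) simp_all
        then show ?thesis using ennreal_leI[OF a_le] by (simp only: mult_1_right)
      qed
      also have "\<dots> \<le> ennreal (a powr \<theta> * M powr (1 - \<theta>)) * (ennreal 16 * (ennreal Ci * (ennreal K * energy v)))"
        by (intro mult_left_mono order_trans[OF True] K(2)[OF v]) auto
      also have "\<dots> = ennreal (16 * Ci * K * M powr (1 - \<theta>) * a powr \<theta>) * energy v"
        using Ci(1) K(1) by (simp add: ennreal_mult mult_ac)
      also have "\<dots> \<le> ennreal (C * a powr \<theta>) * energy v"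
      proof (intro mult_right_mono ennreal_leI)
        have "16 * Ci * K * M powr (1 - \<theta>) \<le> 16 * Ci * K * (M powr (1 - \<theta>) + 1)"
          using Ci(1) K(1) by (intro mult_left_mono) auto
        then show "16 * Ci * K * M powr (1 - \<theta>) \<le> C" unfolding C_def using Cl(1) S0 by linarith
      qed auto
      finally show ?thesis by (simp add: a_def)
    next
      case False
      have deep: "\<bar>F v x - F v x0\<bar> < 1 / 8" if x: "x \<in> \<Omega>" "r \<le> d x" for x
      proof -
        obtain k where k: "ennreal Ci * crit_energy v = ennreal k" "0 \<le> k"
          using False by (cases "ennreal Ci * crit_energy v") auto
        have "k < 1 / 16" using False k by (simp add: not_le)
        have "ennreal \<bar>F v x - F v x0\<bar> \<le> ennreal (1 / 16) + ennreal k"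
          using Ci(2)[OF x v] k by simp
        also have "\<dots> = ennreal (1 / 16 + k)" using k by simp
        finally have "\<bar>F v x - F v x0\<bar> \<le> 1 / 16 + k" using k by (simp del: ennreal_plus)
        then show ?thesis using \<open>k < 1 / 16\<close> by simp
      qed
      define El where "El = E \<inter> {y. F v y \<le> 3 / 4}"
      define Ej where "Ej j = (E \<inter> Y j) \<inter> {y. 1 / 8 \<le> \<bar>F v y - F v (y - T *\<^sub>R e j)\<bar>}" for j
      have El: "El \<in> sets borel" unfolding El_def by measurable
      have Ej: "Ej j \<in> sets borel" if "j \<in> {1..N}" for j
      proof -
        have [measurable]: "Y j \<in> sets borel" using desc[OF that] by (simp add: descends_def)
        show ?thesis unfolding Ej_def by measurable
      qed
      have sub: "E \<subseteq> El \<union> (\<Union>j\<in>{1..N}. Ej j)"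
      proof
        fix y assume y: "y \<in> E"
        have yO: "y \<in> \<Omega>" using y A by auto
        show "y \<in> El \<union> (\<Union>j\<in>{1..N}. Ej j)"
        proof (cases "F v y \<le> 3 / 4")
          case True
          then show ?thesis using y by (simp add: El_def)
        next
          case big: False
          have "d y < r"
          proof (rule ccontr)
            assume "\<not> d y < r"
            then show False using deep[of y] yO big avg0 by auto
          qed
          then obtain j where j: "j \<in> {1..N}" "y \<in> Y j" using cover[OF yO] by blast
          have "y - T *\<^sub>R e j \<in> \<Omega>" "r \<le> d (y - T *\<^sub>R e j)"
            using desc[OF j(1)] j(2) by (auto simp: descends_def)
          then have "\<bar>F v (y - T *\<^sub>R e j) - F v x0\<bar> < 1 / 8" by (rule deep)
          then have "1 / 8 \<le> \<bar>F v y - F v (y - T *\<^sub>R e j)\<bar>" using big avg0 by linarith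
          then show ?thesis using y j by (auto simp: Ej_def)
        qed
      qed
      have "emeasure lborel E \<le> emeasure lborel (El \<union> (\<Union>j\<in>{1..N}. Ej j))"
        using sub El Ej by (intro emeasure_mono) auto
      also have "\<dots> \<le> emeasure lborel El + emeasure lborel (\<Union>j\<in>{1..N}. Ej j)"
        using El Ej by (intro emeasure_subadditive) auto
      also have "\<dots> \<le> emeasure lborel El + (\<Sum>j\<in>{1..N}. emeasure lborel (Ej j))"
        using Ej by (intro add_left_mono emeasure_subadditive_finite) auto
      also have "\<dots> \<le> ennreal (Cl * a powr \<theta>) * energy v + (\<Sum>j\<in>{1..N}. ennreal (Cj j * K * a powr \<theta>) * energy v)"
      proof (intro add_mono sum_mono)
        show "emeasure lborel El \<le> ennreal (Cl * a powr \<theta>) * energy v"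
          unfolding a_def using v vE vA A El by (intro Cl(2)) (auto simp: El_def separates_def)
        fix j assume j: "j \<in> {1..N}"
        have "Ej j \<subseteq> A" using A by (auto simp: Ej_def)
        have "emeasure lborel (Ej j) \<le> ennreal (Cj j * vol (Ej j) powr \<theta>) * crit_energy v"
          using A by (intro Cj(2)[OF j, unfolded descent_bound_def, rule_format] v Ej[OF j]) (auto simp: Ej_def)
        also have "\<dots> \<le> ennreal (Cj j * a powr \<theta>) * (ennreal K * energy v)"
          using measure_le[OF \<open>Ej j \<subseteq> A\<close> Ej[OF j] A(1,3)] Cj(1)[OF j] theta_bounds(1)
          by (intro mult_mono ennreal_leI K(2) v mult_left_mono powr_mono2) (auto simp: a_def)
        also have "\<dots> = ennreal (Cj j * K * a powr \<theta>) * energy v"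
          using Cj(1)[OF j] K(1) by (simp add: ennreal_mult mult_ac)
        finally show "emeasure lborel (Ej j) \<le> ennreal (Cj j * K * a powr \<theta>) * energy v" .
      qed
      also have "\<dots> = ennreal ((Cl + (\<Sum>j\<in>{1..N}. Cj j * K)) * a powr \<theta>) * energy v"
      proof -
        have "(\<Sum>j\<in>{1..N}. ennreal (Cj j * K * a powr \<theta>)) = ennreal (\<Sum>j\<in>{1..N}. Cj j * K * a powr \<theta>)"
          using Cj(1) K(1) by (intro sum_ennreal) (simp add: less_imp_le)
        moreover have "0 \<le> (\<Sum>j\<in>{1..N}. Cj j * K * a powr \<theta>)"
          using Cj(1) K(1) by (intro sum_nonneg) (simp add: less_imp_le)
        ultimately show ?thesis using Cl(1)
          by (simp add: sum_distrib_right[symmetric] distrib_right[symmetric] flip: ennreal_plus)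
      qed
      also have "\<dots> \<le> ennreal (C * a powr \<theta>) * energy v"
        using I0 by (intro mult_right_mono ennreal_leI) (auto simp: C_def)
      finally show ?thesis by (simp add: a_def)
    qed
  qed
  then show ?thesis using C by blast
qed

end

section \<open>From the capacity-type inequality to the norm inequality\<close>

lemma sum_powr_le:
  fixes c :: "'b \<Rightarrow> real"
  assumes "finite I" "\<And>i. i \<in> I \<Longrightarrow> 0 \<le> c i" "1 \<le> p"
  shows "(\<Sum>i\<in>I. c i powr p) \<le> (\<Sum>i\<in>I. c i) powr p"
proof -
  let ?S = "\<Sum>i\<in>I. c i"
  have S: "0 \<le> ?S" using assms by (intro sum_nonneg) auto
  have mult_powr: "t * t powr (p - 1) = t powr p" if "0 \<le> t" for t :: real
    using that powr_add[of t 1 "p - 1"] by (cases "t = 0") auto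
  have "(\<Sum>i\<in>I. c i powr p) \<le> (\<Sum>i\<in>I. c i * ?S powr (p - 1))"
  proof (rule sum_mono)
    fix i assume i: "i \<in> I"
    have "c i \<le> ?S" using assms i by (intro member_le_sum) auto
    then have "c i powr (p - 1) \<le> ?S powr (p - 1)" using assms i by (intro powr_mono2) auto
    then have "c i * c i powr (p - 1) \<le> c i * ?S powr (p - 1)" using assms i by (intro mult_left_mono) auto
    then show "c i powr p \<le> c i * ?S powr (p - 1)" using mult_powr assms i by simp
  qed
  also have "\<dots> = ?S powr p" using mult_powr[OF S] by (simp add: sum_distrib_right[symmetric])
  finally show ?thesis .
qed

text \<open>The truncation of \<open>a\<close> between the levels \<open>t\<close> and \<open>2 * t\<close>, rescaled to the unit
  interval.\<close>

definition layer :: "real \<Rightarrow> real \<Rightarrow> real" where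
  "layer t a = min 1 (max 0 (a / t - 1))"

lemma layer_bounds: "0 \<le> layer t a" "layer t a \<le> 1"
  by (auto simp: layer_def)

lemma layer_eq: "0 < t \<Longrightarrow> t * layer t a = min a (2 * t) - min a t"
proof -
  assume t: "0 < t"
  consider "a \<le> t" | "t < a" "a < 2 * t" | "2 * t \<le> a" by linarith
  then show ?thesis
  proof cases
    case 1
    then have "a / t \<le> 1" using t by (simp add: divide_le_eq)
    then show ?thesis using 1 t by (simp add: layer_def)
  next
    case 2
    then have "1 < a / t" "a / t < 2" using t by (simp_all add: less_divide_eq divide_less_eq)
    then have "layer t a = a / t - 1" by (simp add: layer_def)
    then show ?thesis using 2 t by (simp add: right_diff_distrib)
  next
    case 3
    then have "2 \<le> a / t" using t by (simp add: le_divide_eq)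
    then show ?thesis using 3 t by (simp add: layer_def)
  qed
qed

lemma sum_layers:
  assumes "0 < \<epsilon>"
  shows "(\<Sum>k<K. (\<epsilon> * 2 ^ k) * layer (\<epsilon> * 2 ^ k) a) = min a (\<epsilon> * 2 ^ K) - min a \<epsilon>"
proof (induction K)
  case (Suc K)
  have "(\<epsilon> * 2 ^ K) * layer (\<epsilon> * 2 ^ K) a = min a (2 * (\<epsilon> * 2 ^ K)) - min a (\<epsilon> * 2 ^ K)"
    using assms by (intro layer_eq) auto
  then show ?case using Suc by (simp add: algebra_simps)
qed simp

text \<open>The layers are nondecreasing functions of the value, so their differences have equal
  signs and telescope.\<close>

lemma layers_diff_le:
  assumes "0 < \<epsilon>"
  shows "(\<Sum>k<K. \<bar>(\<epsilon> * 2 ^ k) * layer (\<epsilon> * 2 ^ k) a - (\<epsilon> * 2 ^ k) * layer (\<epsilon> * 2 ^ k) b\<bar>) \<le> \<bar>a - b\<bar>"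
proof -
  let ?l = "\<lambda>k a. (\<epsilon> * 2 ^ k) * layer (\<epsilon> * 2 ^ k) a"
  have le: "(\<Sum>k<K. \<bar>?l k a - ?l k b\<bar>) \<le> a - b"
    if "b \<le> a" for a b
  proof -
    have "\<bar>?l k a - ?l k b\<bar>
        = ?l k a - ?l k b" for k
    proof -
      have "b / (\<epsilon> * 2 ^ k) \<le> a / (\<epsilon> * 2 ^ k)" using that assms by (intro divide_right_mono) auto
      then have "layer (\<epsilon> * 2 ^ k) b \<le> layer (\<epsilon> * 2 ^ k) a" unfolding layer_def by auto
      then have "?l k b \<le> ?l k a"
        using assms by (intro mult_left_mono) auto
      then show ?thesis by simp
    qed
    then have "(\<Sum>k<K. \<bar>?l k a - ?l k b\<bar>)
       = (min a (\<epsilon> * 2 ^ K) - min a \<epsilon>) - (min b (\<epsilon> * 2 ^ K) - min b \<epsilon>)"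
      by (simp only: sum_subtractf sum_layers[OF assms])
    then show ?thesis using that by (simp add: min_def)
  qed
  show ?thesis
  proof (cases "b \<le> a")
    case True
    then show ?thesis using le[of b a] by simp
  next
    case False
    then show ?thesis using le[of a b] by (simp add: abs_minus_commute)
  qed
qed

lemma le_of_le_add_powr:
  fixes X x0 M \<theta> :: real
  assumes "X \<le> x0 + M * X powr \<theta>" "\<theta> < 1" "0 \<le> x0" "0 \<le> M"
  shows "X \<le> 2 * x0 + (2 * M) powr (1 / (1 - \<theta>))"
proof (cases "X \<le> 2 * x0")
  case True
  then show ?thesis by (simp add: add_increasing2)
next
  case False
  then have X: "0 < X" "X / 2 \<le> M * X powr \<theta>" using assms by auto
  have "X powr (1 - \<theta>) \<le> 2 * M"
  proof -
    have "X powr \<theta> * X powr (1 - \<theta>) = X" using X by (simp add: powr_add[symmetric])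
    also have "\<dots> \<le> X powr \<theta> * (2 * M)" using X by (simp add: mult_ac)
    finally show ?thesis using X by (simp add: mult_le_cancel_left)
  qed
  then have "(X powr (1 - \<theta>)) powr (1 / (1 - \<theta>)) \<le> (2 * M) powr (1 / (1 - \<theta>))"
    using assms X by (intro powr_mono2) auto
  then show ?thesis using X assms by (simp add: powr_powr)
qed

lemma measure_superlevel_vanishes:
  fixes g :: "'a::euclidean_space \<Rightarrow> real"
  assumes [measurable]: "g \<in> borel_measurable borel" "B \<in> sets borel" and B: "bounded B" and c: "0 < c"
  shows "\<exists>N. vol (B \<inter> {z. real N < g z}) < c"
proof -
  have "(\<lambda>N. vol (B \<inter> {z. real N < g z})) \<longlonglongrightarrow> vol (\<Inter>N. B \<inter> {z. real N < g z})"
  proof (intro Lim_measure_decseq)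
    show "decseq (\<lambda>N. B \<inter> {z. real N < g z})" by (intro decseq_SucI) auto
    show "emeasure lborel (B \<inter> {z. real N < g z}) \<noteq> \<infinity>" for N
      using emeasure_bounded_finite[OF bounded_subset[OF B, of "B \<inter> {z. real N < g z}"]] by simp
  qed auto
  moreover have "(\<Inter>N. B \<inter> {z. real N < g z}) = {}"
  proof -
    have False if "\<forall>N. real N < g z" for z
      using that real_arch_simple[of "g z"] by (meson not_less)
    then show ?thesis by blast
  qed
  ultimately have "(\<lambda>N. vol (B \<inter> {z. real N < g z})) \<longlonglongrightarrow> 0" by simp
  then have "\<forall>\<^sub>F N in sequentially. vol (B \<inter> {z. real N < g z}) < c"
    using c by (rule order_tendstoD)
  then show ?thesis by (auto simp: eventually_sequentially)
qed

lemma measure_superlevel_le: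
  fixes g :: "'a::euclidean_space \<Rightarrow> real"
  assumes [measurable]: "g \<in> borel_measurable borel" "B \<in> sets borel" and B: "bounded B"
    and le: "\<And>t. m < t \<Longrightarrow> vol (B \<inter> {z. t < g z}) \<le> c"
  shows "vol (B \<inter> {z. m < g z}) \<le> c"
proof (rule LIMSEQ_le_const2)
  let ?A = "\<lambda>N. B \<inter> {z. m + 1 / real (Suc N) < g z}"
  have U: "(\<Union>N. ?A N) = B \<inter> {z. m < g z}"
  proof (intro equalityI subsetI)
    fix z assume "z \<in> (\<Union>N. ?A N)"
    then obtain N where "z \<in> B" "m + 1 / real (Suc N) < g z" by blast
    moreover have "0 < 1 / real (Suc N)" by simp
    ultimately have "m < g z" by linarith
    then show "z \<in> B \<inter> {z. m < g z}" using \<open>z \<in> B\<close> by simp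
  next
    fix z assume z: "z \<in> B \<inter> {z. m < g z}"
    then obtain N where "1 / real (Suc N) < g z - m"
      using reals_Archimedean[of "g z - m"] by (auto simp: inverse_eq_divide)
    then show "z \<in> (\<Union>N. ?A N)" using z by (auto intro!: exI[of _ N])
  qed
  have "(\<lambda>N. vol (?A N)) \<longlonglongrightarrow> vol (\<Union>N. ?A N)"
  proof (intro Lim_measure_incseq)
    show "incseq ?A"
    proof (intro incseq_SucI subsetI)
      fix N z assume "z \<in> ?A N"
      moreover have "1 / real (Suc (Suc N)) \<le> 1 / real (Suc N)" by (intro divide_left_mono) auto
      ultimately show "z \<in> ?A (Suc N)" by auto
    qed
    have "bounded (\<Union>N. ?A N)" using B by (rule bounded_subset) auto
    then show "emeasure lborel (\<Union>N. ?A N) \<noteq> \<infinity>" using emeasure_bounded_finite by force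
  qed auto
  then show "(\<lambda>N. vol (?A N)) \<longlonglongrightarrow> vol (B \<inter> {z. m < g z})" unfolding U .
  show "\<exists>N. \<forall>k\<ge>N. vol (?A k) \<le> c" using le by auto
qed

lemma median_exists:
  fixes g :: "'a::euclidean_space \<Rightarrow> real"
  assumes g [measurable]: "g \<in> borel_measurable borel" and sB [measurable]: "B \<in> sets borel"
    and B: "bounded B" and pos: "0 < vol B"
  shows "\<exists>m. vol (B \<inter> {z. m < g z}) \<le> vol B / 2
     \<and> vol (B \<inter> {z. g z < m}) \<le> vol B / 2"
proof -
  let ?\<mu> = "measure lborel"
  have ng [measurable]: "(\<lambda>z. - g z) \<in> borel_measurable borel" by measurable
  have fin: "emeasure lborel A \<noteq> \<infinity>" if "A \<subseteq> B" for A
    using emeasure_bounded_finite[OF bounded_subset[OF B that]] by simp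
  have mono: "?\<mu> A \<le> ?\<mu> A'" if "A \<subseteq> A'" "A \<in> sets borel" "A' \<in> sets borel" "A' \<subseteq> B" for A A'
    using that fin[of A'] by (intro measure_mono_fmeasurable) (auto simp: fmeasurable_def top.not_eq_extremum)
  have compl: "?\<mu> (B \<inter> {z. t < g z}) + ?\<mu> (B \<inter> {z. g z \<le> t}) = ?\<mu> B" for t
  proof -
    have "?\<mu> ((B \<inter> {z. t < g z}) \<union> (B \<inter> {z. g z \<le> t})) = ?\<mu> (B \<inter> {z. t < g z}) + ?\<mu> (B \<inter> {z. g z \<le> t})"
      using fin[of "B \<inter> {z. t < g z}"] fin[of "B \<inter> {z. g z \<le> t}"] by (intro measure_Union) auto
    moreover have "(B \<inter> {z. t < g z}) \<union> (B \<inter> {z. g z \<le> t}) = B" by auto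
    ultimately show ?thesis by simp
  qed
  define S where "S = {t. ?\<mu> (B \<inter> {z. t < g z}) \<le> ?\<mu> B / 2}"
  have half: "0 < ?\<mu> B / 2" using pos by simp
  have Sne: "S \<noteq> {}"
    using measure_superlevel_vanishes[OF g sB B half] by (auto simp: S_def intro: less_imp_le)
  obtain N where N: "?\<mu> (B \<inter> {z. real N < - g z}) < ?\<mu> B / 2"
    using measure_superlevel_vanishes[OF ng sB B half] by blast
  have lower: "- real N - 1 \<le> t" if "t \<in> S" for t
  proof (rule ccontr)
    assume t: "\<not> - real N - 1 \<le> t"
    have "?\<mu> (B \<inter> {z. g z \<le> t}) \<le> ?\<mu> (B \<inter> {z. real N < - g z})" using t by (intro mono) auto
    then show False using N compl[of t] that by (simp add: S_def)
  qed
  have bdd: "bdd_below S" using lower by (auto simp: bdd_below_def)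
  define m where "m = Inf S"
  have above: "?\<mu> (B \<inter> {z. t < g z}) \<le> ?\<mu> B / 2" if t: "m < t" for t
  proof -
    obtain t' where t': "t' \<in> S" "t' < t" using t cInf_less_iff[OF Sne bdd] by (auto simp: m_def)
    have "?\<mu> (B \<inter> {z. t < g z}) \<le> ?\<mu> (B \<inter> {z. t' < g z})" using t' by (intro mono) auto
    then show ?thesis using t' by (simp add: S_def)
  qed
  have below: "?\<mu> (B \<inter> {z. t < - g z}) \<le> ?\<mu> B / 2" if t: "- m < t" for t
  proof -
    have "- t \<notin> S" using t cInf_lower[OF _ bdd, of "- t"] by (auto simp: m_def)
    then have "?\<mu> (B \<inter> {z. g z \<le> - t}) \<le> ?\<mu> B / 2" using compl[of "- t"] by (simp add: S_def)
    moreover have "?\<mu> (B \<inter> {z. t < - g z}) \<le> ?\<mu> (B \<inter> {z. g z \<le> - t})" by (intro mono) auto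
    ultimately show ?thesis by simp
  qed
  have "?\<mu> (B \<inter> {z. m < g z}) \<le> ?\<mu> B / 2" by (rule measure_superlevel_le[OF g sB B above])
  moreover have "?\<mu> (B \<inter> {z. - m < - g z}) \<le> ?\<mu> B / 2" by (rule measure_superlevel_le[OF ng sB B below])
  ultimately show ?thesis by auto
qed

context sobolev_exponents
begin

lemma layer_measurable [measurable]: "layer t \<in> borel_measurable borel"
  unfolding layer_def by measurable

text \<open>For each pair of points the differences of the layers add up to at most the difference
  of \<open>u\<close>, and for \<open>p \<ge> 1\<close> the same holds for the \<open>p\<close>-th powers. For nonlocal energies this
  takes the place of the disjointness of the supports of the gradients of the layers.\<close>

lemma energy_layers:
  assumes u [measurable]: "u \<in> borel_measurable borel" and eps: "0 < \<epsilon>"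
  shows "(\<Sum>k<K. ennreal ((\<epsilon> * 2 ^ k) powr p) * energy (\<lambda>x. layer (\<epsilon> * 2 ^ k) (u x))) \<le> energy u"
proof -
  define t where "t k = \<epsilon> * 2 ^ k" for k :: nat
  have t: "0 < t k" for k using eps by (simp add: t_def)
  let ?v = "\<lambda>k x. layer (t k) (u x)"
  define m where "m z w = (if norm (z - w) \<le> d z / 2 then 1 else 0 :: ennreal)" for z w
  define \<omega> where "\<omega> z w = 1 / norm (w - z) powr (n + s * p) * min (d z) (d w) powr b" for z w
  have om: "0 \<le> \<omega> z w" for z w by (simp add: \<omega>_def)
  have [measurable]: "case_prod m \<in> borel_measurable (borel \<Otimes>\<^sub>M borel)" unfolding m_def by measurable
  have [measurable]: "case_prod \<omega> \<in> borel_measurable (borel \<Otimes>\<^sub>M borel)" unfolding \<omega>_def by measurable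
  define h where "h k z w = ennreal (t k powr p) * (ennreal (\<bar>?v k w - ?v k z\<bar> powr p * \<omega> z w) * m z w)" for k z w
  have [measurable]: "case_prod (h k) \<in> borel_measurable (borel \<Otimes>\<^sub>M borel)" for k
    unfolding h_def by measurable
  have energy_eq: "energy f = (\<integral>\<^sup>+z. (\<integral>\<^sup>+w. ennreal (\<bar>f w - f z\<bar> powr p * \<omega> z w) * m z w \<partial>lborel) * indicator \<Omega> z \<partial>lborel)" for f
    unfolding frac_energy_def n_def[symmetric] m_def \<omega>_def
    by (intro nn_integral_cong arg_cong2[where f = "(*)"] refl) (auto split: split_indicator)
  have "(\<Sum>k<K. ennreal (t k powr p) * energy (?v k))
      = (\<Sum>k<K. (\<integral>\<^sup>+z. (\<integral>\<^sup>+w. h k z w \<partial>lborel) * indicator \<Omega> z \<partial>lborel))"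
    unfolding energy_eq h_def by (simp add: nn_integral_cmult mult.assoc)
  also have "\<dots> = (\<integral>\<^sup>+z. (\<integral>\<^sup>+w. (\<Sum>k<K. h k z w) \<partial>lborel) * indicator \<Omega> z \<partial>lborel)"
  proof -
    have inner: "(\<integral>\<^sup>+w. (\<Sum>k<K. h k z w) \<partial>lborel) = (\<Sum>k<K. (\<integral>\<^sup>+w. h k z w \<partial>lborel))" for z
      by (rule nn_integral_sum) measurable
    have "(\<Sum>k<K. (\<integral>\<^sup>+z. (\<integral>\<^sup>+w. h k z w \<partial>lborel) * indicator \<Omega> z \<partial>lborel))
        = (\<integral>\<^sup>+z. (\<Sum>k<K. (\<integral>\<^sup>+w. h k z w \<partial>lborel) * indicator \<Omega> z) \<partial>lborel)"
      by (rule nn_integral_sum[symmetric]) measurable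
    also have "\<dots> = (\<integral>\<^sup>+z. (\<integral>\<^sup>+w. (\<Sum>k<K. h k z w) \<partial>lborel) * indicator \<Omega> z \<partial>lborel)"
      by (simp only: inner sum_distrib_right)
    finally show ?thesis .
  qed
  also have "\<dots> \<le> (\<integral>\<^sup>+z. (\<integral>\<^sup>+w. ennreal (\<bar>u w - u z\<bar> powr p * \<omega> z w) * m z w \<partial>lborel) * indicator \<Omega> z \<partial>lborel)"
  proof (intro nn_integral_mono mult_right_mono)
    fix z w
    have "(\<Sum>k<K. t k powr p * \<bar>?v k w - ?v k z\<bar> powr p) = (\<Sum>k<K. \<bar>t k * ?v k w - t k * ?v k z\<bar> powr p)"
      using t by (intro sum.cong refl) (simp add: powr_mult[symmetric] abs_mult_pos' less_imp_le right_diff_distrib)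
    also have "\<dots> \<le> (\<Sum>k<K. \<bar>t k * ?v k w - t k * ?v k z\<bar>) powr p"
      using p_gt by (intro sum_powr_le) auto
    also have "\<dots> \<le> \<bar>u w - u z\<bar> powr p"
      unfolding t_def using p_gt by (intro powr_mono2 layers_diff_le eps sum_nonneg) auto
    finally have le: "(\<Sum>k<K. t k powr p * \<bar>?v k w - ?v k z\<bar> powr p) * \<omega> z w \<le> \<bar>u w - u z\<bar> powr p * \<omega> z w"
      using om by (rule mult_right_mono)
    have "(\<Sum>k<K. h k z w)
        = (\<Sum>k<K. ennreal (t k powr p * \<bar>?v k w - ?v k z\<bar> powr p * \<omega> z w)) * m z w"
      using om by (simp add: h_def sum_distrib_right ennreal_mult mult.assoc)
    also have "(\<Sum>k<K. ennreal (t k powr p * \<bar>?v k w - ?v k z\<bar> powr p * \<omega> z w))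
        = ennreal ((\<Sum>k<K. t k powr p * \<bar>?v k w - ?v k z\<bar> powr p) * \<omega> z w)"
      unfolding sum_distrib_right using om by (intro sum_ennreal) auto
    also have "\<dots> \<le> ennreal (\<bar>u w - u z\<bar> powr p * \<omega> z w)" by (rule ennreal_leI[OF le])
    finally show "(\<Sum>k<K. h k z w)
       \<le> ennreal (\<bar>u w - u z\<bar> powr p * \<omega> z w) * m z w"
      by (simp add: mult_right_mono)
  qed auto
  also have "\<dots> = energy u" by (rule energy_eq[symmetric])
  finally show ?thesis by (simp add: t_def)
qed

lemma avg_le_half:
  assumes v: "unit_valued v" and x0: "x0 \<in> \<Omega>" and Z: "{z \<in> B x0. v z \<noteq> 0} \<subseteq> Z" "Z \<in> sets borel" "Z \<subseteq> B x0"
    "vol Z \<le> vol (B x0) / 2"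
  shows "F v x0 \<le> 1 / 2"
proof -
  have m: "0 < vol (B x0)" by (rule measure_wball_pos[OF x0])
  have "bounded Z" using Z(3) wball_bounded bounded_subset by blast
  then have iZ: "integrable lborel (indicator Z :: 'a \<Rightarrow> real)"
    using Z(2) emeasure_bounded_finite by (simp add: integrable_indicator_iff)
  have "(\<integral>z. indicator (B x0) z * v z \<partial>lborel) \<le> (\<integral>z. indicator Z z \<partial>lborel)"
  proof (rule integral_mono)
    show "integrable lborel (\<lambda>z. indicator (B x0) z * v z)"
      by (rule integrable_unit_valued[OF v wball_sets wball_bounded])
    show "indicator (B x0) z * v z \<le> indicator Z z" for z
      using v Z(1) by (auto simp: unit_valued_def split: split_indicator)
  qed (rule iZ)
  also have "\<dots> = vol Z" using Z(2) by simp
  finally show ?thesis using Z(4) m by (simp add: avg_def divide_le_eq)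
qed

text \<open>Write \<open>a k\<close> for the measure of the superlevel set at \<open>t k\<close> and
  \<open>x k = t k powr q * a k\<close>. The capacity-type inequality for the \<open>k\<close>-th layer, of energy
  \<open>\<sigma> k\<close>, becomes \<open>x (Suc k) \<le> 2 powr q * C * (x k powr \<theta> * (t k powr p * \<sigma> k))\<close>, because
  \<open>q * \<theta> + p = q\<close>. Every \<open>x k\<close> is at most the sum \<open>X\<close> of them all, so summation gives
  \<open>X \<le> x 0 + 2 powr q * C * S * X powr \<theta>\<close>, and \<open>\<theta> < 1\<close> lets the last term be absorbed.\<close>

lemma superlevel_bound:
  assumes C: "0 < C"
    "\<And>v E A. separates v E A \<Longrightarrow> F v x0 \<le> 1 / 2 \<Longrightarrow>
     emeasure lborel E \<le> ennreal (C * vol A powr \<theta>) * energy v"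
    and x0: "x0 \<in> \<Omega>" and u [measurable]: "u \<in> borel_measurable borel"
    and half: "vol {z \<in> B x0. 0 < u z} \<le> vol (B x0) / 2"
    and S: "energy u = ennreal S" "0 \<le> S" and eps: "0 < \<epsilon>"
  shows "(\<Sum>k\<le>K. (\<epsilon> * 2 ^ k) powr q * vol {x \<in> \<Omega>. \<epsilon> * 2 ^ k < u x})
     \<le> 2 * (\<epsilon> powr q * vol \<Omega>) + (2 * (2 powr q * C * S)) powr (q / p)"
proof -
  define t where "t k = \<epsilon> * 2 ^ k" for k :: nat
  have t: "0 < t k" "t (Suc k) = 2 * t k" for k using eps by (auto simp: t_def)
  define A where "A k = {x \<in> \<Omega>. t k < u x}" for k
  have A: "A k \<in> sets borel" "A k \<subseteq> \<Omega>" for k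
  proof -
    have "A k = \<Omega> \<inter> {x. t k < u x}" by (auto simp: A_def)
    then show "A k \<in> sets borel" by simp
  qed (auto simp: A_def)
  define a where "a k = vol (A k)" for k
  have a0: "0 \<le> a k" for k by (simp add: a_def)
  define v where "v k x = layer (t k) (u x)" for k x
  have v: "unit_valued (v k)" for k
    unfolding unit_valued_def v_def using layer_bounds by auto
  have halfm: "{z \<in> B x0. 0 < u z} \<in> sets borel"
  proof -
    have "{z \<in> B x0. 0 < u z} = B x0 \<inter> {z. 0 < u z}" by auto
    then show ?thesis by simp
  qed
  have cap: "emeasure lborel (A (Suc k)) \<le> ennreal (C * a k powr \<theta>) * energy (v k)" for k
    unfolding a_def
  proof (intro C(2), unfold separates_def, intro conjI v A ballI)
    show "A (Suc k) \<subseteq> A k" using t(1)[of k] t(2)[of k] by (auto simp: A_def)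
    show "v k y = 1" if "y \<in> A (Suc k)" for y
    proof -
      have "2 < u y / t k" using that t[of k] by (simp add: A_def less_divide_eq)
      then show ?thesis by (simp add: v_def layer_def)
    qed
    show "v k z = 0" if "z \<in> \<Omega> - A k" for z
    proof -
      have "u z / t k \<le> 1" using that t[of k] by (auto simp: A_def divide_le_eq not_less)
      then show ?thesis by (simp add: v_def layer_def)
    qed
    show "F (v k) x0 \<le> 1 / 2"
    proof (rule avg_le_half[OF v x0 _ halfm _ half])
      show "{z \<in> B x0. v k z \<noteq> 0} \<subseteq> {z \<in> B x0. 0 < u z}"
      proof
        fix z assume z: "z \<in> {z \<in> B x0. v k z \<noteq> 0}"
        have "\<not> u z / t k \<le> 1" using z by (auto simp: v_def layer_def)
        then have "0 < u z" using t(1)[of k] by (simp add: divide_le_eq)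
        then show "z \<in> {z \<in> B x0. 0 < u z}" using z by simp
      qed
    qed auto
  qed
  have en: "(\<Sum>k<K. ennreal (t k powr p) * energy (v k)) \<le> ennreal S" for K
    using energy_layers[OF u eps, of K] unfolding S(1) t_def v_def .
  define \<sigma> where "\<sigma> k = enn2real (energy (v k))" for k
  have s0: "0 \<le> \<sigma> k" for k by (simp add: \<sigma>_def)
  have fin: "energy (v k) = ennreal (\<sigma> k)" for k
  proof -
    have "ennreal (t k powr p) * energy (v k) \<le> (\<Sum>k<Suc k. ennreal (t k powr p) * energy (v k))"
      by simp
    also have "\<dots> \<le> ennreal S" by (rule en)
    finally have "energy (v k) \<noteq> top" using t(1)[of k] by (auto simp: ennreal_mult_top top_unique)
    then show ?thesis by (simp add: \<sigma>_def top.not_eq_extremum)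
  qed
  have sumS: "(\<Sum>k<K. t k powr p * \<sigma> k) \<le> S" for K
  proof -
    have "ennreal (\<Sum>k<K. t k powr p * \<sigma> k) = (\<Sum>k<K. ennreal (t k powr p * \<sigma> k))"
      using s0 by (intro sum_ennreal[symmetric]) auto
    also have "\<dots> = (\<Sum>k<K. ennreal (t k powr p) * energy (v k))"
      using s0 by (simp add: fin ennreal_mult)
    also have "\<dots> \<le> ennreal S" by (rule en)
    finally show ?thesis using ennreal_le_iff[OF S(2)] by blast
  qed
  have rec: "a (Suc k) \<le> C * a k powr \<theta> * \<sigma> k" for k
  proof -
    have "ennreal (a (Suc k)) \<le> ennreal (C * a k powr \<theta>) * ennreal (\<sigma> k)"
      using cap[of k] emeasure_subset_eq[OF A(2)[of "Suc k"]] by (simp add: fin a_def)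
    also have "\<dots> = ennreal (C * a k powr \<theta> * \<sigma> k)"
      using C(1) s0 by (intro ennreal_mult[symmetric]) auto
    finally show ?thesis using C(1) s0[of k] by (simp add: ennreal_le_iff)
  qed
  define x where "x k = t k powr q * a k" for k
  have x0': "0 \<le> x k" for k using a0 by (simp add: x_def)
  have xrec: "x (Suc k) \<le> 2 powr q * C * (x k powr \<theta> * (t k powr p * \<sigma> k))" for k
  proof -
    have "x (Suc k) = 2 powr q * t k powr q * a (Suc k)"
      using t(1)[of k] by (simp add: x_def t(2) powr_mult)
    also have "\<dots> \<le> 2 powr q * t k powr q * (C * a k powr \<theta> * \<sigma> k)"
      by (intro mult_left_mono rec) auto
    also have "t k powr q = (t k powr q) powr \<theta> * t k powr p"
    proof -
      have "q * \<theta> + p = q" using q_gt by (simp add: \<theta>_def right_diff_distrib)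
      then show ?thesis by (simp add: powr_powr powr_add[symmetric])
    qed
    also have "2 powr q * ((t k powr q) powr \<theta> * t k powr p) * (C * a k powr \<theta> * \<sigma> k)
       = 2 powr q * C * (((t k powr q) powr \<theta> * a k powr \<theta>) * (t k powr p * \<sigma> k))" by (simp add: mult_ac)
    also have "(t k powr q) powr \<theta> * a k powr \<theta> = x k powr \<theta>"
      using a0 by (simp add: x_def powr_mult)
    finally show ?thesis .
  qed
  define X where "X = (\<Sum>k\<le>K. x k)"
  have X0: "0 \<le> X" using x0' by (simp add: X_def sum_nonneg)
  have "X = x 0 + (\<Sum>k<K. x (Suc k))"
    unfolding X_def by (simp add: sum.atMost_shift)
  also have "\<dots> \<le> x 0 + (\<Sum>k<K. 2 powr q * C * (X powr \<theta> * (t k powr p * \<sigma> k)))"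
  proof (intro add_left_mono sum_mono)
    fix k assume k: "k \<in> {..<K}"
    have "x k \<le> X" unfolding X_def using k x0' by (intro member_le_sum) auto
    then have "x k powr \<theta> \<le> X powr \<theta>" using x0' theta_bounds by (intro powr_mono2) auto
    then show "x (Suc k) \<le> 2 powr q * C * (X powr \<theta> * (t k powr p * \<sigma> k))"
      using C(1) s0 by (intro order_trans[OF xrec] mult_left_mono mult_right_mono) auto
  qed
  also have "(\<Sum>k<K. 2 powr q * C * (X powr \<theta> * (t k powr p * \<sigma> k))) = (2 powr q * C * (\<Sum>k<K. t k powr p * \<sigma> k)) * X powr \<theta>"
    by (simp add: sum_distrib_left sum_distrib_right mult_ac)
  also have "x 0 + \<dots> \<le> x 0 + (2 powr q * C * S) * X powr \<theta>"
    using C(1) by (intro add_left_mono mult_right_mono mult_left_mono sumS) auto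
  finally have "X \<le> 2 * x 0 + (2 * (2 powr q * C * S)) powr (1 / (1 - \<theta>))"
    using theta_bounds x0' C(1) S(2) by (intro le_of_le_add_powr) auto
  moreover have "1 / (1 - \<theta>) = q / p" by (simp add: theta_bounds(3))
  moreover have "x 0 \<le> \<epsilon> powr q * vol \<Omega>"
  proof -
    have "a 0 \<le> vol \<Omega>"
      unfolding a_def using A[of 0] emeasure_region_finite by (intro measure_mono_fmeasurable) (auto simp: fmeasurable_def)
    then show ?thesis by (simp add: x_def t_def mult_left_mono)
  qed
  ultimately show ?thesis unfolding X_def x_def a_def A_def t_def by simp
qed

lemma layer_cake:
  assumes u [measurable]: "u \<in> borel_measurable borel" and nonneg: "\<And>x. 0 \<le> u x" and eps: "0 < \<epsilon>"
    and bound: "\<And>K. (\<Sum>k\<le>K. (\<epsilon> * 2 ^ k) powr q * vol {x \<in> \<Omega>. \<epsilon> * 2 ^ k < u x}) \<le> H"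
  shows "(\<integral>\<^sup>+x\<in>\<Omega>. ennreal (u x powr q) \<partial>lborel) \<le> ennreal (\<epsilon> powr q * vol \<Omega> + 2 powr q * H)"
proof -
  define t where "t k = \<epsilon> * 2 ^ k" for k :: nat
  have t: "0 < t k" "t (Suc k) = 2 * t k" for k using eps by (auto simp: t_def)
  define A where "A k = {x \<in> \<Omega>. t k < u x}" for k
  have A [measurable]: "A k \<in> sets borel" for k
  proof -
    have "A k = \<Omega> \<inter> {x. t k < u x}" by (auto simp: A_def)
    then show "A k \<in> sets borel" by simp
  qed
  have H0: "0 \<le> H"
  proof -
    have "0 \<le> (\<Sum>k\<le>0. (\<epsilon> * 2 ^ k) powr q * vol {x \<in> \<Omega>. \<epsilon> * 2 ^ k < u x})"
      by (intro sum_nonneg) auto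
    then show ?thesis using bound[of 0] by linarith
  qed
  have pt: "ennreal (u x powr q) * indicator \<Omega> x \<le> ennreal (\<epsilon> powr q) * indicator \<Omega> x
      + (\<Sum>k. ennreal ((2 * t k) powr q) * indicator (A k) x)" for x
  proof (cases "x \<in> \<Omega> \<and> \<epsilon> < u x")
    case False
    then have "u x powr q \<le> \<epsilon> powr q" if "x \<in> \<Omega>" using that nonneg q_gt by (intro powr_mono2) auto
    then have "ennreal (u x powr q) * indicator \<Omega> x \<le> ennreal (\<epsilon> powr q) * indicator \<Omega> x"
      by (auto split: split_indicator intro: ennreal_leI)
    then show ?thesis by (rule order_trans) simp
  next
    case True
    obtain N where N: "u x / \<epsilon> < 2 ^ N" using real_arch_pow[of 2 "u x / \<epsilon>"] by auto
    then have "u x \<le> t N" using eps by (simp add: t_def divide_less_eq mult.commute less_imp_le)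
    define M where "M = (LEAST k. u x \<le> t k)"
    have M: "u x \<le> t M" unfolding M_def using \<open>u x \<le> t N\<close> by (rule LeastI)
    have "M \<noteq> 0"
    proof
      assume "M = 0"
      then show False using M True by (simp add: t_def)
    qed
    then obtain k where k: "M = Suc k" by (cases M) auto
    have "\<not> u x \<le> t k" using not_less_Least[of k "\<lambda>k. u x \<le> t k"] k by (simp add: M_def)
    then have xA: "x \<in> A k" using True by (simp add: A_def)
    have "u x powr q \<le> (2 * t k) powr q" using M k t nonneg q_gt by (intro powr_mono2) auto
    then have "ennreal (u x powr q) * indicator \<Omega> x \<le> ennreal ((2 * t k) powr q) * indicator (A k) x"
      using xA True by (simp add: ennreal_leI)
    also have "\<dots> = (\<Sum>j\<in>{k}. ennreal ((2 * t j) powr q) * indicator (A j) x)"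
    proof -
      have "h k = (\<Sum>j\<in>{k}. h j)" for h :: "nat \<Rightarrow> ennreal" by simp
      then show ?thesis .
    qed
    also have "\<dots> \<le> (\<Sum>j. ennreal ((2 * t j) powr q) * indicator (A j) x)"
      by (intro sum_le_suminf) auto
    finally show ?thesis by (simp add: add_increasing)
  qed
  have "(\<integral>\<^sup>+x\<in>\<Omega>. ennreal (u x powr q) \<partial>lborel)
     \<le> (\<integral>\<^sup>+x. ennreal (\<epsilon> powr q) * indicator \<Omega> x + (\<Sum>k. ennreal ((2 * t k) powr q) * indicator (A k) x) \<partial>lborel)"
    by (intro nn_integral_mono pt)
  also have "\<dots> = ennreal (\<epsilon> powr q) * emeasure lborel \<Omega> + (\<Sum>k. ennreal ((2 * t k) powr q) * emeasure lborel (A k))"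
    by (simp add: nn_integral_add nn_integral_suminf nn_integral_cmult)
  also have "\<dots> \<le> ennreal (\<epsilon> powr q * vol \<Omega>) + ennreal (2 powr q * H)"
  proof (intro add_mono)
    show "ennreal (\<epsilon> powr q) * emeasure lborel \<Omega> \<le> ennreal (\<epsilon> powr q * vol \<Omega>)"
      using emeasure_subset_eq[of \<Omega>] by (simp add: ennreal_mult)
    show "(\<Sum>k. ennreal ((2 * t k) powr q) * emeasure lborel (A k)) \<le> ennreal (2 powr q * H)"
    proof (rule suminf_le_const)
      fix K
      have "(\<Sum>k<K. ennreal ((2 * t k) powr q) * emeasure lborel (A k))
         = (\<Sum>k<K. ennreal (2 powr q * (t k powr q * vol (A k))))"
      proof (rule sum.cong[OF refl])
        fix k
        have "emeasure lborel (A k) = ennreal (vol (A k))"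
          by (rule emeasure_subset_eq) (auto simp: A_def)
        then show "ennreal ((2 * t k) powr q) * emeasure lborel (A k) = ennreal (2 powr q * (t k powr q * vol (A k)))"
          using t(1)[of k] by (simp add: powr_mult ennreal_mult mult.assoc)
      qed
      also have "\<dots> = ennreal (2 powr q * (\<Sum>k<K. t k powr q * vol (A k)))"
        by (subst sum_ennreal) (auto simp: sum_distrib_left)
      also have "\<dots> \<le> ennreal (2 powr q * H)"
      proof (intro ennreal_leI mult_left_mono)
        have "(\<Sum>k<K. t k powr q * vol (A k)) \<le> (\<Sum>k\<le>K. t k powr q * vol (A k))"
          by (intro sum_mono2) auto
        also have "\<dots> \<le> H" using bound[of K] by (simp add: t_def A_def)
        finally show "(\<Sum>k<K. t k powr q * vol (A k)) \<le> H" .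
      qed auto
      finally show "(\<Sum>k<K. ennreal ((2 * t k) powr q) * emeasure lborel (A k)) \<le> ennreal (2 powr q * H)" .
    qed auto
  qed
  also have "\<dots> = ennreal (\<epsilon> powr q * vol \<Omega> + 2 powr q * H)"
    using H0 by (intro ennreal_plus[symmetric]) auto
  finally show ?thesis .
qed

text \<open>The lowest level \<open>\<epsilon>\<close> is arbitrary, and its contribution vanishes as it tends to 0.\<close>

lemma strong_bound:
  assumes hol: "holder_domain \<alpha> \<Omega>" and x0: "x0 \<in> \<Omega>"
  shows "\<exists>C>0. \<forall>u. u \<in> borel_measurable borel \<longrightarrow> (\<forall>x. 0 \<le> u x) \<longrightarrow>
     vol {z \<in> B x0. 0 < u z} \<le> vol (B x0) / 2 \<longrightarrow>
     (\<integral>\<^sup>+x\<in>\<Omega>. ennreal (u x powr q) \<partial>lborel) \<le> ennreal C * ennpowr (energy u) (q / p)"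
proof -
  let ?N = "\<lambda>u. \<integral>\<^sup>+x\<in>\<Omega>. ennreal (u x powr q) \<partial>lborel"
  obtain C where C: "0 < C" "\<And>v E A. separates v E A \<Longrightarrow> F v x0 \<le> 1 / 2 \<Longrightarrow>
     emeasure lborel E \<le> ennreal (C * vol A powr \<theta>) * energy v"
    using capacity_bound[OF hol x0] by blast
  define C' where "C' = 2 powr q * (2 * (2 powr q * C)) powr (q / p)"
  have C': "0 < C'" using C(1) by (simp add: C'_def)
  have "?N u \<le> ennreal C' * ennpowr (energy u) (q / p)"
    if u: "u \<in> borel_measurable borel" "\<forall>x. 0 \<le> u x"
      and half: "vol {z \<in> B x0. 0 < u z} \<le> vol (B x0) / 2" for u
  proof (cases "energy u")
    case top
    then show ?thesis using C' by (simp add: ennpowr_def ennreal_mult_top)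
  next
    case (real S)
    define G where "G = (1 + 2 powr q * 2) * vol \<Omega>"
    have G: "0 \<le> G" by (simp add: G_def)
    have bound: "?N u \<le> ennreal (\<epsilon> powr q * G + C' * S powr (q / p))" if "0 < \<epsilon>" for \<epsilon>
    proof -
      have "?N u \<le> ennreal (\<epsilon> powr q * vol \<Omega>
         + 2 powr q * (2 * (\<epsilon> powr q * vol \<Omega>) + (2 * (2 powr q * C * S)) powr (q / p)))"
        using u that by (intro layer_cake superlevel_bound[OF C x0 _ half _ _ that] real) auto
      also have "(2 * (2 powr q * C * S)) powr (q / p) = (2 * (2 powr q * C)) powr (q / p) * S powr (q / p)"
        using C(1) real by (subst powr_mult[symmetric]) (auto simp: mult_ac)
      also have "\<epsilon> powr q * vol \<Omega>
         + 2 powr q * (2 * (\<epsilon> powr q * vol \<Omega>) + (2 * (2 powr q * C)) powr (q / p) * S powr (q / p))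
        = \<epsilon> powr q * G + C' * S powr (q / p)"
        by (simp add: G_def C'_def algebra_simps)
      finally show ?thesis .
    qed
    have near: "?N u \<le> ennreal (C' * S powr (q / p)) + ennreal \<delta>" if "0 < \<delta>" for \<delta>
    proof -
      define \<epsilon> where "\<epsilon> = (\<delta> / (G + 1)) powr (1 / q)"
      have e: "0 < \<epsilon>" using that G by (simp add: \<epsilon>_def)
      have "\<epsilon> powr q = \<delta> / (G + 1)" using that G q_gt by (simp add: \<epsilon>_def powr_powr)
      then have "\<epsilon> powr q * G + \<epsilon> powr q = \<delta>" using G by (simp add: field_simps)
      then have "\<epsilon> powr q * G \<le> \<delta>" using powr_ge_zero[of \<epsilon> q] by linarith
      then have "ennreal (\<epsilon> powr q * G + C' * S powr (q / p)) \<le> ennreal (C' * S powr (q / p) + \<delta>)"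
        by (intro ennreal_leI) simp
      also have "\<dots> = ennreal (C' * S powr (q / p)) + ennreal \<delta>"
        using that C' by (intro ennreal_plus) auto
      finally show ?thesis using bound[OF e] by (rule order_trans[rotated])
    qed
    have "?N u \<le> ennreal (C' * S powr (q / p))"
      by (rule ennreal_le_epsilon) (rule near)
    also have "\<dots> = ennreal C' * ennpowr (energy u) (q / p)"
      using real C' by (simp add: ennpowr_def ennreal_mult)
    finally show ?thesis .
  qed
  then show ?thesis using C' by blast
qed

end

lemma frac_energy_mono:
  assumes "bounded_region \<Omega>" "0 \<le> p"
    and "\<And>x z. x \<in> \<Omega> \<Longrightarrow> z \<in> \<Omega> \<Longrightarrow> \<bar>u z - u x\<bar> \<le> \<bar>f z - f x\<bar>"
  shows "frac_energy s p b \<Omega> u \<le> frac_energy s p b \<Omega> f"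
  unfolding frac_energy_def
proof (intro nn_integral_mono)
  interpret bounded_region \<Omega> by fact
  fix x
  let ?I = "\<lambda>f. \<integral>\<^sup>+z\<in>{z. norm (x - z) \<le> d x / 2}. ennreal (\<bar>f z - f x\<bar> powr p / norm (z - x) powr (real DIM('a) + s * p)
                     * min (d x) (d z) powr b) \<partial>lborel"
  have "?I u \<le> ?I f" if x: "x \<in> \<Omega>"
  proof (rule nn_integral_mono)
    fix z
    have "z \<in> \<Omega>" if "norm (x - z) \<le> d x / 2"
      using mem_region[OF x, of z] that d_pos[OF x] by (simp add: dist_norm)
    then show "ennreal (\<bar>u z - u x\<bar> powr p / norm (z - x) powr (real DIM('a) + s * p) * min (d x) (d z) powr b)
         * indicator {z. norm (x - z) \<le> d x / 2} z
       \<le> ennreal (\<bar>f z - f x\<bar> powr p / norm (z - x) powr (real DIM('a) + s * p) * min (d x) (d z) powr b)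
         * indicator {z. norm (x - z) \<le> d x / 2} z"
      using assms(2,3) x
      by (auto split: split_indicator intro!: ennreal_leI mult_right_mono divide_right_mono powr_mono2)
  qed
  then show "?I u * indicator \<Omega> x \<le> ?I f * indicator \<Omega> x" by (auto split: split_indicator)
qed

lemma ennpowr_le:
  assumes le: "I \<le> ennreal c * ennpowr W (q / p)" and pos: "0 < c" "0 < p" "0 < q"
  shows "ennpowr I (1 / q) \<le> ennreal (c powr (1 / q)) * ennpowr W (1 / p)"
proof (cases W)
  case top
  then show ?thesis using pos by (simp add: ennpowr_def ennreal_mult_top)
next
  case (real S)
  then have "I \<le> ennreal (c * S powr (q / p))" using le pos by (simp add: ennpowr_def ennreal_mult)
  then obtain i where i: "I = ennreal i" "0 \<le> i" "i \<le> c * S powr (q / p)"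
    using pos real by (cases I) (auto simp: top_unique)
  have "i powr (1 / q) \<le> (c * S powr (q / p)) powr (1 / q)" using i pos by (intro powr_mono2) auto
  also have "\<dots> = c powr (1 / q) * S powr (1 / p)" using pos real by (simp add: powr_mult powr_powr)
  finally have "ennreal (i powr (1 / q)) \<le> ennreal (c powr (1 / q) * S powr (1 / p))" by (rule ennreal_leI)
  then show ?thesis using i real by (simp add: ennpowr_def ennreal_mult)
qed

theorem theorem5p1:
  fixes \<Omega> :: "(real ^ 'n) set" and \<alpha> s p q b :: real
  assumes "CARD('n) \<ge> 2"
    and "0 < \<alpha>" and "\<alpha> \<le> 1"
    and "holder_domain \<alpha> \<Omega>"
    and "0 < s" and "s < 1"
    and "1 < p" and "p \<le> q"
    and "b \<le> p * (s - real CARD('n))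
              + p * (real CARD('n) - 1 + \<alpha>) * (1 + 1 / q - 1 / p)"
    and "p < real CARD('n) / s \<Longrightarrow> q \<le> real CARD('n) * p / (real CARD('n) - s * p)"
  shows "\<exists>C::real. C > 0 \<and>
    (\<forall>f. smooth_on f \<Omega> \<longrightarrow>
       (INF c::real. Lq_norm q \<Omega> (\<lambda>x. f x - c))
         \<le> ennreal C * weighted_frac_seminorm s p b \<Omega> f)"
proof -
  let ?N = "\<lambda>u. \<integral>\<^sup>+x\<in>\<Omega>. ennreal (u x powr q) \<partial>lborel"
  define n where "n = real CARD('n)"
  define \<theta> where "\<theta> = 1 - p / q"
  have q: "1 < q" using assms by simp
  have n0: "0 < n" using assms(1) by (simp add: n_def)
  have theta: "\<theta> * n \<le> s * p"
  proof (cases "p < n / s")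
    case True
    then have sp: "0 < n - s * p" using assms(5) by (simp add: field_simps)
    have "q \<le> n * p / (n - s * p)" using assms(10) True by (simp add: n_def)
    then have "q * (n - s * p) \<le> n * p" using sp by (simp add: le_divide_eq)
    then have "(n - s * p) \<le> n * p / q" using q by (simp add: le_divide_eq mult.commute)
    then show ?thesis by (simp add: \<theta>_def algebra_simps)
  next
    case False
    then have "n \<le> s * p" using assms(5) by (simp add: field_simps)
    moreover have "\<theta> * n \<le> 1 * n" using n0 assms q by (intro mult_right_mono) (auto simp: \<theta>_def)
    ultimately show ?thesis by simp
  qed
  interpret sobolev_exponents \<Omega> \<alpha> s p q b n "p * (s - n) + p * (n - 1 + \<alpha>) * (1 + 1 / q - 1 / p)"
     "p * (s - n) + p * (n - 1 + \<alpha>) * (1 + 1 / q - 1 / p) - n - s * p" "1 - p / q"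
  proof unfold_locales
    show "open \<Omega>" "connected \<Omega>" "\<Omega> \<noteq> {}" "bounded \<Omega>"
      using assms(4) by (auto simp: holder_domain_def)
    show "n = real DIM(real ^ 'n)" by (simp add: n_def)
    show "(1 - p / q) * n \<le> s * p" using theta by (simp add: \<theta>_def)
    show "b \<le> p * (s - n) + p * (n - 1 + \<alpha>) * (1 + 1 / q - 1 / p)" using assms(9) by (simp add: n_def)
  qed (use assms in auto)
  obtain x0 where x0: "x0 \<in> \<Omega>" using region_ne by blast
  obtain C where C: "0 < C" "\<And>u. u \<in> borel_measurable borel \<Longrightarrow> (\<forall>x. 0 \<le> u x) \<Longrightarrow>
     vol {z \<in> B x0. 0 < u z} \<le> vol (B x0) / 2 \<Longrightarrow>
     ?N u \<le> ennreal C * ennpowr (energy u) (q / p)"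
    using strong_bound[OF assms(4) x0] by blast
  have main: "(INF c. Lq_norm q \<Omega> (\<lambda>x. f x - c)) \<le> ennreal ((2 * C) powr (1 / q)) * weighted_frac_seminorm s p b \<Omega> f"
    if smooth: "smooth_on f \<Omega>" for f
  proof -
    have "continuous_on \<Omega> f" using smooth unfolding smooth_on_def by (metis Ck_on.simps(1))
    define g where "g = (\<lambda>x. if x \<in> \<Omega> then f x else 0)"
    have g [measurable]: "g \<in> borel_measurable borel"
      unfolding g_def by (intro borel_measurable_continuous_on_if \<open>continuous_on \<Omega> f\<close> measurable_region) auto
    \<comment> \<open>for a median over \<open>B x0\<close> both parts of \<open>g - m\<close> vanish on at least half of that ball,
      so that the averages of their layers at \<open>x0\<close> are at most \<open>1 / 2\<close>\<close>
    obtain m where m: "vol (B x0 \<inter> {z. m < g z}) \<le> vol (B x0) / 2"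
       "vol (B x0 \<inter> {z. g z < m}) \<le> vol (B x0) / 2"
      using median_exists[OF g wball_sets wball_bounded measure_wball_pos[OF x0]] by blast
    define u1 where "u1 x = max 0 (g x - m)" for x
    define u2 where "u2 x = max 0 (m - g x)" for x
    have [measurable]: "u1 \<in> borel_measurable borel" "u2 \<in> borel_measurable borel"
      unfolding u1_def u2_def by measurable
    have e1: "energy u1 \<le> energy f"
      by (rule frac_energy_mono) (use assms in \<open>auto simp: u1_def g_def bounded_region_axioms\<close>)
    have e2: "energy u2 \<le> energy f"
      by (rule frac_energy_mono) (use assms in \<open>auto simp: u2_def g_def bounded_region_axioms\<close>)
    have mono: "ennpowr a r \<le> ennpowr a' r" if "a \<le> a'" "0 < r" for a a' r
      using that by (cases a; cases a') (auto simp: ennpowr_def top_unique intro!: ennreal_leI powr_mono2)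
    have qp: "0 < q / p" using q assms by simp
    have i1: "?N u1 \<le> ennreal C * ennpowr (energy f) (q / p)"
    proof -
      have "?N u1 \<le> ennreal C * ennpowr (energy u1) (q / p)"
      proof (rule C(2))
        have "{z \<in> B x0. 0 < u1 z} = (B x0 \<inter> {z. m < g z})" by (auto simp: u1_def)
        then show "vol {z \<in> B x0. 0 < u1 z} \<le> vol (B x0) / 2" using m(1) by simp
      qed (auto simp: u1_def)
      also have "\<dots> \<le> ennreal C * ennpowr (energy f) (q / p)" by (intro mult_left_mono mono e1 qp) auto
      finally show ?thesis .
    qed
    have i2: "?N u2 \<le> ennreal C * ennpowr (energy f) (q / p)"
    proof -
      have "?N u2 \<le> ennreal C * ennpowr (energy u2) (q / p)"
      proof (rule C(2))
        have "{z \<in> B x0. 0 < u2 z} = (B x0 \<inter> {z. g z < m})" by (auto simp: u2_def)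
        then show "vol {z \<in> B x0. 0 < u2 z} \<le> vol (B x0) / 2" using m(2) by simp
      qed (auto simp: u2_def)
      also have "\<dots> \<le> ennreal C * ennpowr (energy f) (q / p)" by (intro mult_left_mono mono e2 qp) auto
      finally show ?thesis .
    qed
    have "(\<integral>\<^sup>+x\<in>\<Omega>. ennreal (\<bar>f x - m\<bar> powr q) \<partial>lborel)
       \<le> (\<integral>\<^sup>+x. ennreal (u1 x powr q) * indicator \<Omega> x + ennreal (u2 x powr q) * indicator \<Omega> x \<partial>lborel)"
      using q by (intro nn_integral_mono) (auto simp: u1_def u2_def g_def max_def split: split_indicator)
    also have "\<dots> = ?N u1 + ?N u2"
      by (intro nn_integral_add) auto
    also have "\<dots> \<le> ennreal C * ennpowr (energy f) (q / p) + ennreal C * ennpowr (energy f) (q / p)"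
      by (intro add_mono i1 i2)
    also have "\<dots> = ennreal (2 * C) * ennpowr (energy f) (q / p)"
    proof -
      have "ennreal (2 * C) = ennreal C + ennreal C" using C(1) by (simp flip: ennreal_plus)
      then show ?thesis by (simp add: distrib_right)
    qed
    finally have "Lq_norm q \<Omega> (\<lambda>x. f x - m) \<le> ennreal ((2 * C) powr (1 / q)) * ennpowr (energy f) (1 / p)"
      unfolding Lq_norm_def using C(1) q assms by (intro ennpowr_le) auto
    also have "ennpowr (energy f) (1 / p) = weighted_frac_seminorm s p b \<Omega> f"
      by (simp add: weighted_frac_seminorm_def frac_energy_def)
    finally show ?thesis by (rule INF_lower2[OF UNIV_I])
  qed
  have "0 < (2 * C) powr (1 / q)" using C(1) by simp
  then show ?thesis using main by blast
qed

end
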